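(* Let $\tilde\epsilon_n = 1+8/\epsilon_n$ and $\varpi_n = \dfrac{q}{\sqrt{\log n}} + \dfrac{pq}{n\epsilon_n} + e^{9\rho_n}\left(1+\dfrac{8}{\epsilon_n}\right)^2$. Suppose $\boldsymbol\theta\in B(\boldsymbol\theta^*,\epsilon_{n1})$ and $\boldsymbol\gamma\in B(\boldsymbol\gamma^*,\epsilon_{n2})$ (so that $|Z_{ij}^T\boldsymbol\gamma+\alpha_i+\beta_j|\le\rho_n$ for all $i\neq j$). If $$\tilde\epsilon_n e^{6\rho_n} = o\left(\sqrt{\frac{n}{\log n}}\right),\qquad \varpi_n\lambda_n^2 e^{9\rho_n} = o\left(\frac{n}{\log n}\right),$$ then, as $n\to\infty$, with probability tending to one the differentially private moment estimators $\widehat{\boldsymbol\theta}$ and $\widehat{\boldsymbol\gamma}$ exist, and they satisfy $$\|\widehat{\boldsymbol\theta}-\boldsymbol\theta^*\|_\infty = O_p\left(e^{3\rho_n}\tilde\epsilon_n\sqrt{\frac{\log n}{n}}\right),\qquad \|\widehat{\boldsymbol\gamma}-\boldsymbol\gamma^*\|_\infty = O_p\left(\frac{\varpi_n\lambda_n\log n}{n}\right).$$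
   Context: Model. For each $n\ge2$, $A=(a_{ij})_{n\times n}$ is the adjacency matrix of a random directed graph on nodes $1,\dots,n$ without self-loops ($a_{ii}=0$, $a_{ij}\in\{0,1\}$). The edges $a_{ij}$, $i\ne j$, are mutually independent Bernoulli variables with $$P(a_{ij}=1)=\mu(Z_{ij}^T\boldsymbol\gamma^*+\alpha_i^*+\beta_j^* ),\qquad \mu(x)=\frac{e^x}{1+e^x},$$ where $Z_{ij}\in\mathbb R^p$ are given covariate vectors ($p$ fixed), $\boldsymbol\gamma\in\mathbb R^p$, and $\boldsymbol\theta=(\alpha_1,\dots,\alpha_n,\beta_1,\dots,\beta_{n-1})^T$, with the identification convention $\beta_n=0$. True values are denoted by a star. Put $q=\max_{i,j}\|Z_{ij}\|_\infty$, assumed to be a constant. Private statistics. Let $d_i=\sum_{j\ne i}a_{ij}$, $b_j=\sum_{i\ne j}a_{ij}$. For a privacy parameter $\epsilon_n>0$ the released statistics are $\widetilde d_i=d_i+e_i^+$, $\widetilde b_j=b_j+e_j^-$ ($i,j=1,\dots,n$), and $\widetilde{\mathbf y}=\sum_{i\ne j}Z_{ij}a_{ij}+(\eta_1,\dots,\eta_p)^T$ (sum over all ordered pairs $i\neq j$). All noise variables are independent of each other and of $A$; the $e_i^+,e_j^-$ are discrete Laplace: $P(X=x)=\frac{1-\alpha}{1+\alpha}\alpha^{|x|}$, $x\in\mathbb Z$, with $\alpha=e^{-\epsilon_n/2}$; the $\eta_t$ are continuous Laplace with density $\frac1{2\alpha}e^{-|x|/\alpha}$, $\alpha=pq/\epsilon_n$.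 Estimators. $(\widehat{\boldsymbol\theta},\widehat{\boldsymbol\gamma})$ (with $\hat\beta_n=0$) is the solution, when it exists, of $$\widetilde d_i=\sum_{j\ne i}\mu(Z_{ij}^T\boldsymbol\gamma+\alpha_i+\beta_j)\ (1\le i\le n),\quad \widetilde b_j=\sum_{i\ne j}\mu(Z_{ij}^T\boldsymbol\gamma+\alpha_i+\beta_j)\ (1\le j\le n-1),\quad \widetilde{\mathbf y}=\sum_{i\neq j}Z_{ij}\,\mu(Z_{ij}^T\boldsymbol\gamma+\alpha_i+\beta_j).$$ Notation. $\|\mathbf x\|_\infty=\max_i|x_i|$; for matrices $\|J\|_\infty=\max_i\sum_j|J_{ij}|$; $B(\mathbf x,\epsilon)=\{\mathbf y:\|\mathbf x-\mathbf y\|_\infty\le\epsilon\}$. $\epsilon_{n1},\epsilon_{n2}$ are small positive numbers and $$\rho_n=\max_{i\ne j}|\alpha_i^*+\beta_j^*|+2\epsilon_{n1}+pq\|\boldsymbol\gamma^*\|_\infty+pq\,\epsilon_{n2}.$$ Let $F=(F_1,\dots,F_{2n-1})^T$ with $F_i(\boldsymbol\theta,\boldsymbol\gamma)=\widetilde d_i-\sum_{j\ne i}\mu(Z_{ij}^T\boldsymbol\gamma+\alpha_i+\beta_j)$ for $i\le n$, $F_{n+j}(\boldsymbol\theta,\boldsymbol\gamma)=\widetilde b_j-\sum_{i\ne j}\mu(Z_{ij}^T\boldsymbol\gamma+\alpha_i+\beta_j)$ for $j\le n-1$, and $Q(\boldsymbol\theta,\boldsymbol\gamma)=\widetilde{\mathbf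 y}-\sum_{i\ne j}Z_{ij}\mu(Z_{ij}^T\boldsymbol\gamma+\alpha_i+\beta_j)$. Define $$H(\boldsymbol\theta,\boldsymbol\gamma)=-\left(\frac{\partial Q}{\partial\boldsymbol\gamma^T}-\frac{\partial Q}{\partial\boldsymbol\theta^T}\left[\frac{\partial F}{\partial\boldsymbol\theta^T}\right]^{-1}\frac{\partial F}{\partial\boldsymbol\gamma^T}\right)(\boldsymbol\theta,\boldsymbol\gamma).$$ Standing assumptions: $H(\boldsymbol\theta,\boldsymbol\gamma)$ is positive definite, and $\lambda_n$ is a number such that $\sup_{\boldsymbol\theta\in B(\boldsymbol\theta^*,\epsilon_{n1})}\|H^{-1}(\boldsymbol\theta,\boldsymbol\gamma^* )\|_\infty\le\lambda_n/n^2$. All quantities may depend on $n$ unless said to be fixed. *)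

theory Defs
  imports
    "HOL-Probability.Probability"
    "HOL-Library.Landau_Symbols"
    "Jordan_Normal_Form.Gauss_Jordan_Elimination"
begin

(* Vectors and matrices have dimensions depending on n, so they are the carrier-based ones of
   Jordan_Normal_Form; the type-indexed ones of HOL-Analysis are hidden. *)
unbundle no vec_syntax
unbundle no inner_syntax
hide_type (open) Finite_Cartesian_Product.vec
hide_const (open) Finite_Cartesian_Product.vec Finite_Cartesian_Product.vec_nth
hide_const (open) Finite_Cartesian_Product.mat Determinants.det

(* Max is applied to a nonempty set as soon as the dimension is positive, which is the only case
   in which these norms are used; similarly for the maxima over ordered pairs below, if n \<ge> 2. *)
definition vec_norm_inf :: "real vec \<Rightarrow> real" where
  "vec_norm_inf x = Max ((\<lambda>i. \<bar>x $ i\<bar>) ` {..<dim_vec x})"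

definition mat_norm_inf :: "real mat \<Rightarrow> real" where
  "mat_norm_inf J = Max ((\<lambda>i. \<Sum>j<dim_col J. \<bar>J $$ (i, j)\<bar>) ` {..<dim_row J})"

definition ball_inf :: "real vec \<Rightarrow> real \<Rightarrow> real vec set" where
  "ball_inf x r = {y \<in> carrier_vec (dim_vec x). vec_norm_inf (x - y) \<le> r}"

definition jacobian :: "(real vec \<Rightarrow> real vec) \<Rightarrow> real vec \<Rightarrow> real mat" where
  "jacobian f x =
     mat (dim_vec (f x)) (dim_vec x) (\<lambda>(r, c). deriv (\<lambda>t. f (x |\<^sub>v c \<mapsto> t) $ r) (x $ c))"

definition positive_definite :: "real mat \<Rightarrow> bool" where
  "positive_definite A \<longleftrightarrow>
     A \<in> carrier_mat (dim_row A) (dim_row A) \<and> transpose_mat A = A \<and>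
     (\<forall>x \<in> carrier_vec (dim_row A). x \<noteq> 0\<^sub>v (dim_row A) \<longrightarrow> x \<bullet> (A *\<^sub>v x) > 0)"

(* None is returned by mat_inverse exactly for singular matrices; in that case this is unspecified. *)
definition inv_mat :: "real mat \<Rightarrow> real mat" where
  "inv_mat A = the (mat_inverse A)"

(* The nodes are 0, ..., n - 1 and the covariate coordinates are 0, ..., p - 1. *)
definition node_pairs :: "nat \<Rightarrow> (nat \<times> nat) set" where
  "node_pairs n = {(i, j). i < n \<and> j < n \<and> i \<noteq> j}"

definition mu :: "real \<Rightarrow> real" where
  "mu x = exp x / (1 + exp x)"

(* A parameter vector of length 2n - 1 is (\<alpha>_0, ..., \<alpha>_{n-1}, \<beta>_0, ..., \<beta>_{n-2});
   the in-parameter of the last node is 0 by the identification convention. *)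
definition out_par :: "real vec \<Rightarrow> nat \<Rightarrow> real" where
  "out_par \<theta> i = \<theta> $ i"

definition in_par :: "nat \<Rightarrow> real vec \<Rightarrow> nat \<Rightarrow> real" where
  "in_par n \<theta> j = (if j < n - 1 then \<theta> $ (n + j) else 0)"

(* Here and below, Z i j is the covariate vector of the ordered pair (i, j). *)
definition lin_pred ::
  "nat \<Rightarrow> (nat \<Rightarrow> nat \<Rightarrow> real vec) \<Rightarrow> real vec \<Rightarrow> real vec \<Rightarrow> nat \<Rightarrow> nat \<Rightarrow> real" where
  "lin_pred n Z \<theta> \<gamma> i j = Z i j \<bullet> \<gamma> + out_par \<theta> i + in_par n \<theta> j"

(* With w i j the edge weights these are the (non-private) degree and covariate statistics, and with
   w i j = mu (...) their expectations. *)
definition out_sum :: "nat \<Rightarrow> (nat \<Rightarrow> nat \<Rightarrow> real) \<Rightarrow> nat \<Rightarrow> real" where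
  "out_sum n w i = (\<Sum>j\<in>{..<n} - {i}. w i j)"

definition in_sum :: "nat \<Rightarrow> (nat \<Rightarrow> nat \<Rightarrow> real) \<Rightarrow> nat \<Rightarrow> real" where
  "in_sum n w j = (\<Sum>i\<in>{..<n} - {j}. w i j)"

definition cov_sum ::
  "nat \<Rightarrow> nat \<Rightarrow> (nat \<Rightarrow> nat \<Rightarrow> real vec) \<Rightarrow> (nat \<Rightarrow> nat \<Rightarrow> real) \<Rightarrow> real vec" where
  "cov_sum n p Z w = vec p (\<lambda>t. \<Sum>(i, j)\<in>node_pairs n. Z i j $ t * w i j)"

definition mean_edge ::
  "nat \<Rightarrow> (nat \<Rightarrow> nat \<Rightarrow> real vec) \<Rightarrow> real vec \<Rightarrow> real vec \<Rightarrow> nat \<Rightarrow> nat \<Rightarrow> real" where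
  "mean_edge n Z \<theta> \<gamma> i j = mu (lin_pred n Z \<theta> \<gamma> i j)"

(* d, b and y are the observed (noisy) out-degrees, in-degrees and covariate statistic. *)
definition moment_solution ::
  "nat \<Rightarrow> nat \<Rightarrow> (nat \<Rightarrow> nat \<Rightarrow> real vec) \<Rightarrow> (nat \<Rightarrow> real) \<Rightarrow> (nat \<Rightarrow> real) \<Rightarrow> real vec \<Rightarrow>
   real vec \<Rightarrow> real vec \<Rightarrow> bool" where
  "moment_solution n p Z d b y \<theta> \<gamma> \<longleftrightarrow>
     \<theta> \<in> carrier_vec (2 * n - 1) \<and> \<gamma> \<in> carrier_vec p \<and>
     (\<forall>i<n. d i = out_sum n (mean_edge n Z \<theta> \<gamma>) i) \<and>
     (\<forall>j<n - 1. b j = in_sum n (mean_edge n Z \<theta> \<gamma>) j) \<and>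
     y = cov_sum n p Z (mean_edge n Z \<theta> \<gamma>)"

definition F_map ::
  "nat \<Rightarrow> (nat \<Rightarrow> nat \<Rightarrow> real vec) \<Rightarrow> (nat \<Rightarrow> real) \<Rightarrow> (nat \<Rightarrow> real) \<Rightarrow>
   real vec \<Rightarrow> real vec \<Rightarrow> real vec" where
  "F_map n Z d b \<theta> \<gamma> = vec (2 * n - 1) (\<lambda>k.
     if k < n then d k - out_sum n (mean_edge n Z \<theta> \<gamma>) k
     else b (k - n) - in_sum n (mean_edge n Z \<theta> \<gamma>) (k - n))"

definition Q_map ::
  "nat \<Rightarrow> nat \<Rightarrow> (nat \<Rightarrow> nat \<Rightarrow> real vec) \<Rightarrow> real vec \<Rightarrow> real vec \<Rightarrow> real vec \<Rightarrow> real vec" where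
  "Q_map n p Z y \<theta> \<gamma> = y - cov_sum n p Z (mean_edge n Z \<theta> \<gamma>)"

(* The data d, b, y enter F_map and Q_map as additive constants only, so H_mat does not depend on
   them.  For positive p, H_mat can be positive definite only if n is large: the n * (n - 1) ordered
   pairs must leave at least p dimensions after the 2n - 1 node parameters are projected out; for
   n = 2 the Jacobian of F_map in \<theta> is even singular. *)
definition H_mat ::
  "nat \<Rightarrow> nat \<Rightarrow> (nat \<Rightarrow> nat \<Rightarrow> real vec) \<Rightarrow> (nat \<Rightarrow> real) \<Rightarrow> (nat \<Rightarrow> real) \<Rightarrow> real vec \<Rightarrow>
   real vec \<Rightarrow> real vec \<Rightarrow> real mat" where
  "H_mat n p Z d b y \<theta> \<gamma> =
     - (jacobian (\<lambda>g. Q_map n p Z y \<theta> g) \<gamma>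
        - jacobian (\<lambda>x. Q_map n p Z y x \<gamma>) \<theta>
          * inv_mat (jacobian (\<lambda>x. F_map n Z d b x \<gamma>) \<theta>)
          * jacobian (\<lambda>g. F_map n Z d b \<theta> g) \<gamma>)"

definition rho ::
  "nat \<Rightarrow> nat \<Rightarrow> real \<Rightarrow> real vec \<Rightarrow> real vec \<Rightarrow> real \<Rightarrow> real \<Rightarrow> real" where
  "rho n p q \<theta> \<gamma> \<epsilon>1 \<epsilon>2 =
     Max ((\<lambda>(i, j). \<bar>out_par \<theta> i + in_par n \<theta> j\<bar>) ` node_pairs n)
     + 2 * \<epsilon>1 + real p * q * vec_norm_inf \<gamma> + real p * q * \<epsilon>2"

datatype source = Edge nat nat | Out_noise nat | In_noise nat | Cov_noise nat

definition sources :: "nat \<Rightarrow> nat \<Rightarrow> source set" where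
  "sources n p = (\<lambda>(i, j). Edge i j) ` node_pairs n
     \<union> Out_noise ` {..<n} \<union> In_noise ` {..<n} \<union> Cov_noise ` {..<p}"

definition source_var ::
  "(nat \<Rightarrow> nat \<Rightarrow> 'w \<Rightarrow> real) \<Rightarrow> (nat \<Rightarrow> 'w \<Rightarrow> int) \<Rightarrow> (nat \<Rightarrow> 'w \<Rightarrow> int) \<Rightarrow> (nat \<Rightarrow> 'w \<Rightarrow> real) \<Rightarrow>
   source \<Rightarrow> 'w \<Rightarrow> real" where
  "source_var a ep em eta s = (case s of
       Edge i j \<Rightarrow> a i j
     | Out_noise i \<Rightarrow> (\<lambda>\<omega>. real_of_int (ep i \<omega>))
     | In_noise j \<Rightarrow> (\<lambda>\<omega>. real_of_int (em j \<omega>))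
     | Cov_noise t \<Rightarrow> eta t)"

definition discrete_laplace :: "'w measure \<Rightarrow> real \<Rightarrow> ('w \<Rightarrow> int) \<Rightarrow> bool" where
  "discrete_laplace M \<alpha> X \<longleftrightarrow>
     (\<forall>x. measure M {\<omega> \<in> space M. X \<omega> = x} = (1 - \<alpha>) / (1 + \<alpha>) * \<alpha> ^ nat \<bar>x\<bar>)"

definition laplace_density :: "real \<Rightarrow> real \<Rightarrow> real" where
  "laplace_density \<alpha> x = 1 / (2 * \<alpha>) * exp (- \<bar>x\<bar> / \<alpha>)"

(* The next two notions use inner resp. outer probabilities, so that they are meaningful without
   any measurability of the event or variable; for measurable ones they are the usual notions
   "with probability tending to one" and "X_n = O_p(r_n)". *)
definition with_prob_tending_to_one ::
  "(nat \<Rightarrow> 'w measure) \<Rightarrow> (nat \<Rightarrow> 'w \<Rightarrow> bool) \<Rightarrow> bool" where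
  "with_prob_tending_to_one M P \<longleftrightarrow>
     (\<exists>E. (\<forall>n. E n \<in> sets (M n) \<and> (\<forall>\<omega>\<in>E n. P n \<omega>)) \<and> (\<lambda>n. measure (M n) (E n)) \<longlonglongrightarrow> 1)"

definition big_O_p ::
  "(nat \<Rightarrow> 'w measure) \<Rightarrow> (nat \<Rightarrow> 'w \<Rightarrow> real) \<Rightarrow> (nat \<Rightarrow> real) \<Rightarrow> bool" where
  "big_O_p M X r \<longleftrightarrow>
     (\<forall>\<delta>>0. \<exists>C>0. \<forall>\<^sub>F n in sequentially.
        \<exists>E\<in>sets (M n). {\<omega> \<in> space (M n). \<bar>X n \<omega>\<bar> > C * \<bar>r n\<bar>} \<subseteq> E \<and> measure (M n) E \<le> \<delta>)"

end

(*
  Write the moment equations as sum_e X_e (mu(x_e + X_e u) - mu(x_e)) = g, where e runs over the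
  ordered pairs, X_e is the gradient of the linear predictor, x_e its true value, u the deviation from
  the true parameter and g the noise in the observed statistics.  Replace each increment of mu by its
  linear continuation outside [-r, r]: all slopes then stay within a factor 1 +- 2r of the true weights
  mu'(x_e), so a fixed-point iteration that contracts the norm of the true Hessian solves the modified
  equations, and every estimate for its solution holds without a smallness assumption.

  A maximum principle for the bipartite graph of out- and in-parameters bounds the node part of u in
  the sup norm by e^(3 rho) times (noise / n + covariate part).  Projecting the covariates onto the node
  effects makes H the Gram matrix of the residuals; hence lambda_n / n^2 bounds the covariate part by
  the projected noise, of order n e^(3 rho) (1 + 8 / epsilon) by Chebyshev's inequality because the
  edge part of its variance is at most that of the unprojected covariate statistic, plus a second-order remainder
  of relative size r.  With r of the order e^(3 rho) (1 + 8 / epsilon) sqrt(log n / n) the two rate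
  conditions close the argument: |X_e u| <= r for all e, so u solves the original equations.

  Uniqueness, by strict monotonicity of mu, identifies this solution with the estimator.
*)
theory Submission
  imports Defs "Jordan_Normal_Form.Determinant" "HOL-Real_Asymp.Real_Asymp"
begin

section \<open>Linear and nearly linear systems\<close>

text \<open>The exponent 3 is the price of the maximum principle: with weights of at least
  \<open>m\<close>, of order exp(-\<rho>), a bound is divided by \<open>m\<close> three times, once
  at the extremal node, once to reach the nodes of its class and once to return to the other class.
  The missing pairs (i, i) are the obstacle there: the partner of the extremal node does not occur
  in its equation and is absorbed because \<open>m\<close>^2 n is bounded below. The number of node
  parameters grows, and only the maximum principle controls each of them separately; the p covariate
  parameters are controlled through H. The two bounds feed into each other, and the second rate
  condition makes the feedback factor small. Every estimate thus holds with probability 1 - \<delta>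
  and a constant depending on \<delta>. For O_p this is the right form; for existence a single
  sequence of events is extracted afterwards.\<close>

lemma inv_mat_trivial_kernel:
  assumes A: "A \<in> carrier_mat N N"
    and kernel: "\<And>v. v \<in> carrier_vec N \<Longrightarrow> A *\<^sub>v v = 0\<^sub>v N \<Longrightarrow> v = 0\<^sub>v N"
  shows "inv_mat A \<in> carrier_mat N N" "A * inv_mat A = 1\<^sub>m N" "inv_mat A * A = 1\<^sub>m N"
proof -
  have "det A \<noteq> 0" using det_0_iff_vec_prod_zero_field[OF A] kernel by blast
  then have "A \<in> Units (ring_mat TYPE(real) N ())" by (rule det_non_zero_imp_unit[OF A])
  then obtain B where "mat_inverse A = Some B"
    using mat_inverse(1)[OF A, of "()"] by (metis option.exhaust)
  then show "inv_mat A \<in> carrier_mat N N" "A * inv_mat A = 1\<^sub>m N" "inv_mat A * A = 1\<^sub>m N"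
    using mat_inverse(2)[OF A] by (auto simp: inv_mat_def)
qed

text \<open>Injectivity of a square matrix gives surjectivity. The unknowns are functions on
  \<open>nat\<close>, so that the iteration and the designs below can be written with plain
  sums.\<close>

lemma linear_system_solvable:
  fixes A :: "nat \<Rightarrow> nat \<Rightarrow> real"
  assumes "\<And>v. (\<forall>i<N. (\<Sum>j<N. A i j * v j) = 0) \<Longrightarrow> \<forall>j<N. v j = 0"
  shows "\<exists>v. \<forall>i<N. (\<Sum>j<N. A i j * v j) = g i"
proof -
  define M where "M = mat N N (\<lambda>(i, j). A i j)"
  have M: "M \<in> carrier_mat N N" by (simp add: M_def)
  have mv: "(M *\<^sub>v v) $ i = (\<Sum>j<N. A i j * v $ j)" if "v \<in> carrier_vec N" "i < N" for v i
    using that by (auto simp: M_def scalar_prod_def lessThan_atLeast0 intro!: sum.cong)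
  have "v = 0\<^sub>v N" if v: "v \<in> carrier_vec N" "M *\<^sub>v v = 0\<^sub>v N" for v
  proof -
    have "\<forall>i<N. (\<Sum>j<N. A i j * v $ j) = 0"
      using mv[OF v(1)] v(2) by (metis index_zero_vec(1))
    then have "\<forall>j<N. v $ j = 0" by (rule assms)
    then show ?thesis using v(1) by (intro eq_vecI) auto
  qed
  note B = inv_mat_trivial_kernel(1,2)[OF M this]
  define u where "u = inv_mat M *\<^sub>v vec N g"
  have u: "u \<in> carrier_vec N" unfolding u_def using B by (intro mult_mat_vec_carrier) auto
  have "M *\<^sub>v u = vec N g"
    unfolding u_def using B M by (subst assoc_mult_mat_vec[symmetric]) auto
  then have "\<forall>i<N. (\<Sum>j<N. A i j * u $ j) = g i" using mv[OF u] by (metis index_vec)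
  then show ?thesis by (intro exI[of _ "\<lambda>j. u $ j"])
qed

text \<open>Pairing the system with \<open>v\<close> yields the weighted sum of squares of the
  values of \<open>X\<close> on \<open>v\<close>, so each square vanishes.\<close>

lemma weighted_gram_trivial_kernel:
  fixes X :: "'e \<Rightarrow> nat \<Rightarrow> real" and w :: "'e \<Rightarrow> real"
  assumes E: "finite E" and w: "\<And>e. e \<in> E \<Longrightarrow> w e > 0"
    and kernel: "\<And>v. (\<forall>e\<in>E. (\<Sum>k<N. X e k * v k) = 0) \<Longrightarrow> \<forall>k<N. v k = 0"
    and zero: "\<forall>i<N. (\<Sum>j<N. (\<Sum>e\<in>E. w e * X e i * X e j) * v j) = 0"
  shows "\<forall>k<N. v k = 0"
proof (rule kernel)
  have "(\<Sum>e\<in>E. w e * (\<Sum>k<N. X e k * v k)\<^sup>2)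
      = (\<Sum>e\<in>E. \<Sum>i<N. \<Sum>j<N. v i * (w e * X e i * X e j * v j))"
    by (intro sum.cong refl) (simp add: power2_eq_square sum_product sum_distrib_left ac_simps)
  also have "\<dots> = (\<Sum>i<N. v i * (\<Sum>j<N. (\<Sum>e\<in>E. w e * X e i * X e j) * v j))"
    by (subst sum.swap, intro sum.cong refl, subst sum.swap)
       (simp add: sum_distrib_left sum_distrib_right)
  also have "\<dots> = 0" using zero by simp
  finally have "(\<Sum>e\<in>E. w e * (\<Sum>k<N. X e k * v k)\<^sup>2) = 0" .
  then have "\<forall>e\<in>E. w e * (\<Sum>k<N. X e k * v k)\<^sup>2 = 0"
    using w E by (subst (asm) sum_nonneg_eq_0_iff) (simp_all add: less_imp_le)
  then show "\<forall>e\<in>E. (\<Sum>k<N. X e k * v k) = 0" using w by fastforce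
qed

text \<open>Solves the estimating equations by the iteration
  \<open>z \<mapsto> z + A\<^sup>-\<^sup>1 (g - \<Sum>\<^sub>e \<nu>\<^sub>e(X\<^sub>e z) X\<^sub>e)\<close> with the Gram matrix \<open>A = \<Sum>\<^sub>e w\<^sub>e X\<^sub>e X\<^sub>e\<^sup>T\<close>,
  which contracts the norm \<open>\<Sum>\<^sub>e w\<^sub>e (X\<^sub>e z)\<^sup>2\<close> by \<open>\<kappa>\<^sup>2\<close>.\<close>
lemma near_linear_system_solvable:
  fixes X :: "'e \<Rightarrow> nat \<Rightarrow> real" and w :: "'e \<Rightarrow> real" and \<nu> :: "'e \<Rightarrow> real \<Rightarrow> real"
  assumes E: "finite E" and w: "\<And>e. e \<in> E \<Longrightarrow> w e > 0"
    and kernel: "\<And>v. (\<forall>e\<in>E. (\<Sum>k<N. X e k * v k) = 0) \<Longrightarrow> \<forall>k<N. v k = 0"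
    and \<kappa>: "0 \<le> \<kappa>" "\<kappa> < 1"
    and \<nu>: "\<And>e s t. e \<in> E \<Longrightarrow> \<bar>\<nu> e s - \<nu> e t - w e * (s - t)\<bar> \<le> \<kappa> * w e * \<bar>s - t\<bar>"
  shows "\<exists>v. \<forall>i<N. (\<Sum>e\<in>E. X e i * \<nu> e (\<Sum>k<N. X e k * v k)) = g i"
proof -
  have "\<exists>v. \<forall>i<N. (\<Sum>j<N. (\<Sum>e\<in>E. w e * X e i * X e j) * v j) = b i" for b
    by (rule linear_system_solvable) (rule weighted_gram_trivial_kernel[OF E w kernel])
  moreover have gram: "(\<Sum>j<N. (\<Sum>e\<in>E. w e * X e i * X e j) * v j)
      = (\<Sum>e\<in>E. w e * X e i * (\<Sum>j<N. X e j * v j))" for v i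
    by (simp add: sum_distrib_left sum_distrib_right ac_simps) (rule sum.swap)
  ultimately have "\<forall>b. \<exists>v. \<forall>i<N. (\<Sum>e\<in>E. w e * X e i * (\<Sum>j<N. X e j * v j)) = b i"
    by simp
  \<comment> \<open>\<open>S b\<close> is a chosen solution of the Gram system with right-hand side
    \<open>b\<close>; it plays the role of the inverse of \<open>A\<close>.\<close>
  from choice[OF this] obtain S
    where S: "\<And>b i. i < N \<Longrightarrow> (\<Sum>e\<in>E. w e * X e i * (\<Sum>j<N. X e j * S b j)) = b i"
    by blast
  define L where "L v e = (\<Sum>k<N. X e k * v k)" for v e
  define z where "z = rec_nat (\<lambda>_. 0)
    (\<lambda>_ z i. z i + S (\<lambda>i. g i - (\<Sum>e\<in>E. X e i * \<nu> e (L z e))) i)"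
  define x where "x k e = L (z k) e" for k e
  define D where "D k e = x (Suc k) e - x k e" for k e
  have L_add: "L (\<lambda>i. u i + v i) e = L u e + L v e" for u v e
    by (simp add: L_def algebra_simps sum.distrib)
  have L_diff: "L (\<lambda>i. u i - v i) e = L u e - L v e" for u v e
    by (simp add: L_def algebra_simps sum_subtractf)
  \<comment> \<open>\<open>L\<close> is adjoint to the summation against \<open>X e i\<close>; this
    turns the coordinate equations into identities for arbitrary test vectors.\<close>
  have pair: "(\<Sum>e\<in>E. s e * L v e) = (\<Sum>i<N. v i * (\<Sum>e\<in>E. X e i * s e))" for s v
    by (simp add: L_def sum_distrib_left) (subst sum.swap, simp add: ac_simps)
  have z_Suc: "z (Suc k) = (\<lambda>i. z k i + S (\<lambda>i. g i - (\<Sum>e\<in>E. X e i * \<nu> e (x k e))) i)" for k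
    by (simp add: z_def x_def)
  have D_S: "D k e = L (S (\<lambda>i. g i - (\<Sum>e\<in>E. X e i * \<nu> e (x k e)))) e" for k e
    unfolding D_def by (simp add: x_def z_Suc L_add)
  have D_L: "D k e = L (\<lambda>i. z (Suc k) i - z k i) e" for k e
    by (simp add: D_def x_def L_diff)
  have step: "(\<Sum>e\<in>E. X e i * (w e * D k e)) = g i - (\<Sum>e\<in>E. X e i * \<nu> e (x k e))"
    if "i < N" for i k
    using S[OF that, of "\<lambda>i. g i - (\<Sum>e\<in>E. X e i * \<nu> e (x k e))"]
    by (simp add: D_S L_def ac_simps)
  define Q where "Q k = (\<Sum>e\<in>E. w e * (D k e)\<^sup>2)" for k
  have Q_Suc: "Q (Suc k) \<le> \<kappa>\<^sup>2 * Q k" for k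
  proof -
    \<comment> \<open>The linearization error of the last step. Subtracting the equations of two
      consecutive steps leaves it as the right-hand side of the system for
      \<open>D (Suc k)\<close>.\<close>
    define s where "s e = w e * D k e - (\<nu> e (x (Suc k) e) - \<nu> e (x k e))" for e
    have s: "\<bar>s e\<bar> \<le> \<kappa> * w e * \<bar>D k e\<bar>" if "e \<in> E" for e
      using \<nu>[OF that, of "x (Suc k) e" "x k e"] by (simp add: s_def D_def abs_minus_commute)
    have eq: "(\<Sum>e\<in>E. X e i * (w e * D (Suc k) e)) = (\<Sum>e\<in>E. X e i * s e)" if "i < N" for i
      using step[OF that, of k] step[OF that, of "Suc k"]
      by (simp add: s_def algebra_simps sum_subtractf sum.distrib)
    have "Q (Suc k) = (\<Sum>e\<in>E. (w e * D (Suc k) e) * D (Suc k) e)"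
      by (simp add: Q_def power2_eq_square ac_simps)
    also have "\<dots> = (\<Sum>e\<in>E. s e * D (Suc k) e)"
    proof -
      define u where "u i = z (Suc (Suc k)) i - z (Suc k) i" for i
      have "D (Suc k) = L u" unfolding u_def by (rule ext) (rule D_L)
      then have "(\<Sum>e\<in>E. t e * D (Suc k) e) = (\<Sum>i<N. u i * (\<Sum>e\<in>E. X e i * t e))" for t
        by (simp only: pair)
      then show ?thesis using eq by simp
    qed
    also have "\<dots> \<le> (\<Sum>e\<in>E. w e * ((\<kappa>\<^sup>2 * (D k e)\<^sup>2 + (D (Suc k) e)\<^sup>2) / 2))"
    proof (rule sum_mono)
      fix e assume e: "e \<in> E"
      have "s e * D (Suc k) e \<le> \<bar>s e\<bar> * \<bar>D (Suc k) e\<bar>" by (metis abs_ge_self abs_mult)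
      also have "\<dots> \<le> (\<kappa> * w e * \<bar>D k e\<bar>) * \<bar>D (Suc k) e\<bar>"
        using s[OF e] by (rule mult_right_mono) simp
      also have "\<dots> = w e * ((\<kappa> * \<bar>D k e\<bar>) * \<bar>D (Suc k) e\<bar>)" by simp
      also have "\<dots> \<le> w e * ((\<kappa>\<^sup>2 * (D k e)\<^sup>2 + (D (Suc k) e)\<^sup>2) / 2)"
      proof (rule mult_left_mono)
        \<comment> \<open>Young's inequality instead of Cauchy-Schwarz; the half of
          \<open>Q (Suc k)\<close> that it produces is moved to the left at the end.\<close>
        have "0 \<le> (\<kappa> * \<bar>D k e\<bar> - \<bar>D (Suc k) e\<bar>)\<^sup>2" by simp
        then show "\<kappa> * \<bar>D k e\<bar> * \<bar>D (Suc k) e\<bar> \<le> (\<kappa>\<^sup>2 * (D k e)\<^sup>2 + (D (Suc k) e)\<^sup>2) / 2"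
          by (simp add: power2_diff power_mult_distrib)
      qed (use w[OF e] in simp)
      finally show "s e * D (Suc k) e \<le> w e * ((\<kappa>\<^sup>2 * (D k e)\<^sup>2 + (D (Suc k) e)\<^sup>2) / 2)" .
    qed
    also have "\<dots> = (\<kappa>\<^sup>2 * Q k + Q (Suc k)) / 2"
      by (simp add: Q_def sum_distrib_left sum_divide_distrib flip: sum.distrib)
         (intro sum.cong refl, simp add: field_simps)
    finally show ?thesis by simp
  qed
  have Q_le: "Q k \<le> (\<kappa> ^ k)\<^sup>2 * Q 0" for k
  proof (induction k)
    case (Suc k)
    have "Q (Suc k) \<le> \<kappa>\<^sup>2 * ((\<kappa> ^ k)\<^sup>2 * Q 0)"
      using Q_Suc[of k] mult_left_mono[OF Suc, of "\<kappa>\<^sup>2"] by simp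
    then show ?case by (simp add: power_mult_distrib ac_simps)
  qed simp
  have D_le: "\<bar>D k e\<bar> \<le> sqrt (Q 0 / w e) * \<kappa> ^ k" if e: "e \<in> E" for k e
  proof -
    have "w e * (D k e)\<^sup>2 \<le> Q k"
      unfolding Q_def using e E w
      by (intro member_le_sum[where f = "\<lambda>e. w e * (D k e)\<^sup>2"]) (simp_all add: less_imp_le)
    then have "w e * (D k e)\<^sup>2 \<le> (\<kappa> ^ k)\<^sup>2 * Q 0" using Q_le[of k] by (rule order_trans)
    then have "(D k e)\<^sup>2 \<le> (\<kappa> ^ k)\<^sup>2 * Q 0 / w e"
      using w[OF e] by (simp add: pos_le_divide_eq mult.commute)
    then have "(D k e)\<^sup>2 \<le> Q 0 / w e * (\<kappa> ^ k)\<^sup>2" by (simp add: ac_simps)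
    then have "\<bar>D k e\<bar> \<le> sqrt (Q 0 / w e * (\<kappa> ^ k)\<^sup>2)"
      using real_sqrt_le_mono by (subst real_sqrt_abs[symmetric]) blast
    then show ?thesis using \<kappa> by (simp only: real_sqrt_mult real_sqrt_abs) simp
  qed
  have "summable (\<lambda>k. D k e)" if "e \<in> E" for e
    using D_le[OF that] \<kappa>
    by (intro summable_comparison_test[of "\<lambda>k. D k e" "\<lambda>k. sqrt (Q 0 / w e) * \<kappa> ^ k"])
       (auto intro!: summable_mult summable_geometric)
  moreover have "(\<Sum>k<m. D k e) = x m e - x 0 e" for m e
    unfolding D_def by (rule sum_lessThan_telescope)
  ultimately have "convergent (\<lambda>m. x m e - x 0 e)" if "e \<in> E" for e
    using that by (simp add: summable_iff_convergent)
  then have "\<exists>l. (\<lambda>m. x m e) \<longlonglongrightarrow> l" if "e \<in> E" for e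
    using that convergent_add_const_iff[of "- x 0 e" "\<lambda>m. x m e"] by (auto simp: convergent_def)
  \<comment> \<open>Convergence is obtained for the predictors, edge by edge, and not for the
    iterates \<open>z m\<close>. A parameter vector with predictors \<open>\<xi>\<close> has still
    to be found.\<close>
  then obtain \<xi> where \<xi>: "\<And>e. e \<in> E \<Longrightarrow> (\<lambda>m. x m e) \<longlonglongrightarrow> \<xi> e" by metis
  define v where "v = S (\<lambda>i. \<Sum>e\<in>E. w e * X e i * \<xi> e)"
  have v: "(\<Sum>e\<in>E. X e i * (w e * (L v e - \<xi> e))) = 0" if "i < N" for i
    using S[OF that, of "\<lambda>i. \<Sum>e\<in>E. w e * X e i * \<xi> e"]
    by (simp add: v_def L_def algebra_simps sum_subtractf)
  \<comment> \<open>\<open>L v\<close> is the weighted projection of \<open>\<xi>\<close>. Testing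
    with \<open>L v - x m\<close>, which lies in the range of \<open>L\<close>, and letting
    \<open>m\<close> grow shows that \<open>\<xi>\<close> lies in the range itself.\<close>
  have "(\<Sum>e\<in>E. w e * (L v e - \<xi> e) * (L v e - x m e)) = 0" for m
    using pair[of "\<lambda>e. w e * (L v e - \<xi> e)" "\<lambda>i. v i - z m i"] v by (simp add: L_diff x_def)
  moreover have "(\<lambda>m. \<Sum>e\<in>E. w e * (L v e - \<xi> e) * (L v e - x m e))
      \<longlonglongrightarrow> (\<Sum>e\<in>E. w e * (L v e - \<xi> e) * (L v e - \<xi> e))"
    using \<xi> by (intro tendsto_intros)
  ultimately have "(\<Sum>e\<in>E. w e * (L v e - \<xi> e)\<^sup>2) = 0"
    by (simp add: LIMSEQ_const_iff power2_eq_square mult.assoc)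
  then have "\<forall>e\<in>E. w e * (L v e - \<xi> e)\<^sup>2 = 0"
    using w E by (subst (asm) sum_nonneg_eq_0_iff) (simp_all add: less_imp_le)
  then have L_v: "L v e = \<xi> e" if "e \<in> E" for e using w that by fastforce
  have \<nu>_lim: "(\<lambda>m. \<nu> e (x m e)) \<longlonglongrightarrow> \<nu> e (\<xi> e)" if e: "e \<in> E" for e
  proof (rule Lim_transform)
    have lim0: "(\<lambda>m. x m e - \<xi> e) \<longlonglongrightarrow> 0" using \<xi>[OF e] by (rule LIM_zero)
    show "(\<lambda>m. \<nu> e (\<xi> e) + w e * (x m e - \<xi> e)) \<longlonglongrightarrow> \<nu> e (\<xi> e)"
      using tendsto_add[OF tendsto_const tendsto_mult_right_zero[OF lim0]] by simp
    have "(\<lambda>m. \<kappa> * w e * \<bar>x m e - \<xi> e\<bar>) \<longlonglongrightarrow> 0"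
      by (intro tendsto_mult_right_zero tendsto_rabs_zero lim0)
    then show "(\<lambda>m. \<nu> e (x m e) - (\<nu> e (\<xi> e) + w e * (x m e - \<xi> e))) \<longlonglongrightarrow> 0"
    proof (rule Lim_null_comparison[rotated])
      have "\<bar>\<nu> e (x m e) - (\<nu> e (\<xi> e) + w e * (x m e - \<xi> e))\<bar> \<le> \<kappa> * w e * \<bar>x m e - \<xi> e\<bar>" for m
        using \<nu>[OF e, of "x m e" "\<xi> e"] by linarith
      then show "\<forall>\<^sub>F m in sequentially.
          norm (\<nu> e (x m e) - (\<nu> e (\<xi> e) + w e * (x m e - \<xi> e))) \<le> \<kappa> * w e * \<bar>x m e - \<xi> e\<bar>"
        by simp
    qed
  qed
  have D_lim: "(\<lambda>m. D m e) \<longlonglongrightarrow> 0" if "e \<in> E" for e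
    using tendsto_diff[OF LIMSEQ_Suc[OF \<xi>[OF that]] \<xi>[OF that]] by (simp add: D_def)
  have "(\<Sum>e\<in>E. X e i * \<nu> e (L v e)) = g i" if i: "i < N" for i
  proof -
    have "(\<lambda>m. \<Sum>e\<in>E. X e i * (w e * D m e)) \<longlonglongrightarrow> (\<Sum>e\<in>E. X e i * (w e * 0))"
      using D_lim by (intro tendsto_intros)
    moreover have "(\<lambda>m. g i - (\<Sum>e\<in>E. X e i * \<nu> e (x m e)))
        \<longlonglongrightarrow> g i - (\<Sum>e\<in>E. X e i * \<nu> e (\<xi> e))"
      using \<nu>_lim by (intro tendsto_intros)
    ultimately have "0 = g i - (\<Sum>e\<in>E. X e i * \<nu> e (\<xi> e))"
      unfolding step[OF i] by (simp add: LIMSEQ_unique)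
    then show ?thesis using L_v by simp
  qed
  then show ?thesis by (auto simp: L_def)
qed

section \<open>A maximum principle on bipartite graphs\<close>

text \<open>Maximum principle for \<open>\<Sum>\<^sub>j W\<^sub>i\<^sub>j (a\<^sub>i - c\<^sub>j)\<close> on the complete bipartite graph without a perfect
  matching: at the maximal node \<open>i0\<close> all terms have one sign, so the \<open>c\<^sub>j\<close> are on average close to
  \<open>a\<^sub>i\<^sub>0\<close>; the remaining equations carry this over to every single node.\<close>
lemma bipartite_max_out:
  fixes W :: "nat \<Rightarrow> nat \<Rightarrow> real" and a c :: "nat \<Rightarrow> real"
  assumes n: "2 \<le> n" and m: "0 < m" and S: "0 \<le> S"
    and large: "1 \<le> 8 * m\<^sup>2 * real (n - 1)"
    and W: "\<And>i j. i < n \<Longrightarrow> j < n \<Longrightarrow> i \<noteq> j \<Longrightarrow> m \<le> W i j \<and> W i j \<le> 1 / 4"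
    and row: "\<And>i. i < n \<Longrightarrow> \<bar>\<Sum>j\<in>{..<n} - {i}. W i j * (a i - c j)\<bar> \<le> S"
    and col: "\<And>j. j < n \<Longrightarrow> \<bar>\<Sum>i\<in>{..<n} - {j}. W i j * (a i - c j)\<bar> \<le> S"
    and i0: "i0 < n" and a_le: "\<And>i. i < n \<Longrightarrow> a i \<le> a i0" and c_le: "\<And>j. j < n \<Longrightarrow> c j \<le> a i0"
  shows "\<forall>i<n. a i0 - a i \<le> S / (m ^ 3 * real (n - 1))" "\<forall>j<n. a i0 - c j \<le> S / (m ^ 3 * real (n - 1))"
proof -
  define N where "N = real (n - 1)"
  define p where "p i = a i0 - a i" for i
  define r where "r j = a i0 - c j" for j
  have N: "N \<ge> 1" using n by (simp add: N_def)
  have m4: "m \<le> 1 / 4"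
  proof -
    have "m \<le> W 0 1 \<and> W 0 1 \<le> 1 / 4" by (rule W) (use n in auto)
    then show ?thesis by linarith
  qed
  have p: "0 \<le> p i" if "i < n" for i using a_le[OF that] by (simp add: p_def)
  have r: "0 \<le> r j" if "j < n" for j using c_le[OF that] by (simp add: r_def)
  have card: "real (card ({..<n} - {i})) = N" if "i < n" for i using that by (simp add: N_def)
  have lower: "m * (\<Sum>j\<in>{..<n} - {i}. f j) \<le> (\<Sum>j\<in>{..<n} - {i}. V j * f j)"
    if "\<And>j. j < n \<Longrightarrow> j \<noteq> i \<Longrightarrow> m \<le> V j" "\<And>j. j < n \<Longrightarrow> 0 \<le> f j" for V f :: "nat \<Rightarrow> real" and i
    unfolding sum_distrib_left using that by (intro sum_mono mult_right_mono) auto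
  have upper: "(\<Sum>j\<in>{..<n} - {i}. V j * f j) \<le> (\<Sum>j\<in>{..<n} - {i}. f j) / 4"
    if "\<And>j. j < n \<Longrightarrow> j \<noteq> i \<Longrightarrow> V j \<le> 1 / 4" "\<And>j. j < n \<Longrightarrow> 0 \<le> f j" for V f :: "nat \<Rightarrow> real" and i
  proof -
    have "(\<Sum>j\<in>{..<n} - {i}. V j * f j) \<le> (\<Sum>j\<in>{..<n} - {i}. 1 / 4 * f j)"
      using that by (intro sum_mono mult_right_mono) auto
    then show ?thesis by (simp add: sum_divide_distrib)
  qed
  \<comment> \<open>All terms of the equation at \<open>i0\<close> are nonnegative, so it bounds the
    sum of the \<open>r j\<close>. Only \<open>r i0\<close> is missing, because the pair
    \<open>(i0, i0)\<close> does not occur.\<close>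
  have r_sum: "(\<Sum>j\<in>{..<n} - {i0}. r j) \<le> S / m"
  proof -
    have "m * (\<Sum>j\<in>{..<n} - {i0}. r j) \<le> (\<Sum>j\<in>{..<n} - {i0}. W i0 j * r j)"
      using W[OF i0] r by (intro lower) auto
    also have "\<dots> \<le> S" using row[OF i0] by (simp add: r_def)
    finally show ?thesis using m by (simp add: field_simps)
  qed
  \<comment> \<open>From here on \<open>r i0\<close> is carried along as an unknown, until
    \<open>r0\<close> bounds it.\<close>
  have p_le: "m * N * p i \<le> (S / m + r i0) / 4 + S" if i: "i < n" for i
  proof -
    have "m * N * p i = m * (\<Sum>j\<in>{..<n} - {i}. p i)" using card[OF i] by simp
    also have "\<dots> \<le> (\<Sum>j\<in>{..<n} - {i}. W i j * p i)"
      using W[OF i] p[OF i] by (intro lower) auto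
    also have "\<dots> = (\<Sum>j\<in>{..<n} - {i}. W i j * r j) - (\<Sum>j\<in>{..<n} - {i}. W i j * (a i - c j))"
      by (simp add: p_def r_def algebra_simps sum_subtractf sum.distrib)
    also have "\<dots> \<le> (\<Sum>j\<in>{..<n} - {i}. r j) / 4 + S"
      using upper[of i "W i" r] W[OF i] r row[OF i] by (fastforce simp: abs_le_iff)
    also have "(\<Sum>j\<in>{..<n} - {i}. r j) \<le> (\<Sum>j<n. r j)"
      using r by (intro sum_mono2) auto
    also have "(\<Sum>j<n. r j) = r i0 + (\<Sum>j\<in>{..<n} - {i0}. r j)"
      using i0 by (simp add: sum.remove)
    also have "\<dots> \<le> r i0 + S / m" using r_sum by simp
    finally show ?thesis by (simp add: add.commute)
  qed
  have p_sum: "(\<Sum>i\<in>{..<n} - {j}. p i) \<le> ((S / m + r i0) / 4 + S) / m" if j: "j < n" for j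
  proof -
    have "(\<Sum>i\<in>{..<n} - {j}. p i) \<le> (\<Sum>i\<in>{..<n} - {j}. ((S / m + r i0) / 4 + S) / (m * N))"
      using p_le m N by (intro sum_mono) (simp add: field_simps)
    also have "\<dots> = N * (((S / m + r i0) / 4 + S) / (m * N))" using card[OF j] by simp
    also have "\<dots> = ((S / m + r i0) / 4 + S) / m" using N m by simp
    finally show ?thesis .
  qed
  have r_le: "m * N * r j \<le> (((S / m + r i0) / 4 + S) / m) / 4 + S" if j: "j < n" for j
  proof -
    have "m * N * r j = m * (\<Sum>i\<in>{..<n} - {j}. r j)" using card[OF j] by simp
    also have "\<dots> \<le> (\<Sum>i\<in>{..<n} - {j}. W i j * r j)"
      using W[OF _ j] r[OF j] by (intro lower) auto
    also have "\<dots> = (\<Sum>i\<in>{..<n} - {j}. W i j * p i) + (\<Sum>i\<in>{..<n} - {j}. W i j * (a i - c j))"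
      by (simp add: p_def r_def algebra_simps sum_subtractf sum.distrib)
    also have "\<dots> \<le> (\<Sum>i\<in>{..<n} - {j}. p i) / 4 + S"
      using upper[of j "\<lambda>i. W i j" p] W[OF _ j] p col[OF j] by (fastforce simp: abs_le_iff)
    also have "\<dots> \<le> (((S / m + r i0) / 4 + S) / m) / 4 + S" using p_sum[OF j] by (intro add_mono divide_right_mono) auto
    finally show ?thesis .
  qed
  have pos: "0 < m ^ 3 * N" "0 < m\<^sup>2" using m N by auto
  have r16: "16 * m\<^sup>2 * (m * N * r j) \<le> S + r i0 * m + 4 * S * m + 16 * S * m\<^sup>2" if "j < n" for j
  proof -
    have "16 * m\<^sup>2 * (m * N * r j) \<le> 16 * m\<^sup>2 * ((((S / m + r i0) / 4 + S) / m) / 4 + S)"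
      using r_le[OF that] m by (intro mult_left_mono) auto
    also have "\<dots> = S + r i0 * m + 4 * S * m + 16 * S * m\<^sup>2"
      using m by (simp add: field_simps power2_eq_square)
    finally show ?thesis .
  qed
  have Sm: "S * m \<le> S / 4" "S * m\<^sup>2 \<le> S / 16"
  proof -
    show "S * m \<le> S / 4" using mult_left_mono[OF m4 S] by simp
    have "m\<^sup>2 \<le> (1 / 4)\<^sup>2" using m m4 by (intro power_mono) auto
    then show "S * m\<^sup>2 \<le> S / 16" using mult_left_mono[OF _ S] by (fastforce simp: power2_eq_square)
  qed
  \<comment> \<open>For \<open>j = i0\<close> the unknown stands on both sides of
    \<open>r16\<close>; by \<open>large\<close> its coefficient on the left is at least twice the
    one on the right, so it can be absorbed.\<close>
  have rm: "2 * (r i0 * m) \<le> 16 * m\<^sup>2 * (m * N * r i0)"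
  proof -
    have "1 * (r i0 * m) \<le> (8 * m\<^sup>2 * N) * (r i0 * m)"
      using large r[OF i0] m by (intro mult_right_mono) (simp_all only: N_def, simp)
    then show ?thesis by (simp add: ac_simps)
  qed
  have r0: "r i0 * m \<le> 3 * S" using r16[OF i0] rm Sm by linarith
  have r_fin: "r j \<le> S / (m ^ 3 * N)" if "j < n" for j
  proof -
    have "16 * (m ^ 3 * N * r j) \<le> 16 * S"
      using r16[OF that] r0 Sm S by (simp add: power3_eq_cube power2_eq_square ac_simps)
    then show ?thesis using pos by (simp add: field_simps)
  qed
  have p_fin: "p i \<le> S / (m ^ 3 * N)" if "i < n" for i
  proof -
    have "4 * m\<^sup>2 * (m * N * p i) \<le> 4 * m\<^sup>2 * ((S / m + r i0) / 4 + S)"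
      using p_le[OF that] m by (intro mult_left_mono) auto
    also have "\<dots> = S * m + (r i0 * m) * m + 4 * (S * m\<^sup>2)"
      using m by (simp add: field_simps power2_eq_square)
    also have "\<dots> \<le> S / 4 + 3 * S * (1 / 4) + 4 * (S / 16)"
      using Sm mult_mono[OF r0 m4] m S by (intro add_mono) auto
    finally have "m ^ 3 * N * p i \<le> S" using S by (simp add: power3_eq_cube power2_eq_square ac_simps)
    then show ?thesis using pos by (simp add: field_simps)
  qed
  show "\<forall>i<n. a i0 - a i \<le> S / (m ^ 3 * real (n - 1))" "\<forall>j<n. a i0 - c j \<le> S / (m ^ 3 * real (n - 1))"
    using r_fin p_fin by (auto simp: p_def r_def N_def)
qed

text \<open>The maximum \<open>U\<close> over both classes is within \<open>B\<close> of every
  value. The pinned value 0 is one of them, which gives 0 <= U <= B and places all values in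
  [-B, B].\<close>

lemma bipartite_laplacian_bound:
  fixes W :: "nat \<Rightarrow> nat \<Rightarrow> real" and a c :: "nat \<Rightarrow> real"
  assumes n: "2 \<le> n" and m: "0 < m" and S: "0 \<le> S"
    and large: "1 \<le> 8 * m\<^sup>2 * real (n - 1)"
    and W: "\<And>i j. i < n \<Longrightarrow> j < n \<Longrightarrow> i \<noteq> j \<Longrightarrow> m \<le> W i j \<and> W i j \<le> 1 / 4"
    and row: "\<And>i. i < n \<Longrightarrow> \<bar>\<Sum>j\<in>{..<n} - {i}. W i j * (a i - c j)\<bar> \<le> S"
    and col: "\<And>j. j < n \<Longrightarrow> \<bar>\<Sum>i\<in>{..<n} - {j}. W i j * (a i - c j)\<bar> \<le> S"
    and pinned: "c (n - 1) = 0"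
  shows "\<forall>i<n. \<bar>a i\<bar> \<le> S / (m ^ 3 * real (n - 1)) \<and> \<bar>c i\<bar> \<le> S / (m ^ 3 * real (n - 1))"
proof -
  define B where "B = S / (m ^ 3 * real (n - 1))"
  define U where "U = Max (a ` {..<n} \<union> c ` {..<n})"
  have U_in: "U \<in> a ` {..<n} \<union> c ` {..<n}" unfolding U_def using n by (intro Max_in) (auto simp: lessThan_empty_iff)
  have U_ge: "a i \<le> U" "c i \<le> U" if "i < n" for i
    unfolding U_def using that by (auto intro!: Max_ge)
  have "\<forall>i<n. U - a i \<le> B \<and> U - c i \<le> B"
  proof (cases "U \<in> a ` {..<n}")
    case True
    then obtain i0 where i0: "i0 < n" "U = a i0" by auto
    then show ?thesis
      using bipartite_max_out[OF n m S large W row col i0(1)] U_ge by (auto simp: B_def)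
  next
    case False
    then obtain i0 where i0: "i0 < n" "U = c i0" using U_in by auto
    \<comment> \<open>Exchanging the two classes transposes \<open>W\<close> and reverses the sign
      of every difference.\<close>
    have flip: "(\<Sum>i\<in>I. V i * (x i - y i)) = - (\<Sum>i\<in>I. V i * (y i - x i))"
      for I and V x y :: "nat \<Rightarrow> real"
      by (simp add: algebra_simps flip: sum_negf)
    have "\<bar>\<Sum>j\<in>{..<n} - {i}. W j i * (c i - a j)\<bar> \<le> S" if "i < n" for i
      using col[OF that] by (subst flip) simp
    moreover have "\<bar>\<Sum>i\<in>{..<n} - {j}. W j i * (c i - a j)\<bar> \<le> S" if "j < n" for j
      using row[OF that] by (subst flip) simp
    ultimately show ?thesis
      using bipartite_max_out[of n m S "\<lambda>i j. W j i" c a i0] n m S large W i0 U_ge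
      by (auto simp: B_def)
  qed
  then have bound: "U - a i \<le> B" "U - c i \<le> B" if "i < n" for i using that by blast+
  have "0 \<le> U" "U \<le> B" using U_ge(2)[of "n - 1"] bound(2)[of "n - 1"] pinned n by auto
  then have "\<bar>a i\<bar> \<le> B \<and> \<bar>c i\<bar> \<le> B" if "i < n" for i
    using U_ge[OF that] bound[OF that] by linarith
  then show ?thesis unfolding B_def by blast
qed

section \<open>Two-way designs\<close>

lemma finite_node_pairs [simp]: "finite (node_pairs n)"
  by (rule finite_subset[of _ "{..<n} \<times> {..<n}"]) (auto simp: node_pairs_def)

lemma node_pairs_rows: "node_pairs n = (SIGMA i:{..<n}. {..<n} - {i})"
  by (auto simp: node_pairs_def)

lemma sum_node_pairs_rows:
  "(\<Sum>(i, j)\<in>node_pairs n. f i j) = (\<Sum>i<n. \<Sum>j\<in>{..<n} - {i}. f i j)"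
  by (simp add: node_pairs_rows sum.Sigma)

lemma sum_node_pairs_cols:
  "(\<Sum>(i, j)\<in>node_pairs n. f i j) = (\<Sum>j<n. \<Sum>i\<in>{..<n} - {j}. f i j)"
proof -
  have "(\<Sum>(i, j)\<in>node_pairs n. f i j) = (\<Sum>(j, i)\<in>node_pairs n. f i j)"
    by (rule sum.reindex_bij_witness[of _ prod.swap prod.swap]) (auto simp: node_pairs_def)
  then show ?thesis by (simp add: sum_node_pairs_rows)
qed

lemma card_node_pairs_le: "real (card (node_pairs n)) \<le> (real n)\<^sup>2"
proof -
  have "card (node_pairs n) \<le> card ({..<n} \<times> {..<n})"
    by (intro card_mono) (auto simp: node_pairs_def)
  then have "card (node_pairs n) \<le> n\<^sup>2" by (simp add: power2_eq_square)
  then show ?thesis by (metis of_nat_le_iff of_nat_power)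
qed

definition effect :: "nat \<Rightarrow> (nat \<Rightarrow> real) \<Rightarrow> nat \<Rightarrow> nat \<Rightarrow> real" where
  "effect n v i j = v i + (if j < n - 1 then v (n + j) else 0)"

text \<open>With the sign of the in-effects reversed, \<open>effect\<close> is a difference across
  the bipartite graph, and the in-effect of the last node, fixed at 0, is the pinned value. The last
  column is listed apart from the others because it has no estimating equation of its own.\<close>

lemma two_way_bound:
  fixes W :: "nat \<Rightarrow> nat \<Rightarrow> real" and v :: "nat \<Rightarrow> real"
  assumes n: "2 \<le> n" and m: "0 < m" and S: "0 \<le> S"
    and large: "1 \<le> 8 * m\<^sup>2 * real (n - 1)"
    and W: "\<And>i j. i < n \<Longrightarrow> j < n \<Longrightarrow> i \<noteq> j \<Longrightarrow> m \<le> W i j \<and> W i j \<le> 1 / 4"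
    and row: "\<And>i. i < n \<Longrightarrow> \<bar>\<Sum>j\<in>{..<n} - {i}. W i j * effect n v i j\<bar> \<le> S"
    and col: "\<And>j. j < n - 1 \<Longrightarrow> \<bar>\<Sum>i\<in>{..<n} - {j}. W i j * effect n v i j\<bar> \<le> S"
    and last: "\<bar>\<Sum>i\<in>{..<n} - {n - 1}. W i (n - 1) * effect n v i (n - 1)\<bar> \<le> S"
    and k: "k < 2 * n - 1"
  shows "\<bar>v k\<bar> \<le> S / (m ^ 3 * real (n - 1))"
proof -
  define c where "c j = (if j < n - 1 then - v (n + j) else 0)" for j
  have eff: "v i - c j = effect n v i j" for i j by (simp add: c_def effect_def)
  have col': "\<bar>\<Sum>i\<in>{..<n} - {j}. W i j * effect n v i j\<bar> \<le> S" if "j < n" for j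
    using col[of j] last that by (cases "j = n - 1") auto
  have *: "\<forall>i<n. \<bar>v i\<bar> \<le> S / (m ^ 3 * real (n - 1)) \<and> \<bar>c i\<bar> \<le> S / (m ^ 3 * real (n - 1))"
  proof (rule bipartite_laplacian_bound[where W = W, OF n m S large W])
    show "c (n - 1) = 0" by (simp add: c_def)
  qed (auto simp only: eff intro: row col')
  show ?thesis
  proof (cases "k < n")
    case False
    then have "c (k - n) = - v k" "k - n < n" using k by (auto simp: c_def)
    then show ?thesis using * by (metis abs_minus_cancel)
  qed (use * in blast)
qed

text \<open>Rows and columns have the same total. The last in-degree is absent from the moment
  equations, and its sum is recovered in this way from the other ones.\<close>

lemma last_column_sum:
  fixes f :: "nat \<Rightarrow> nat \<Rightarrow> real"
  assumes "0 < n"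
  shows "(\<Sum>i\<in>{..<n} - {n - 1}. f i (n - 1))
    = (\<Sum>i<n. \<Sum>j\<in>{..<n} - {i}. f i j) - (\<Sum>j<n - 1. \<Sum>i\<in>{..<n} - {j}. f i j)"
proof -
  obtain k where k: "n = Suc k" using assms by (cases n) auto
  show ?thesis
    using sum_node_pairs_rows[of f n] sum_node_pairs_cols[of f n] by (simp add: k)
qed

text \<open>The derivative of the linear predictor of a pair in the \<open>k\<close>-th coordinate of the joint
  parameter \<open>(\<alpha>, \<beta>, \<gamma>)\<close>.\<close>
definition incidence :: "nat \<Rightarrow> (nat \<Rightarrow> nat \<Rightarrow> nat \<Rightarrow> real) \<Rightarrow> nat \<Rightarrow> nat \<times> nat \<Rightarrow> real" where
  "incidence n z k = (\<lambda>(i, j). if k < n then of_bool (i = k)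
     else if k < 2 * n - 1 then of_bool (j = k - n) else z i j (k - (2 * n - 1)))"

lemma sum_params:
  fixes f :: "nat \<Rightarrow> real"
  assumes n: "2 \<le> n"
  shows "(\<Sum>k<2 * n - 1 + p. f k)
  = (\<Sum>i<n. f i) + (\<Sum>j<n - 1. f (n + j)) + (\<Sum>t<p. f (2 * n - 1 + t))"
proof -
  have split: "(\<Sum>k<a + b. f k) = (\<Sum>k<a. f k) + (\<Sum>k<b. f (a + k))" for a b and f :: "nat \<Rightarrow> real"
    by (induction b) (simp_all add: ac_simps)
  have "2 * n - 1 = n + (n - 1)" using n by simp
  then show ?thesis by (simp only: split)
qed

lemma incidence_row:
  "k < n \<Longrightarrow> (\<Sum>e\<in>node_pairs n. incidence n z k e * f e) = (\<Sum>j\<in>{..<n} - {k}. f (k, j))"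
proof -
  assume k: "k < n"
  have "(\<Sum>e\<in>node_pairs n. incidence n z k e * f e) = (\<Sum>(i, j)\<in>node_pairs n. if i = k then f (i, j) else 0)"
    using k by (intro sum.cong) (auto simp: incidence_def)
  also have "\<dots> = (\<Sum>i<n. if i = k then \<Sum>j\<in>{..<n} - {i}. f (i, j) else 0)"
    unfolding sum_node_pairs_rows by (intro sum.cong) auto
  finally show ?thesis using k by simp
qed

lemma incidence_col:
  "j < n - 1 \<Longrightarrow> (\<Sum>e\<in>node_pairs n. incidence n z (n + j) e * f e) = (\<Sum>i\<in>{..<n} - {j}. f (i, j))"
proof -
  assume j: "j < n - 1"
  have "(\<Sum>e\<in>node_pairs n. incidence n z (n + j) e * f e) = (\<Sum>(i, j')\<in>node_pairs n. if j' = j then f (i, j') else 0)"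
    using j by (intro sum.cong) (auto simp: incidence_def)
  also have "\<dots> = (\<Sum>j'<n. if j' = j then \<Sum>i\<in>{..<n} - {j'}. f (i, j') else 0)"
    unfolding sum_node_pairs_cols by (intro sum.cong) auto
  finally show ?thesis using j by simp
qed

lemma incidence_cov: "2 \<le> n \<Longrightarrow> incidence n z (2 * n - 1 + t) (i, j) = z i j t"
proof -
  assume n: "2 \<le> n"
  have "\<not> 2 * n - 1 + t < 2 * n - 1" "\<not> 2 * n - 1 + t < n" using n by linarith+
  then show ?thesis by (simp only: incidence_def) simp
qed

text \<open>\<open>L t\<close> holds the coefficients of the weighted projection of the covariate \<open>t\<close> onto the node
  effects; \<open>\<Lambda>\<close> bounds the inverse of the Gram matrix of the projection residuals \<open>\<zeta>\<close>.\<close>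
locale two_way_design =
  fixes n p :: nat and z :: "nat \<Rightarrow> nat \<Rightarrow> nat \<Rightarrow> real" and q m \<Lambda> :: real
    and w :: "nat \<Rightarrow> nat \<Rightarrow> real" and L :: "nat \<Rightarrow> nat \<Rightarrow> real"
  assumes n: "2 \<le> n" and m: "0 < m" and q: "0 \<le> q" and \<Lambda>: "0 \<le> \<Lambda>"
    and large: "1 \<le> 2 * m\<^sup>2 * real (n - 1)"
    and z_le: "\<And>i j t. i < n \<Longrightarrow> j < n \<Longrightarrow> i \<noteq> j \<Longrightarrow> t < p \<Longrightarrow> \<bar>z i j t\<bar> \<le> q"
    and w: "\<And>i j. i < n \<Longrightarrow> j < n \<Longrightarrow> i \<noteq> j \<Longrightarrow> m \<le> w i j \<and> w i j \<le> 1 / 4"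
    and orth_row: "\<And>t i. t < p \<Longrightarrow> i < n \<Longrightarrow>
      (\<Sum>j\<in>{..<n} - {i}. w i j * (z i j t - effect n (L t) i j)) = 0"
    and orth_col: "\<And>t j. t < p \<Longrightarrow> j < n - 1 \<Longrightarrow>
      (\<Sum>i\<in>{..<n} - {j}. w i j * (z i j t - effect n (L t) i j)) = 0"
    and H_inv: "\<And>\<delta> B t. t < p \<Longrightarrow>
      (\<And>s. s < p \<Longrightarrow> \<bar>\<Sum>(i, j)\<in>node_pairs n.
          w i j * (z i j s - effect n (L s) i j) * (\<Sum>t<p. z i j t * \<delta> t)\<bar> \<le> B) \<Longrightarrow>
      \<bar>\<delta> t\<bar> \<le> \<Lambda> * B"
begin

definition \<zeta> :: "nat \<Rightarrow> nat \<Rightarrow> nat \<Rightarrow> real" where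
  "\<zeta> s i j = z i j s - effect n (L s) i j"

definition pred :: "(nat \<Rightarrow> real) \<Rightarrow> nat \<Rightarrow> nat \<Rightarrow> real" where
  "pred u i j = effect n u i j + (\<Sum>t<p. z i j t * u (2 * n - 1 + t))"

text \<open>Summation by parts: a node effect sees a function on pairs only through its row sums and
  its free column sums. Hence the 2n - 1 normal equations imply orthogonality to every node
  effect.\<close>

lemma sum_mult_effect:
  "(\<Sum>(i, j)\<in>node_pairs n. f i j * effect n v i j)
    = (\<Sum>i<n. v i * (\<Sum>j\<in>{..<n} - {i}. f i j)) + (\<Sum>j<n - 1. v (n + j) * (\<Sum>i\<in>{..<n} - {j}. f i j))"
proof -
  have "(\<Sum>(i, j)\<in>node_pairs n. f i j * effect n v i j)
      = (\<Sum>(i, j)\<in>node_pairs n. f i j * v i)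
        + (\<Sum>(i, j)\<in>node_pairs n. f i j * (if j < n - 1 then v (n + j) else 0))"
    by (simp add: effect_def distrib_left case_prod_beta sum.distrib)
  also have "(\<Sum>(i, j)\<in>node_pairs n. f i j * v i) = (\<Sum>i<n. v i * (\<Sum>j\<in>{..<n} - {i}. f i j))"
    by (simp add: sum_node_pairs_rows sum_distrib_left mult.commute)
  also have "(\<Sum>(i, j)\<in>node_pairs n. f i j * (if j < n - 1 then v (n + j) else 0))
      = (\<Sum>j<n. (if j < n - 1 then v (n + j) else 0) * (\<Sum>i\<in>{..<n} - {j}. f i j))"
    unfolding sum_node_pairs_cols sum_distrib_left by (simp only: mult.commute)
  also have "\<dots> = (\<Sum>j<n - 1. v (n + j) * (\<Sum>i\<in>{..<n} - {j}. f i j))"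
    by (rule sum.mono_neutral_cong_right) auto
  finally show ?thesis .
qed

lemma orth_effect: "s < p \<Longrightarrow> (\<Sum>(i, j)\<in>node_pairs n. w i j * \<zeta> s i j * effect n v i j) = 0"
  unfolding sum_mult_effect using orth_row orth_col by (simp add: \<zeta>_def)

text \<open>The node part of \<open>u\<close> drops out against the residuals, so the projected
  score involves the covariate part alone, in the form in which \<open>H_inv\<close> is
  stated.\<close>

lemma orth_pred: "s < p \<Longrightarrow> (\<Sum>(i, j)\<in>node_pairs n. w i j * \<zeta> s i j * pred u i j)
    = (\<Sum>(i, j)\<in>node_pairs n. w i j * \<zeta> s i j * (\<Sum>t<p. z i j t * u (2 * n - 1 + t)))"
  using orth_effect[of s u]
  by (simp add: pred_def distrib_left case_prod_beta sum.distrib)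

lemma w_pair: "e \<in> node_pairs n \<Longrightarrow> 0 \<le> w (fst e) (snd e) \<and> w (fst e) (snd e) \<le> 1 / 4"
  using w[of "fst e" "snd e"] m by (auto simp: node_pairs_def)

text \<open>Pythagoras for the weighted projection: the residual is no longer than the covariate.
  The bound is free of \<open>m\<close>, whereas a pointwise bound of \<open>\<zeta>\<close> through
  the projection coefficients would cost a factor 1 / \<open>m\<close>^3.\<close>

lemma \<zeta>_norm:
  assumes s: "s < p"
  shows "(\<Sum>(i, j)\<in>node_pairs n. w i j * (\<zeta> s i j)\<^sup>2) \<le> q\<^sup>2 * (real n)\<^sup>2 / 4"
proof -
  have split: "w i j * (z i j s)\<^sup>2 = w i j * (\<zeta> s i j)\<^sup>2 + w i j * (effect n (L s) i j)\<^sup>2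
      + 2 * (w i j * \<zeta> s i j * effect n (L s) i j)" for i j
    by (simp add: \<zeta>_def power2_eq_square algebra_simps)
  have "(\<Sum>(i, j)\<in>node_pairs n. w i j * (\<zeta> s i j)\<^sup>2)
      \<le> (\<Sum>(i, j)\<in>node_pairs n. w i j * (\<zeta> s i j)\<^sup>2) + (\<Sum>(i, j)\<in>node_pairs n. w i j * (effect n (L s) i j)\<^sup>2)"
    using w_pair by (simp add: case_prod_beta sum_nonneg)
  also have "\<dots> = (\<Sum>(i, j)\<in>node_pairs n. w i j * (z i j s)\<^sup>2)
      - 2 * (\<Sum>(i, j)\<in>node_pairs n. w i j * \<zeta> s i j * effect n (L s) i j)"
    unfolding split by (simp add: case_prod_beta sum.distrib sum_distrib_left)
  also have "\<dots> = (\<Sum>(i, j)\<in>node_pairs n. w i j * (z i j s)\<^sup>2)" by (simp add: orth_effect[OF s])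
  also have "\<dots> \<le> (\<Sum>(i, j)\<in>node_pairs n. 1 / 4 * q\<^sup>2)"
  proof (intro sum_mono, clarify)
    fix i j assume "(i, j) \<in> node_pairs n"
    then have ij: "i < n" "j < n" "i \<noteq> j" by (auto simp: node_pairs_def)
    have "(z i j s)\<^sup>2 \<le> q\<^sup>2" using power_mono[OF z_le[OF ij s], of 2] by simp
    then show "w i j * (z i j s)\<^sup>2 \<le> 1 / 4 * q\<^sup>2" using w[OF ij] m by (intro mult_mono) auto
  qed
  also have "\<dots> \<le> q\<^sup>2 * (real n)\<^sup>2 / 4"
    using mult_left_mono[OF card_node_pairs_le[of n], of "q\<^sup>2"] by (simp add: case_prod_beta mult.commute)
  finally show ?thesis .
qed

text \<open>Cauchy-Schwarz against the weights, whose sum is at most n^2 / 4; again without a loss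
  in \<open>m\<close>.\<close>

lemma \<zeta>_abs:
  assumes s: "s < p"
  shows "(\<Sum>(i, j)\<in>node_pairs n. w i j * \<bar>\<zeta> s i j\<bar>) \<le> q * (real n)\<^sup>2 / 4"
proof -
  let ?P = "node_pairs n"
  have w0: "0 \<le> w (fst e) (snd e)" "w (fst e) (snd e) \<le> 1 / 4" if "e \<in> ?P" for e
    using w_pair[OF that] by auto
  have "(\<Sum>(i, j)\<in>?P. w i j * \<bar>\<zeta> s i j\<bar>)\<^sup>2
      = (\<Sum>e\<in>?P. sqrt (w (fst e) (snd e)) * (sqrt (w (fst e) (snd e)) * \<bar>\<zeta> s (fst e) (snd e)\<bar>))\<^sup>2"
    using w0 by (intro arg_cong[where f = "\<lambda>x. x\<^sup>2"] sum.cong) (auto simp: case_prod_beta simp flip: mult.assoc)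
  also have "\<dots> \<le> (\<Sum>e\<in>?P. (sqrt (w (fst e) (snd e)))\<^sup>2)
      * (\<Sum>e\<in>?P. (sqrt (w (fst e) (snd e)) * \<bar>\<zeta> s (fst e) (snd e)\<bar>)\<^sup>2)"
    by (rule Cauchy_Schwarz_ineq_sum)
  also have "\<dots> = (\<Sum>e\<in>?P. w (fst e) (snd e)) * (\<Sum>(i, j)\<in>?P. w i j * (\<zeta> s i j)\<^sup>2)"
    using w0 by (intro arg_cong2[where f = "(*)"] sum.cong) (auto simp: case_prod_beta power_mult_distrib)
  also have "\<dots> \<le> ((real n)\<^sup>2 / 4) * (q\<^sup>2 * (real n)\<^sup>2 / 4)"
  proof (rule mult_mono)
    have "(\<Sum>e\<in>?P. w (fst e) (snd e)) \<le> (\<Sum>e\<in>?P. 1 / 4)" using w0 by (intro sum_mono) auto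
    also have "\<dots> = real (card ?P) / 4" by simp
    also have "\<dots> \<le> (real n)\<^sup>2 / 4" by (intro divide_right_mono card_node_pairs_le) simp
    finally show "(\<Sum>e\<in>?P. w (fst e) (snd e)) \<le> (real n)\<^sup>2 / 4" .
    show "0 \<le> (\<Sum>(i, j)\<in>?P. w i j * (\<zeta> s i j)\<^sup>2)"
      using w0 by (intro sum_nonneg) (fastforce simp: case_prod_beta intro!: mult_nonneg_nonneg)
  qed (use \<zeta>_norm[OF s] in auto)
  also have "\<dots> = (q * (real n)\<^sup>2 / 4)\<^sup>2" by (simp add: power2_eq_square)
  finally show ?thesis by (rule power2_le_imp_le) (use q in simp)
qed

text \<open>The maximum principle is applied to the weights \<open>w\<close>, bounded below by
  \<open>m\<close>, and to secant slopes, bounded below by \<open>m / 2\<close>. The constant 2 in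
  \<open>large\<close> is chosen so that both are covered.\<close>

lemma half_weight_large: "1 \<le> 8 * (m / 2)\<^sup>2 * real (n - 1)" "1 \<le> 8 * m\<^sup>2 * real (n - 1)"
proof -
  show "1 \<le> 8 * (m / 2)\<^sup>2 * real (n - 1)" using large by (simp add: power_divide del: of_nat_diff)
  have "2 * m\<^sup>2 * real (n - 1) \<le> 8 * m\<^sup>2 * real (n - 1)" by (intro mult_right_mono) auto
  then show "1 \<le> 8 * m\<^sup>2 * real (n - 1)" using large by linarith
qed

lemma n_le_double_pred: "real n \<le> 2 * real (n - 1)" using n by simp

text \<open>The projection coefficients solve the node equations whose right-hand sides are sums of
  weight times covariate along a row or column, at most n q / 4. The maximum principle applies, and
  n <= 2 (n - 1) turns 1 / 4 into 1 / 2.\<close>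

lemma L_bound:
  assumes t: "t < p" and k: "k < 2 * n - 1"
  shows "\<bar>L t k\<bar> \<le> q / (2 * m ^ 3)"
proof -
  define S where "S = real n * q / 4"
  have wz: "\<bar>w i j * z i j t\<bar> \<le> q / 4" if "i < n" "j < n" "i \<noteq> j" for i j
    using mult_mono[of "w i j" "1 / 4" "\<bar>z i j t\<bar>" q] w[OF that] z_le[OF that t] m by (simp add: abs_mult)
  have bound: "\<bar>\<Sum>j\<in>{..<n} - {i}. f j\<bar> \<le> S"
    if i: "i < n" and f: "\<And>j. j < n \<Longrightarrow> j \<noteq> i \<Longrightarrow> \<bar>f j\<bar> \<le> q / 4" for f and i
  proof -
    have "\<bar>\<Sum>j\<in>{..<n} - {i}. f j\<bar> \<le> (\<Sum>j\<in>{..<n} - {i}. q / 4)"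
      using f by (intro order_trans[OF sum_abs] sum_mono) auto
    also have "\<dots> \<le> S" using i q mult_right_mono[of "real (n - 1)" "real n" q] by (simp add: S_def)
    finally show ?thesis .
  qed
  have row: "(\<Sum>j\<in>{..<n} - {i}. w i j * effect n (L t) i j) = (\<Sum>j\<in>{..<n} - {i}. w i j * z i j t)"
    if "i < n" for i
    using orth_row[OF t that] by (simp add: algebra_simps sum_subtractf)
  have col: "(\<Sum>i\<in>{..<n} - {j}. w i j * effect n (L t) i j) = (\<Sum>i\<in>{..<n} - {j}. w i j * z i j t)"
    if "j < n - 1" for j
    using orth_col[OF t that] by (simp add: algebra_simps sum_subtractf)
  have last: "(\<Sum>i\<in>{..<n} - {n - 1}. w i (n - 1) * effect n (L t) i (n - 1))
      = (\<Sum>i\<in>{..<n} - {n - 1}. w i (n - 1) * z i (n - 1) t)"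
    using last_column_sum[of n "\<lambda>i j. w i j * effect n (L t) i j"]
      last_column_sum[of n "\<lambda>i j. w i j * z i j t"] n row col by simp
  have "\<bar>L t k\<bar> \<le> S / (m ^ 3 * real (n - 1))"
  proof (rule two_way_bound[OF n m _ half_weight_large(2) w _ _ _ k])
    show "0 \<le> S" using q by (simp add: S_def)
  next
    fix i assume "i < n"
    then show "\<bar>\<Sum>j\<in>{..<n} - {i}. w i j * effect n (L t) i j\<bar> \<le> S" unfolding row[OF \<open>i < n\<close>]
      by (intro bound wz) auto
  next
    fix j assume "j < n - 1"
    then show "\<bar>\<Sum>i\<in>{..<n} - {j}. w i j * effect n (L t) i j\<bar> \<le> S" unfolding col[OF \<open>j < n - 1\<close>]
      by (intro bound wz) auto
  next
    show "\<bar>\<Sum>i\<in>{..<n} - {n - 1}. w i (n - 1) * effect n (L t) i (n - 1)\<bar> \<le> S"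
      unfolding last using n by (intro bound wz) auto
  qed
  also have "\<dots> \<le> q / (2 * m ^ 3)"
  proof -
    have pos: "0 < m ^ 3" "0 < real (n - 1)" using n m by auto
    have "S \<le> q / 2 * real (n - 1)" using mult_left_mono[OF n_le_double_pred q] by (simp add: S_def)
    then have "S / (m ^ 3 * real (n - 1)) \<le> (q / 2 * real (n - 1)) / (m ^ 3 * real (n - 1))"
      using pos by (intro divide_right_mono) auto
    also have "\<dots> = q / (2 * m ^ 3)" using pos by simp
    finally show ?thesis .
  qed
  finally show ?thesis .
qed

end

section \<open>The logistic link and the estimating equations\<close>

text \<open>Derivative of \<open>mu\<close> and at the same time the variance of a Bernoulli
  variable with mean \<open>mu x\<close>: the weights of the Hessian are the edge variances.\<close>

definition mu_deriv :: "real \<Rightarrow> real" where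
  "mu_deriv x = mu x * (1 - mu x)"

lemma mu_has_derivative: "(mu has_real_derivative mu_deriv x) (at x)"
proof -
  have "1 + exp x \<noteq> 0" by (smt (verit) exp_gt_zero)
  then show ?thesis
    unfolding mu_def mu_deriv_def
    by (auto intro!: derivative_eq_intros simp: field_simps power2_eq_square)
qed

lemma mu_deriv_eq: "mu_deriv x = exp x / (1 + exp x)\<^sup>2"
proof -
  have "1 + exp x \<noteq> 0" by (smt (verit) exp_gt_zero)
  then show ?thesis by (simp add: mu_deriv_def mu_def field_simps power2_eq_square)
qed

lemma mu_deriv_pos: "0 < mu_deriv x"
proof -
  have "0 < 1 + exp x" by (simp add: add_pos_pos)
  then show ?thesis by (simp add: mu_deriv_eq)
qed

lemma mu_deriv_le: "mu_deriv x \<le> 1 / 4"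
proof -
  have "0 \<le> (mu x - 1 / 2)\<^sup>2" by simp
  then show ?thesis by (simp add: mu_deriv_def power2_eq_square algebra_simps)
qed

text \<open>The number 1 + exp x is at most twice the larger of 1 and exp x; its square in the
  denominator produces the 4. This is the origin of the lower weight bound exp(-\<rho>) / 4.\<close>

lemma mu_deriv_ge_exp: "exp (- \<bar>x\<bar>) / 4 \<le> mu_deriv x"
proof -
  have pos: "0 < 1 + exp x" by (simp add: add_pos_pos)
  have *: "exp (- \<bar>x\<bar>) * (1 + exp x)\<^sup>2 \<le> 4 * exp x"
  proof (cases "x \<ge> 0")
    case True
    have "(1 + exp x)\<^sup>2 \<le> (2 * exp x)\<^sup>2" using True by (intro power_mono) auto
    then have "exp (- x) * (1 + exp x)\<^sup>2 \<le> exp (- x) * (2 * exp x)\<^sup>2" by (intro mult_left_mono) auto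
    also have "\<dots> = 4 * exp x" by (simp add: power2_eq_square flip: exp_add)
    finally show ?thesis using True by simp
  next
    case False
    have "(1 + exp x)\<^sup>2 \<le> 2\<^sup>2" using False pos by (intro power_mono) auto
    then show ?thesis using False by simp
  qed
  then show ?thesis using pos by (simp add: mu_deriv_eq field_simps)
qed

text \<open>The logarithm of \<open>mu_deriv\<close> has derivative 1 - 2 \<open>mu\<close>, of
  modulus at most 1. The resulting inequality is checked directly on the closed form, according to
  the sign of \<open>t\<close>.\<close>

lemma mu_deriv_ratio: "mu_deriv (x + t) \<le> exp \<bar>t\<bar> * mu_deriv x"
proof -
  have pos: "0 < 1 + exp x" "0 < 1 + exp (x + t)" by (simp_all add: add_pos_pos)
  have *: "exp (x + t) * (1 + exp x)\<^sup>2 \<le> exp \<bar>t\<bar> * exp x * (1 + exp (x + t))\<^sup>2"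
  proof (cases "t \<ge> 0")
    case True
    have "(1 + exp x)\<^sup>2 \<le> (1 + exp (x + t))\<^sup>2" using True pos by (intro power_mono) auto
    then have "exp (x + t) * (1 + exp x)\<^sup>2 \<le> exp (x + t) * (1 + exp (x + t))\<^sup>2"
      by (intro mult_left_mono) auto
    then show ?thesis using True by (simp add: exp_add mult.commute)
  next
    case False
    have "1 \<le> exp (- t)" using False by simp
    then have "1 + exp x \<le> exp (- t) * (1 + exp (x + t))"
      by (simp add: algebra_simps flip: exp_add)
    then have "(1 + exp x)\<^sup>2 \<le> (exp (- t) * (1 + exp (x + t)))\<^sup>2" using pos by (intro power_mono) auto
    then have "exp (x + t) * (1 + exp x)\<^sup>2 \<le> exp (x + t) * (exp (- t) * (1 + exp (x + t)))\<^sup>2"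
      by (intro mult_left_mono) auto
    also have "\<dots> = exp (- t) * exp x * (1 + exp (x + t))\<^sup>2"
      by (simp add: exp_add exp_minus field_simps power2_eq_square)
    finally show ?thesis using False by simp
  qed
  have "exp (x + t) / (1 + exp (x + t))\<^sup>2 \<le> (exp \<bar>t\<bar> * exp x) / (1 + exp x)\<^sup>2"
    using * pos by (subst frac_le_eq[THEN iffD2, of "(1 + exp (x + t))\<^sup>2" "(1 + exp x)\<^sup>2"])
      (auto simp: divide_le_0_iff zero_less_mult_iff mult.commute)
  then show ?thesis by (simp add: mu_deriv_eq)
qed

lemma exp_minus_1_le: "0 \<le> t \<Longrightarrow> t \<le> 1 \<Longrightarrow> exp t - 1 \<le> 2 * t" for t :: real
  using exp_bound[of t] mult_left_mono[of t 1 t] by (simp add: power2_eq_square)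

text \<open>The error is relative to \<open>mu_deriv x\<close>: weights may be as small as
  exp(-\<rho>) / 4, and only a relative error gives a contraction factor common to all
  edges.\<close>

lemma mu_deriv_diff:
  assumes "\<bar>t\<bar> \<le> r" "r \<le> 1"
  shows "\<bar>mu_deriv (x + t) - mu_deriv x\<bar> \<le> 2 * r * mu_deriv x"
proof -
  have e: "exp \<bar>t\<bar> \<le> 1 + 2 * r" using exp_minus_1_le[of "\<bar>t\<bar>"] assms by simp
  have up: "mu_deriv (x + t) \<le> (1 + 2 * r) * mu_deriv x"
    using mu_deriv_ratio[of x t] mult_right_mono[OF e, of "mu_deriv x"] mu_deriv_pos[of x]
    by (meson less_imp_le order_trans)
  have "mu_deriv x \<le> exp \<bar>t\<bar> * mu_deriv (x + t)" using mu_deriv_ratio[of "x + t" "- t"] by simp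
  then have "exp (- \<bar>t\<bar>) * mu_deriv x \<le> exp (- \<bar>t\<bar>) * (exp \<bar>t\<bar> * mu_deriv (x + t))"
    by (intro mult_left_mono) auto
  then have "exp (- \<bar>t\<bar>) * mu_deriv x \<le> mu_deriv (x + t)" by (simp flip: exp_add mult.assoc)
  moreover have "1 - \<bar>t\<bar> \<le> exp (- \<bar>t\<bar>)" using exp_ge_add_one_self[of "- \<bar>t\<bar>"] by simp
  then have "(1 - 2 * r) * mu_deriv x \<le> exp (- \<bar>t\<bar>) * mu_deriv x"
    using assms mu_deriv_pos[of x] by (intro mult_right_mono) auto
  ultimately show ?thesis using up by (simp add: algebra_simps abs_le_iff)
qed

text \<open>Mean value theorem: the intermediate point stays within r of \<open>x\<close>, so its
  slope is compared with the one at \<open>x\<close>. The two orders of \<open>s\<close> and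
  \<open>t\<close> are equivalent.\<close>

lemma mu_near_linear:
  assumes "\<bar>s\<bar> \<le> r" "\<bar>t\<bar> \<le> r" "r \<le> 1"
  shows "\<bar>mu (x + s) - mu (x + t) - mu_deriv x * (s - t)\<bar> \<le> 2 * r * mu_deriv x * \<bar>s - t\<bar>"
proof -
  have *: "\<bar>mu (x + b) - mu (x + a) - mu_deriv x * (b - a)\<bar> \<le> 2 * r * mu_deriv x * \<bar>b - a\<bar>"
    if ab: "a < b" "- r \<le> a" "b \<le> r" for a b
  proof -
    obtain c where c: "x + a < c" "c < x + b" "mu (x + b) - mu (x + a) = (b - a) * mu_deriv c"
      using MVT2[of "x + a" "x + b" mu mu_deriv] mu_has_derivative ab(1) by auto
    have "\<bar>mu_deriv (x + (c - x)) - mu_deriv x\<bar> \<le> 2 * r * mu_deriv x"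
      using c ab assms by (intro mu_deriv_diff) auto
    then have "\<bar>mu_deriv c - mu_deriv x\<bar> * \<bar>b - a\<bar> \<le> 2 * r * mu_deriv x * \<bar>b - a\<bar>"
      by (intro mult_right_mono) auto
    moreover have "mu (x + b) - mu (x + a) - mu_deriv x * (b - a) = (mu_deriv c - mu_deriv x) * (b - a)"
      using c(3) by (simp add: algebra_simps)
    ultimately show ?thesis by (simp add: abs_mult)
  qed
  show ?thesis
  proof (cases s t rule: linorder_cases)
    case less
    have "\<bar>mu (x + s) - mu (x + t) - mu_deriv x * (s - t)\<bar> = \<bar>mu (x + t) - mu (x + s) - mu_deriv x * (t - s)\<bar>"
      by (subst abs_minus_cancel[symmetric]) (simp add: algebra_simps)
    then show ?thesis using *[of s t] less assms by (simp add: abs_minus_commute)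
  next
    case greater
    then show ?thesis using *[of t s] assms by simp
  qed simp
qed

lemma mu_lipschitz: "\<bar>mu (x + s) - mu x\<bar> \<le> \<bar>s\<bar> / 4"
proof -
  have *: "\<bar>mu b - mu a\<bar> \<le> (b - a) / 4" if ab: "a < b" for a b
  proof -
    obtain c where c: "mu b - mu a = (b - a) * mu_deriv c"
      using MVT2[of a b mu mu_deriv] mu_has_derivative ab(1) by auto
    have "(b - a) * mu_deriv c \<le> (b - a) * (1 / 4)"
      using ab mu_deriv_le[of c] by (intro mult_left_mono) auto
    then show ?thesis using c ab mu_deriv_pos[of c] by (simp add: abs_mult)
  qed
  show ?thesis
    by (cases s "0::real" rule: linorder_cases)
       (use *[of "x + s" x] *[of x "x + s"] in \<open>auto simp: abs_minus_commute\<close>)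
qed

lemma mu_strict_mono: "a < b \<Longrightarrow> mu a < mu b"
  by (rule DERIV_pos_imp_increasing[of a b mu]) (use mu_has_derivative mu_deriv_pos in blast)+

text \<open>The logistic increment around \<open>x\<close>, continued linearly outside \<open>[-r, r]\<close>; its slopes stay
  comparable to \<open>mu_deriv x\<close> on the whole line.\<close>
definition clipped :: "real \<Rightarrow> real \<Rightarrow> real \<Rightarrow> real" where
  "clipped r x t = mu (x + max (- r) (min r t)) - mu x + mu_deriv x * (t - max (- r) (min r t))"

text \<open>Outside [-r, r] the continuation is exactly linear with slope \<open>mu_deriv x\<close>.
  The deviation from linearity therefore depends on the clipped arguments only, and clipping does
  not increase distances.\<close>

lemma clipped_near_linear:
  assumes "0 \<le> r" "r \<le> 1"
  shows "\<bar>clipped r x s - clipped r x t - mu_deriv x * (s - t)\<bar> \<le> 2 * r * mu_deriv x * \<bar>s - t\<bar>"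
proof -
  define c where "c t = max (- r) (min r t)" for t
  have c: "\<bar>c t\<bar> \<le> r" for t using assms by (auto simp: c_def)
  have "\<bar>clipped r x s - clipped r x t - mu_deriv x * (s - t)\<bar>
      = \<bar>mu (x + c s) - mu (x + c t) - mu_deriv x * (c s - c t)\<bar>"
    by (simp add: clipped_def c_def algebra_simps)
  also have "\<dots> \<le> 2 * r * mu_deriv x * \<bar>c s - c t\<bar>" by (rule mu_near_linear) (use c assms in auto)
  also have "\<dots> \<le> 2 * r * mu_deriv x * \<bar>s - t\<bar>"
    using assms mu_deriv_pos[of x] by (intro mult_left_mono) (auto simp: c_def)
  finally show ?thesis .
qed

lemma clipped_zero [simp]: "0 \<le> r \<Longrightarrow> clipped r x 0 = 0"
  by (simp add: clipped_def)

lemma clipped_eq: "\<bar>t\<bar> \<le> r \<Longrightarrow> clipped r x t = mu (x + t) - mu x"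
proof -
  assume "\<bar>t\<bar> \<le> r"
  then have "max (- r) (min r t) = t" by auto
  then show ?thesis by (simp add: clipped_def)
qed

text \<open>The moduli of the clipped part and of the excess add up to that of \<open>t\<close>, and
  both slopes are at most 1 / 4. Thus the secant slopes obey the upper bound required by the maximum
  principle.\<close>

lemma clipped_le:
  assumes "0 \<le> r"
  shows "\<bar>clipped r x t\<bar> \<le> \<bar>t\<bar> / 4"
proof -
  define c where "c = max (- r) (min r t)"
  have "\<bar>clipped r x t\<bar> \<le> \<bar>mu (x + c) - mu x\<bar> + \<bar>mu_deriv x * (t - c)\<bar>"
    unfolding clipped_def c_def by (rule abs_triangle_ineq)
  also have "\<dots> \<le> \<bar>c\<bar> / 4 + 1 / 4 * \<bar>t - c\<bar>"
    unfolding abs_mult using mu_deriv_pos[of x] mu_deriv_le[of x]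
    by (intro add_mono mu_lipschitz mult_right_mono) auto
  also have "\<dots> = \<bar>t\<bar> / 4" using assms by (auto simp: c_def)
  finally show ?thesis .
qed

section \<open>A priori estimates and solvability in a two-way design\<close>

context two_way_design
begin

text \<open>Identifiability. A vanishing predictor has score 0, so \<open>H_inv\<close> with bound 0
  removes the covariate part; the maximum principle with right-hand side 0 then removes the node
  part.\<close>

lemma pred_kernel:
  assumes zero: "\<And>i j. (i, j) \<in> node_pairs n \<Longrightarrow> pred u i j = 0" and k: "k < 2 * n - 1 + p"
  shows "u k = 0"
proof -
  have "(\<Sum>(i, j)\<in>node_pairs n. w i j * \<zeta> s i j * pred u i j) = 0" for s
    using zero by (intro sum.neutral) auto
  then have "\<bar>u (2 * n - 1 + t)\<bar> \<le> \<Lambda> * 0" if "t < p" for t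
    using orth_pred[of _ u] by (intro H_inv[OF that]) (simp add: \<zeta>_def)
  then have cov: "u (2 * n - 1 + t) = 0" if "t < p" for t using that by simp
  then have eff: "effect n u i j = 0" if "i < n" "j < n" "i \<noteq> j" for i j
    using zero[of i j] that by (simp add: pred_def node_pairs_def)
  show ?thesis
  proof (cases "k < 2 * n - 1")
    case True
    have "\<bar>u k\<bar> \<le> 0 / (m ^ 3 * real (n - 1))"
      by (rule two_way_bound[OF n m _ half_weight_large(2) w _ _ _ True]) (use n in \<open>auto simp: eff intro!: sum.neutral\<close>)
    then show ?thesis by simp
  next
    case False
    then show ?thesis using cov[of "k - (2 * n - 1)"] k by simp
  qed
qed

lemma cov_part_le:
  assumes G: "\<And>t. t < p \<Longrightarrow> \<bar>\<delta> t\<bar> \<le> G" and ij: "i < n" "j < n" "i \<noteq> j"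
  shows "\<bar>\<Sum>t<p. z i j t * \<delta> t\<bar> \<le> real p * q * G"
proof -
  have "\<bar>\<Sum>t<p. z i j t * \<delta> t\<bar> \<le> (\<Sum>t<p. \<bar>z i j t\<bar> * \<bar>\<delta> t\<bar>)" unfolding abs_mult[symmetric] by (rule sum_abs)
  also have "\<dots> \<le> (\<Sum>t<p. q * G)" using z_le[OF ij] G q by (intro sum_mono mult_mono) auto
  finally show ?thesis by simp
qed

text \<open>The covariate part of the predictor is moved to the right-hand side, where each pair
  contributes at most p q G / 4. The constant 16 is 2^3 from the lower bound \<open>m / 2\<close>
  times 2 from n <= 2 (n - 1).\<close>

lemma effect_estimate:
  fixes V :: "nat \<Rightarrow> nat \<Rightarrow> real" and u :: "nat \<Rightarrow> real"
  assumes X: "0 \<le> X" and G0: "0 \<le> G"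
    and V: "\<And>i j. i < n \<Longrightarrow> j < n \<Longrightarrow> i \<noteq> j \<Longrightarrow> m / 2 \<le> V i j \<and> V i j \<le> 1 / 4"
    and row: "\<And>i. i < n \<Longrightarrow> \<bar>\<Sum>j\<in>{..<n} - {i}. V i j * pred u i j\<bar> \<le> X"
    and col: "\<And>j. j < n - 1 \<Longrightarrow> \<bar>\<Sum>i\<in>{..<n} - {j}. V i j * pred u i j\<bar> \<le> X"
    and last: "\<bar>\<Sum>i\<in>{..<n} - {n - 1}. V i (n - 1) * pred u i (n - 1)\<bar> \<le> X"
    and G: "\<And>t. t < p \<Longrightarrow> \<bar>u (2 * n - 1 + t)\<bar> \<le> G"
    and k: "k < 2 * n - 1"
  shows "\<bar>u k\<bar> \<le> 16 / m ^ 3 * (X / real n + real p * q * G / 4)"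
proof -
  define c where "c i j = (\<Sum>t<p. z i j t * u (2 * n - 1 + t))" for i j
  define K where "K = real p * q * G / 4"
  have K: "0 \<le> K" using q G0 by (simp add: K_def)
  have Vc: "\<bar>V i j * c i j\<bar> \<le> K" if "i < n" "j < n" "i \<noteq> j" for i j
    using mult_mono[of "V i j" "1 / 4" "\<bar>c i j\<bar>" "real p * q * G"] V[OF that] m
      cov_part_le[OF G that] by (simp add: abs_mult K_def c_def)
  have bound: "\<bar>\<Sum>j\<in>{..<n} - {i}. f j\<bar> \<le> real n * K"
    if i: "i < n" and f: "\<And>j. j < n \<Longrightarrow> j \<noteq> i \<Longrightarrow> \<bar>f j\<bar> \<le> K" for f and i
  proof -
    have "\<bar>\<Sum>j\<in>{..<n} - {i}. f j\<bar> \<le> (\<Sum>j\<in>{..<n} - {i}. K)"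
      using f by (intro order_trans[OF sum_abs] sum_mono) auto
    also have "\<dots> \<le> real n * K" using i K by (simp add: mult_right_mono)
    finally show ?thesis .
  qed
  have eff: "V i j * effect n u i j = V i j * pred u i j - V i j * c i j" for i j
    by (simp add: pred_def c_def algebra_simps)
  have diff: "\<bar>a - b\<bar> \<le> X + real n * K" if "\<bar>a\<bar> \<le> X" "\<bar>b\<bar> \<le> real n * K" for a b :: real
    using that by linarith
  have "\<bar>u k\<bar> \<le> (X + real n * K) / ((m / 2) ^ 3 * real (n - 1))"
  proof (rule two_way_bound[OF n _ _ half_weight_large(1) V _ _ _ k])
    show "0 \<le> X + real n * K" "0 < m / 2" using X K m by auto
  next
    fix i assume i: "i < n"
    show "\<bar>\<Sum>j\<in>{..<n} - {i}. V i j * effect n u i j\<bar> \<le> X + real n * K"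
      unfolding eff sum_subtractf by (intro diff row[OF i] bound Vc) (use i in auto)
  next
    fix j assume j: "j < n - 1"
    show "\<bar>\<Sum>i\<in>{..<n} - {j}. V i j * effect n u i j\<bar> \<le> X + real n * K"
      unfolding eff sum_subtractf by (intro diff col[OF j] bound Vc) (use j in auto)
  next
    show "\<bar>\<Sum>i\<in>{..<n} - {n - 1}. V i (n - 1) * effect n u i (n - 1)\<bar> \<le> X + real n * K"
      unfolding eff sum_subtractf by (intro diff last bound Vc) (use n in auto)
  qed
  also have "\<dots> \<le> (X + real n * K) / ((m / 2) ^ 3 * (real n / 2))"
    using n_le_double_pred n m X K by (intro divide_left_mono mult_left_mono mult_pos_pos) auto
  also have "\<dots> = 16 / m ^ 3 * (X / real n + K)"
    using n m by (simp add: field_simps power_divide)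
  finally show ?thesis by (simp add: K_def)
qed

text \<open>The score is formed with the slopes \<open>V\<close>, while orthogonality and
  \<open>H_inv\<close> refer to \<open>w\<close>. Exchanging them costs at most
  \<open>\<kappa> * w i j * D\<close> against each residual, and \<open>\<zeta>_abs\<close> sums
  these errors.\<close>

lemma cov_estimate:
  fixes V :: "nat \<Rightarrow> nat \<Rightarrow> real" and u :: "nat \<Rightarrow> real"
  assumes \<kappa>: "0 \<le> \<kappa>" and D: "0 \<le> D"
    and V: "\<And>i j. i < n \<Longrightarrow> j < n \<Longrightarrow> i \<noteq> j \<Longrightarrow> \<bar>V i j - w i j\<bar> \<le> \<kappa> * w i j"
    and pred: "\<And>i j. i < n \<Longrightarrow> j < n \<Longrightarrow> i \<noteq> j \<Longrightarrow> \<bar>pred u i j\<bar> \<le> D"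
    and score: "\<And>s. s < p \<Longrightarrow> \<bar>\<Sum>(i, j)\<in>node_pairs n. V i j * pred u i j * \<zeta> s i j\<bar> \<le> B"
    and t: "t < p"
  shows "\<bar>u (2 * n - 1 + t)\<bar> \<le> \<Lambda> * (B + \<kappa> * D * (q * (real n)\<^sup>2 / 4))"
proof (rule H_inv[OF t])
  fix s assume s: "s < p"
  define R where "R = (\<Sum>(i, j)\<in>node_pairs n. (w i j - V i j) * pred u i j * \<zeta> s i j)"
  have "(\<Sum>(i, j)\<in>node_pairs n. w i j * \<zeta> s i j * (\<Sum>t<p. z i j t * u (2 * n - 1 + t)))
      = (\<Sum>(i, j)\<in>node_pairs n. w i j * \<zeta> s i j * pred u i j)"
    by (rule orth_pred[OF s, symmetric])
  also have "\<dots> = (\<Sum>(i, j)\<in>node_pairs n. V i j * pred u i j * \<zeta> s i j) + R"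
    unfolding R_def by (simp add: case_prod_beta algebra_simps flip: sum.distrib)
  finally have eq: "(\<Sum>(i, j)\<in>node_pairs n. w i j * \<zeta> s i j * (\<Sum>t<p. z i j t * u (2 * n - 1 + t)))
      = (\<Sum>(i, j)\<in>node_pairs n. V i j * pred u i j * \<zeta> s i j) + R" .
  have "\<bar>R\<bar> \<le> (\<Sum>(i, j)\<in>node_pairs n. \<kappa> * D * (w i j * \<bar>\<zeta> s i j\<bar>))"
    unfolding R_def
  proof (intro order_trans[OF sum_abs] sum_mono, clarify)
    fix i j assume "(i, j) \<in> node_pairs n"
    then have ij: "i < n" "j < n" "i \<noteq> j" by (auto simp: node_pairs_def)
    have "\<bar>w i j - V i j\<bar> * \<bar>pred u i j\<bar> * \<bar>\<zeta> s i j\<bar> \<le> \<kappa> * w i j * D * \<bar>\<zeta> s i j\<bar>"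
      using V[OF ij] pred[OF ij] w[OF ij] m \<kappa>
      by (intro mult_mono) (auto simp: abs_minus_commute intro!: mult_nonneg_nonneg)
    then show "\<bar>(w i j - V i j) * pred u i j * \<zeta> s i j\<bar> \<le> \<kappa> * D * (w i j * \<bar>\<zeta> s i j\<bar>)"
      by (simp add: abs_mult ac_simps)
  qed
  also have "\<dots> = \<kappa> * D * (\<Sum>(i, j)\<in>node_pairs n. w i j * \<bar>\<zeta> s i j\<bar>)"
    by (simp add: sum_distrib_left case_prod_beta)
  also have "\<dots> \<le> \<kappa> * D * (q * (real n)\<^sup>2 / 4)"
    using \<zeta>_abs[OF s] \<kappa> D by (intro mult_left_mono) auto
  finally have "\<bar>R\<bar> \<le> \<kappa> * D * (q * (real n)\<^sup>2 / 4)" .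
  then show "\<bar>\<Sum>(i, j)\<in>node_pairs n. w i j * (z i j s - effect n (L s) i j) * (\<Sum>t<p. z i j t * u (2 * n - 1 + t))\<bar>
      \<le> B + \<kappa> * D * (q * (real n)\<^sup>2 / 4)"
    using score[OF s] eq by (simp add: \<zeta>_def)
qed

lemma incidence_pred:
  assumes "i < n" "j < n"
  shows "(\<Sum>k<2 * n - 1 + p. incidence n z k (i, j) * u k) = pred u i j"
proof -
  have "(\<Sum>i'<n. incidence n z i' (i, j) * u i') = (\<Sum>i'<n. if i' = i then u i' else 0)"
    by (rule sum.cong) (auto simp: incidence_def)
  moreover have "(\<Sum>j'<n - 1. incidence n z (n + j') (i, j) * u (n + j')) = (\<Sum>j'<n - 1. if j' = j then u (n + j') else 0)"
    by (rule sum.cong) (auto simp: incidence_def)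
  moreover have "(\<Sum>t<p. incidence n z (2 * n - 1 + t) (i, j) * u (2 * n - 1 + t)) = (\<Sum>t<p. z i j t * u (2 * n - 1 + t))"
    using n by (intro sum.cong) (auto simp: incidence_def)
  ultimately show ?thesis
    unfolding sum_params[OF n] pred_def effect_def using assms by simp
qed

text \<open>The node bound \<open>T\<close> contains the covariate bound \<open>G\<close>, and
  \<open>G\<close> in turn is bounded through the predictor bound \<open>D\<close>, which contains
  \<open>T\<close>. Hypothesis \<open>\<eta>\<close> makes the feedback factor at most 1 / 4, so
  that it is absorbed and \<open>G \<le> x\<close> remains. Then \<open>D\<close> is at most 32 A P
  (x + G) <= 64 A P x, which explains the 64 in \<open>r\<close>: the clipping radius is exactly the
  bound that comes out.\<close>

lemma combine_estimates:
  fixes u :: "nat \<Rightarrow> real" and V :: "nat \<Rightarrow> nat \<Rightarrow> real" and X B :: real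
  defines "A \<equiv> 1 / m ^ 3" and "P \<equiv> 1 + real p * q"
  defines "r \<equiv> 64 * A * P * (X / real n)"
  assumes X: "0 \<le> X" and B: "0 \<le> B" and r: "r \<le> 1 / 4"
    and \<eta>: "16 * (\<Lambda> * (real n)\<^sup>2) * r * q * A * P \<le> 1 / 4"
    and \<Lambda>B: "4 * (\<Lambda> * B) \<le> X / real n"
    and V_le: "\<And>i j. i < n \<Longrightarrow> j < n \<Longrightarrow> i \<noteq> j \<Longrightarrow> V i j \<le> 1 / 4"
    and V: "\<And>i j. i < n \<Longrightarrow> j < n \<Longrightarrow> i \<noteq> j \<Longrightarrow> \<bar>V i j - w i j\<bar> \<le> 2 * r * w i j"
    and row: "\<And>i. i < n \<Longrightarrow> \<bar>\<Sum>j\<in>{..<n} - {i}. V i j * pred u i j\<bar> \<le> X"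
    and col: "\<And>j. j < n - 1 \<Longrightarrow> \<bar>\<Sum>i\<in>{..<n} - {j}. V i j * pred u i j\<bar> \<le> X"
    and last: "\<bar>\<Sum>i\<in>{..<n} - {n - 1}. V i (n - 1) * pred u i (n - 1)\<bar> \<le> X"
    and score: "\<And>s. s < p \<Longrightarrow> \<bar>\<Sum>(i, j)\<in>node_pairs n. V i j * pred u i j * \<zeta> s i j\<bar> \<le> B"
  shows "i < n \<Longrightarrow> j < n \<Longrightarrow> i \<noteq> j \<Longrightarrow> \<bar>pred u i j\<bar> \<le> r"
    and "k < 2 * n - 1 \<Longrightarrow> \<bar>u k\<bar> \<le> r"
    and "t < p \<Longrightarrow> \<bar>u (2 * n - 1 + t)\<bar>
      \<le> 2 * (\<Lambda> * B) + 2 * (16 * (\<Lambda> * (real n)\<^sup>2) * r * q * A * P) * (X / real n)"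
proof -
  define x where "x = X / real n"
  define \<eta>' where "\<eta>' = 16 * (\<Lambda> * (real n)\<^sup>2) * r * q * A * P"
  \<comment> \<open>\<open>insert 0\<close> covers the empty family and makes \<open>G\<close>
    nonnegative.\<close>
  define G where "G = Max (insert 0 ((\<lambda>t. \<bar>u (2 * n - 1 + t)\<bar>) ` {..<p}))"
  define T where "T = 16 * A * (x + real p * q * G / 4)"
  define D where "D = 2 * T + real p * q * G"
  have G: "0 \<le> G" "\<And>t. t < p \<Longrightarrow> \<bar>u (2 * n - 1 + t)\<bar> \<le> G" by (auto simp: G_def intro!: Max_ge)
  have x: "0 \<le> x" using X by (simp add: x_def)
  have m4: "m \<le> 1 / 4" using w[of 0 1] n by simp
  have A: "1 \<le> A"
  proof -
    have "m ^ 3 \<le> 1" using m m4 by (intro power_le_one) auto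
    then show ?thesis using m by (simp add: A_def)
  qed
  have P: "1 \<le> P" "real p * q \<le> P" using q by (auto simp: P_def)
  have r0: "0 \<le> r" using A P x unfolding r_def x_def[symmetric] by simp
  \<comment> \<open>The relative error 2 r is at most 1 / 2, so the slopes stay above half the
    weights.\<close>
  have V_ge: "m / 2 \<le> V i j" if ij: "i < n" "j < n" "i \<noteq> j" for i j
  proof -
    have "2 * r * w i j \<le> 1 / 2 * w i j" using r w[OF ij] m by (intro mult_right_mono) auto
    then show ?thesis using V[OF ij] w[OF ij] by linarith
  qed
  have T: "\<bar>u k\<bar> \<le> T" if "k < 2 * n - 1" for k
    using effect_estimate[where V = V, OF X G(1) _ row col last G(2) that] V_ge V_le
    by (simp add: T_def A_def x_def)
  have T0: "0 \<le> T" using A x q G(1) by (simp add: T_def)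
  have D0: "0 \<le> D" using T0 q G(1) by (simp add: D_def)
  have D: "\<bar>pred u i j\<bar> \<le> D" if ij: "i < n" "j < n" "i \<noteq> j" for i j
  proof -
    have "\<bar>u i\<bar> \<le> T" using T[of i] ij n by simp
    moreover have "\<bar>if j < n - 1 then u (n + j) else 0\<bar> \<le> T" using T[of "n + j"] T0 by simp
    moreover have "\<bar>\<Sum>t<p. z i j t * u (2 * n - 1 + t)\<bar> \<le> real p * q * G"
      by (rule cov_part_le[OF G(2) ij])
    ultimately show ?thesis unfolding pred_def effect_def D_def by linarith
  qed
  have D_le: "D \<le> 32 * A * P * (x + G)"
  proof -
    have pq: "0 \<le> real p * q" using q by simp
    have "D = 32 * A * x + (8 * A + 1) * (real p * q * G)" by (simp add: D_def T_def algebra_simps)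
    also have "\<dots> \<le> 32 * A * P * x + 32 * A * (P * G)"
    proof (intro add_mono)
      have "32 * A * x * 1 \<le> 32 * A * x * P" using A P x by (intro mult_left_mono) auto
      then show "32 * A * x \<le> 32 * A * P * x" by (simp add: ac_simps)
      show "(8 * A + 1) * (real p * q * G) \<le> 32 * A * (P * G)"
        using A P G(1) pq by (intro mult_mono mult_right_mono) auto
    qed
    finally show ?thesis by (simp add: algebra_simps)
  qed
  have cov: "\<bar>u (2 * n - 1 + t)\<bar> \<le> \<Lambda> * B + \<eta>' * (x + G)" if "t < p" for t
  proof -
    have "\<bar>u (2 * n - 1 + t)\<bar> \<le> \<Lambda> * (B + (2 * r) * D * (q * (real n)\<^sup>2 / 4))"
      by (rule cov_estimate[OF _ D0 V D score that]) (use r0 in auto)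
    also have "\<dots> = \<Lambda> * B + \<Lambda> * (real n)\<^sup>2 * r * q / 2 * D" by (simp add: algebra_simps)
    also have "\<dots> \<le> \<Lambda> * B + \<Lambda> * (real n)\<^sup>2 * r * q / 2 * (32 * A * P * (x + G))"
      using D_le \<Lambda> r0 q by (intro add_left_mono mult_left_mono) auto
    also have "\<dots> = \<Lambda> * B + \<eta>' * (x + G)" by (simp add: \<eta>'_def)
    finally show ?thesis .
  qed
  have \<eta>0: "0 \<le> \<eta>'" using \<Lambda> r0 q A P by (simp add: \<eta>'_def)
  have nn: "0 \<le> \<Lambda> * B" using \<Lambda> B by simp
  define c where "c = \<Lambda> * B + \<eta>' * (x + G)"
  have "0 \<le> c" using nn \<eta>0 x G(1) by (simp add: c_def)
  then have "G \<le> c" unfolding G_def using cov by (intro Max.boundedI) (auto simp: c_def[symmetric])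
  then have "G \<le> \<Lambda> * B + \<eta>' * (x + G)" by (simp add: c_def)
  moreover have "\<eta>' * G \<le> 1 / 4 * G" using \<eta> G(1) by (intro mult_right_mono) (simp_all add: \<eta>'_def)
  ultimately have G_le: "3 * G \<le> 4 * (\<Lambda> * B) + 4 * (\<eta>' * x)" by (simp add: algebra_simps)
  have \<eta>x: "0 \<le> \<eta>' * x" "\<eta>' * x \<le> 1 / 4 * x"
    using \<eta>0 x mult_right_mono[OF \<eta>[folded \<eta>'_def] x] by simp_all
  have Gx: "G \<le> x" using G_le \<eta>x \<Lambda>B[folded x_def] x by linarith
  have "32 * A * P * (x + G) \<le> 32 * A * P * (x + x)"
    using Gx A P by (intro mult_left_mono) auto
  then have Dr: "D \<le> r" using D_le by (simp add: r_def x_def)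
  show "\<bar>pred u i j\<bar> \<le> r" if "i < n" "j < n" "i \<noteq> j" using D[OF that] Dr by simp
  show "\<bar>u k\<bar> \<le> r" if "k < 2 * n - 1"
  proof -
    have "0 \<le> real p * q * G" using q G(1) by simp
    then show ?thesis using T[OF that] T0 Dr unfolding D_def by linarith
  qed
  show "\<bar>u (2 * n - 1 + t)\<bar>
      \<le> 2 * (\<Lambda> * B) + 2 * (16 * (\<Lambda> * (real n)\<^sup>2) * r * q * A * P) * (X / real n)" if "t < p"
    using G(2)[OF that] G_le nn \<eta>x unfolding \<eta>'_def[symmetric] x_def[symmetric] by linarith
qed

text \<open>A solution of the clipped equations solves linear equations whose weights are the secant
  slopes \<open>V\<close>, comparable with \<open>w\<close> whatever the size of \<open>u\<close>.
  \<open>combine_estimates\<close> then puts every predictor into [-r, r], where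
  \<open>clipped\<close> is the true increment. In the hypotheses, \<open>g_last\<close> concerns
  the recovered last column and \<open>g_score\<close> the covariate equations after subtraction of
  the projected node equations.\<close>

lemma estimating_equations_solvable:
  fixes g :: "nat \<Rightarrow> real" and x0 :: "nat \<Rightarrow> nat \<Rightarrow> real" and X B :: real
  defines "A \<equiv> 1 / m ^ 3" and "P \<equiv> 1 + real p * q"
  defines "r \<equiv> 64 * A * P * (X / real n)"
  assumes w_mu: "\<And>i j. w i j = mu_deriv (x0 i j)"
    and X: "0 \<le> X" and B: "0 \<le> B" and r: "r \<le> 1 / 4"
    and \<eta>: "16 * (\<Lambda> * (real n)\<^sup>2) * r * q * A * P \<le> 1 / 4"
    and \<Lambda>B: "4 * (\<Lambda> * B) \<le> X / real n"
    and g: "\<And>k. k < 2 * n - 1 \<Longrightarrow> \<bar>g k\<bar> \<le> X"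
    and g_last: "\<bar>(\<Sum>i<n. g i) - (\<Sum>j<n - 1. g (n + j))\<bar> \<le> X"
    and g_score: "\<And>s. s < p \<Longrightarrow>
      \<bar>g (2 * n - 1 + s) - (\<Sum>i<n. L s i * g i) - (\<Sum>j<n - 1. L s (n + j) * g (n + j))\<bar> \<le> B"
  shows "\<exists>u. (\<forall>k<2 * n - 1 + p. (\<Sum>(i, j)\<in>node_pairs n.
            incidence n z k (i, j) * (mu (x0 i j + pred u i j) - mu (x0 i j))) = g k)
    \<and> (\<forall>k<2 * n - 1. \<bar>u k\<bar> \<le> r)
    \<and> (\<forall>t<p. \<bar>u (2 * n - 1 + t)\<bar>
          \<le> 2 * (\<Lambda> * B) + 2 * (16 * (\<Lambda> * (real n)\<^sup>2) * r * q * A * P) * (X / real n))"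
proof -
  let ?x = "\<lambda>e. x0 (fst e) (snd e)"
  have r0: "0 \<le> r" using m q X n by (simp add: r_def A_def P_def)
  have pred: "(\<Sum>k<2 * n - 1 + p. incidence n z k e * u k) = pred u (fst e) (snd e)"
    if "e \<in> node_pairs n" for e u
    using that incidence_pred[of "fst e" "snd e" u] by (auto simp: node_pairs_def)
  have "\<exists>u. \<forall>k<2 * n - 1 + p. (\<Sum>e\<in>node_pairs n. incidence n z k e
      * clipped r (?x e) (\<Sum>l<2 * n - 1 + p. incidence n z l e * u l)) = g k"
  proof (rule near_linear_system_solvable[where w = "\<lambda>e. mu_deriv (?x e)" and \<kappa> = "2 * r"
        and X = "\<lambda>e k. incidence n z k e" and \<nu> = "\<lambda>e. clipped r (?x e)"])
    fix u assume zero: "\<forall>e\<in>node_pairs n. (\<Sum>k<2 * n - 1 + p. incidence n z k e * u k) = 0"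
    have "pred u i j = 0" if "(i, j) \<in> node_pairs n" for i j
      using pred[OF that, of u] bspec[OF zero that] by simp
    then show "\<forall>k<2 * n - 1 + p. u k = 0" using pred_kernel by blast
  next
    fix e s t
    show "\<bar>clipped r (?x e) s - clipped r (?x e) t - mu_deriv (?x e) * (s - t)\<bar>
        \<le> 2 * r * mu_deriv (?x e) * \<bar>s - t\<bar>"
      by (rule clipped_near_linear) (use r r0 in auto)
  qed (use r r0 mu_deriv_pos in auto)
  then obtain u where u: "\<And>k. k < 2 * n - 1 + p \<Longrightarrow> (\<Sum>e\<in>node_pairs n. incidence n z k e
      * clipped r (?x e) (\<Sum>l<2 * n - 1 + p. incidence n z l e * u l)) = g k"
    by blast
  \<comment> \<open>At a zero predictor the slope is set to the true weight, so that the bounds on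
    \<open>V\<close> hold for all pairs.\<close>
  define V where "V i j = (if pred u i j = 0 then w i j else clipped r (x0 i j) (pred u i j) / pred u i j)" for i j
  have V_pred: "V i j * pred u i j = clipped r (x0 i j) (pred u i j)" for i j
    using r0 by (simp add: V_def)
  have eq: "(\<Sum>e\<in>node_pairs n. incidence n z k e * (V (fst e) (snd e) * pred u (fst e) (snd e))) = g k"
    if "k < 2 * n - 1 + p" for k
    unfolding u[OF that, symmetric] V_pred using pred by (intro sum.cong) auto
  have V_le: "V i j \<le> 1 / 4" for i j
  proof (cases "pred u i j = 0")
    case False
    have "clipped r (x0 i j) (pred u i j) / pred u i j \<le> \<bar>clipped r (x0 i j) (pred u i j)\<bar> / \<bar>pred u i j\<bar>"
      by (metis abs_divide abs_ge_self)
    also have "\<dots> \<le> 1 / 4" using clipped_le[OF r0, of "x0 i j" "pred u i j"] False by (simp add: field_simps)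
    finally show ?thesis using False by (simp add: V_def)
  qed (use mu_deriv_le[of "x0 i j"] in \<open>simp add: V_def w_mu\<close>)
  have V: "\<bar>V i j - w i j\<bar> \<le> 2 * r * w i j" for i j
  proof (cases "pred u i j = 0")
    case False
    have "\<bar>V i j - w i j\<bar> * \<bar>pred u i j\<bar> = \<bar>clipped r (x0 i j) (pred u i j) - w i j * pred u i j\<bar>"
      unfolding V_pred[symmetric] by (simp add: left_diff_distrib flip: abs_mult)
    also have "\<dots> \<le> 2 * r * w i j * \<bar>pred u i j\<bar>"
      using clipped_near_linear[OF r0, of "x0 i j" "pred u i j" 0] r r0 by (simp add: w_mu)
    finally show ?thesis using False by simp
  qed (use r0 mu_deriv_pos in \<open>simp add: V_def w_mu less_imp_le\<close>)
  have row_eq: "(\<Sum>j\<in>{..<n} - {i}. V i j * pred u i j) = g i" if "i < n" for i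
    using eq[of i] incidence_row[OF that, where z = z and f = "\<lambda>e. V (fst e) (snd e) * pred u (fst e) (snd e)"] that n by simp
  have col_eq: "(\<Sum>i\<in>{..<n} - {j}. V i j * pred u i j) = g (n + j)" if "j < n - 1" for j
    using eq[of "n + j"] incidence_col[OF that, where z = z and f = "\<lambda>e. V (fst e) (snd e) * pred u (fst e) (snd e)"] that n by simp
  have row: "\<bar>\<Sum>j\<in>{..<n} - {i}. V i j * pred u i j\<bar> \<le> X" if "i < n" for i
    using row_eq[OF that] g[of i] that n by simp
  have col: "\<bar>\<Sum>i\<in>{..<n} - {j}. V i j * pred u i j\<bar> \<le> X" if "j < n - 1" for j
    using col_eq[OF that] g[of "n + j"] that n by simp
  have last: "\<bar>\<Sum>i\<in>{..<n} - {n - 1}. V i (n - 1) * pred u i (n - 1)\<bar> \<le> X"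
    using last_column_sum[of n "\<lambda>i j. V i j * pred u i j"] n g_last by (simp add: row_eq col_eq)
  \<comment> \<open>Subtracting the node equations with coefficients \<open>L s\<close> from the
    covariate equation replaces the covariate by its residual; \<open>sum_mult_effect\<close>
    rewrites the subtracted part as row and column sums.\<close>
  have score: "\<bar>\<Sum>(i, j)\<in>node_pairs n. V i j * pred u i j * \<zeta> s i j\<bar> \<le> B" if s: "s < p" for s
  proof -
    have "(\<Sum>(i, j)\<in>node_pairs n. V i j * pred u i j * \<zeta> s i j)
        = (\<Sum>(i, j)\<in>node_pairs n. V i j * pred u i j * z i j s)
          - (\<Sum>(i, j)\<in>node_pairs n. V i j * pred u i j * effect n (L s) i j)"
      by (simp add: \<zeta>_def right_diff_distrib case_prod_beta sum_subtractf)
    also have "(\<Sum>(i, j)\<in>node_pairs n. V i j * pred u i j * z i j s) = g (2 * n - 1 + s)"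
      using eq[of "2 * n - 1 + s"] s by (simp add: incidence_cov[OF n, symmetric] case_prod_beta mult.commute)
    also have "(\<Sum>(i, j)\<in>node_pairs n. V i j * pred u i j * effect n (L s) i j)
        = (\<Sum>i<n. L s i * g i) + (\<Sum>j<n - 1. L s (n + j) * g (n + j))"
      unfolding sum_mult_effect using row_eq col_eq by simp
    finally show ?thesis using g_score[OF s] by simp
  qed
  note bounds = combine_estimates[where X = X and B = B and V = V and u = u,
      folded A_def P_def, folded r_def, OF X B r \<eta> \<Lambda>B V_le V row col last score]
  have "(\<Sum>(i, j)\<in>node_pairs n. incidence n z k (i, j) * (mu (x0 i j + pred u i j) - mu (x0 i j))) = g k"
    if k: "k < 2 * n - 1 + p" for k
  proof -
    have "(\<Sum>(i, j)\<in>node_pairs n. incidence n z k (i, j) * (mu (x0 i j + pred u i j) - mu (x0 i j)))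
        = (\<Sum>e\<in>node_pairs n. incidence n z k e * (V (fst e) (snd e) * pred u (fst e) (snd e)))"
      using bounds(1) by (intro sum.cong) (auto simp: V_pred clipped_eq node_pairs_def)
    then show ?thesis using eq[OF k] by simp
  qed
  then show ?thesis using bounds(2,3) by blast
qed

end

section \<open>The matrix H\<close>

abbreviation cov :: "(nat \<Rightarrow> nat \<Rightarrow> real vec) \<Rightarrow> nat \<Rightarrow> nat \<Rightarrow> nat \<Rightarrow> real" where
  "cov Z i j t \<equiv> Z i j $ t"

lemma lin_pred_effect: "lin_pred n Z \<theta> \<gamma> i j = Z i j \<bullet> \<gamma> + effect n (($) \<theta>) i j"
  by (simp add: lin_pred_def out_par_def in_par_def effect_def)

lemma lin_pred_update_node:
  assumes n: "2 \<le> n" and \<theta>: "\<theta> \<in> carrier_vec (2 * n - 1)" and k: "k < 2 * n - 1"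
    and ij: "i < n" "j < n"
  shows "lin_pred n Z (\<theta> |\<^sub>v k \<mapsto> t) \<gamma> i j
    = lin_pred n Z \<theta> \<gamma> i j + incidence n (cov Z) k (i, j) * (t - \<theta> $ k)"
proof (cases "k < n")
  case True
  then show ?thesis using \<theta> ij k n by (auto simp: lin_pred_effect effect_def incidence_def)
next
  case False
  then have "n + j = k \<longleftrightarrow> j = k - n" by auto
  then show ?thesis using False \<theta> ij k n by (auto simp: lin_pred_effect effect_def incidence_def)
qed

lemma lin_pred_update_cov:
  assumes Z: "Z i j \<in> carrier_vec p" and \<gamma>: "\<gamma> \<in> carrier_vec p" and s: "s < p"
  shows "lin_pred n Z \<theta> (\<gamma> |\<^sub>v s \<mapsto> t) i j = lin_pred n Z \<theta> \<gamma> i j + Z i j $ s * (t - \<gamma> $ s)"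
proof -
  have "Z i j \<bullet> (\<gamma> |\<^sub>v s \<mapsto> t) = (\<Sum>l<p. Z i j $ l * (if l = s then t else \<gamma> $ l))"
    using \<gamma> by (auto simp: scalar_prod_def lessThan_atLeast0 intro!: sum.cong)
  also have "\<dots> = (\<Sum>l<p. Z i j $ l * \<gamma> $ l + (if l = s then Z i j $ s * (t - \<gamma> $ s) else 0))"
    by (rule sum.cong) (auto simp: algebra_simps)
  also have "\<dots> = Z i j \<bullet> \<gamma> + Z i j $ s * (t - \<gamma> $ s)"
    using \<gamma> s by (simp add: scalar_prod_def lessThan_atLeast0 sum.distrib)
  finally show ?thesis by (simp add: lin_pred_def)
qed

text \<open>Common form of all entries of \<open>F_map\<close> and \<open>Q_map\<close> along a
  coordinate line, the predictors being affine in the moving coordinate. The entries of the four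
  Jacobians are instances.\<close>

lemma deriv_sum_mu:
  assumes f: "\<And>t. f t = c - (\<Sum>e\<in>E. a e * mu (x e + b e * (t - t0)))"
  shows "deriv f t0 = - (\<Sum>e\<in>E. a e * (mu_deriv (x e) * b e))"
proof (rule DERIV_imp_deriv)
  have "((\<lambda>t. mu (x e + b e * (t - t0))) has_real_derivative mu_deriv (x e) * b e) (at t0)" for e
  proof -
    have "(mu has_real_derivative mu_deriv (x e)) (at (x e + b e * (t0 - t0)))"
      using mu_has_derivative[of "x e"] by simp
    then show ?thesis by (rule DERIV_chain2) (auto intro!: derivative_eq_intros)
  qed
  then have "((\<lambda>t. c - (\<Sum>e\<in>E. a e * mu (x e + b e * (t - t0)))) has_real_derivative
      0 - (\<Sum>e\<in>E. a e * (mu_deriv (x e) * b e))) (at t0)"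
    by (intro DERIV_diff DERIV_const DERIV_sum DERIV_cmult)
  moreover have "f = (\<lambda>t. c - (\<Sum>e\<in>E. a e * mu (x e + b e * (t - t0))))" using f by blast
  ultimately show "(f has_real_derivative - (\<Sum>e\<in>E. a e * (mu_deriv (x e) * b e))) (at t0)" by simp
qed

section \<open>The four Jacobian blocks as weighted sums over pairs\<close>

context
  fixes n p :: nat and Z :: "nat \<Rightarrow> nat \<Rightarrow> real vec" and d b :: "nat \<Rightarrow> real" and y \<theta> \<gamma> :: "real vec"
  assumes n: "2 \<le> n" and Z: "\<And>i j. (i, j) \<in> node_pairs n \<Longrightarrow> Z i j \<in> carrier_vec p"
    and \<theta>: "\<theta> \<in> carrier_vec (2 * n - 1)" and \<gamma>: "\<gamma> \<in> carrier_vec p"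
begin

private abbreviation (input) "x0 e \<equiv> lin_pred n Z \<theta> \<gamma> (fst e) (snd e)"

lemma F_map_incidence:
  assumes k: "k < 2 * n - 1"
  shows "F_map n Z d b x g $ k = (if k < n then d k else b (k - n))
    - (\<Sum>e\<in>node_pairs n. incidence n (cov Z) k e * mu (lin_pred n Z x g (fst e) (snd e)))"
proof (cases "k < n")
  case True
  then show ?thesis using k
    by (simp add: F_map_def out_sum_def mean_edge_def incidence_row)
next
  case False
  then have "k - n < n - 1" "n + (k - n) = k" using k by auto
  then show ?thesis
    using False k incidence_col[of "k - n" n "cov Z" "\<lambda>e. mu (lin_pred n Z x g (fst e) (snd e))"]
    by (simp add: F_map_def in_sum_def mean_edge_def)
qed

lemma Q_map_cov:
  assumes "s < p"
  shows "Q_map n p Z y x g $ s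
    = y $ s - (\<Sum>e\<in>node_pairs n. Z (fst e) (snd e) $ s * mu (lin_pred n Z x g (fst e) (snd e)))"
  using assms by (simp add: Q_map_def cov_sum_def mean_edge_def case_prod_beta)

lemma dim_maps: "dim_vec (F_map n Z d b x g) = 2 * n - 1" "dim_vec (Q_map n p Z y x g) = p"
  by (simp_all add: F_map_def Q_map_def cov_sum_def)

lemma pairD: "e \<in> node_pairs n \<Longrightarrow> fst e < n \<and> snd e < n \<and> Z (fst e) (snd e) \<in> carrier_vec p"
  using Z[of "fst e" "snd e"] by (auto simp: node_pairs_def)

lemma jacobian_F_\<theta>:
  "jacobian (\<lambda>x. F_map n Z d b x \<gamma>) \<theta> = mat (2 * n - 1) (2 * n - 1) (\<lambda>(k, l).
     - (\<Sum>e\<in>node_pairs n. incidence n (cov Z) k e * (mu_deriv (x0 e) * incidence n (cov Z) l e)))"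
    (is "_ = ?M")
proof (rule eq_matI)
  fix k l assume "k < dim_row ?M" "l < dim_col ?M"
  then have kl: "k < 2 * n - 1" "l < 2 * n - 1" by auto
  have "deriv (\<lambda>t. F_map n Z d b (\<theta> |\<^sub>v l \<mapsto> t) \<gamma> $ k) (\<theta> $ l)
      = - (\<Sum>e\<in>node_pairs n. incidence n (cov Z) k e * (mu_deriv (x0 e) * incidence n (cov Z) l e))"
    by (rule deriv_sum_mu[where c = "if k < n then d k else b (k - n)"], subst F_map_incidence[OF kl(1)])
       (use lin_pred_update_node[OF n \<theta> kl(2)] pairD in \<open>auto intro!: sum.cong\<close>)
  then show "jacobian (\<lambda>x. F_map n Z d b x \<gamma>) \<theta> $$ (k, l) = ?M $$ (k, l)"
    using kl \<theta> by (simp add: jacobian_def dim_maps)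
qed (use \<theta> in \<open>simp_all add: jacobian_def dim_maps\<close>)

lemma jacobian_F_\<gamma>:
  "jacobian (\<lambda>g. F_map n Z d b \<theta> g) \<gamma> = mat (2 * n - 1) p (\<lambda>(k, t).
     - (\<Sum>e\<in>node_pairs n. incidence n (cov Z) k e * (mu_deriv (x0 e) * Z (fst e) (snd e) $ t)))"
    (is "_ = ?M")
proof (rule eq_matI)
  fix k t assume "k < dim_row ?M" "t < dim_col ?M"
  then have kt: "k < 2 * n - 1" "t < p" by auto
  have "deriv (\<lambda>s. F_map n Z d b \<theta> (\<gamma> |\<^sub>v t \<mapsto> s) $ k) (\<gamma> $ t)
      = - (\<Sum>e\<in>node_pairs n. incidence n (cov Z) k e * (mu_deriv (x0 e) * Z (fst e) (snd e) $ t))"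
    by (rule deriv_sum_mu[where c = "if k < n then d k else b (k - n)"], subst F_map_incidence[OF kt(1)])
       (use lin_pred_update_cov[OF _ \<gamma> kt(2)] pairD in \<open>auto intro!: sum.cong\<close>)
  then show "jacobian (\<lambda>g. F_map n Z d b \<theta> g) \<gamma> $$ (k, t) = ?M $$ (k, t)"
    using kt \<gamma> by (simp add: jacobian_def dim_maps)
qed (use \<gamma> in \<open>simp_all add: jacobian_def dim_maps\<close>)

lemma jacobian_Q_\<theta>:
  "jacobian (\<lambda>x. Q_map n p Z y x \<gamma>) \<theta> = mat p (2 * n - 1) (\<lambda>(s, l).
     - (\<Sum>e\<in>node_pairs n. Z (fst e) (snd e) $ s * (mu_deriv (x0 e) * incidence n (cov Z) l e)))"
    (is "_ = ?M")
proof (rule eq_matI)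
  fix s l assume "s < dim_row ?M" "l < dim_col ?M"
  then have sl: "s < p" "l < 2 * n - 1" by auto
  have "deriv (\<lambda>t. Q_map n p Z y (\<theta> |\<^sub>v l \<mapsto> t) \<gamma> $ s) (\<theta> $ l)
      = - (\<Sum>e\<in>node_pairs n. Z (fst e) (snd e) $ s * (mu_deriv (x0 e) * incidence n (cov Z) l e))"
    by (rule deriv_sum_mu[where c = "y $ s"], subst Q_map_cov[OF sl(1)])
       (use lin_pred_update_node[OF n \<theta> sl(2)] pairD in \<open>auto intro!: sum.cong\<close>)
  then show "jacobian (\<lambda>x. Q_map n p Z y x \<gamma>) \<theta> $$ (s, l) = ?M $$ (s, l)"
    using sl \<theta> by (simp add: jacobian_def dim_maps)
qed (use \<theta> in \<open>simp_all add: jacobian_def dim_maps\<close>)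

lemma jacobian_Q_\<gamma>:
  "jacobian (\<lambda>g. Q_map n p Z y \<theta> g) \<gamma> = mat p p (\<lambda>(s, t).
     - (\<Sum>e\<in>node_pairs n. Z (fst e) (snd e) $ s * (mu_deriv (x0 e) * Z (fst e) (snd e) $ t)))"
    (is "_ = ?M")
proof (rule eq_matI)
  fix s t assume "s < dim_row ?M" "t < dim_col ?M"
  then have st: "s < p" "t < p" by auto
  have "deriv (\<lambda>r. Q_map n p Z y \<theta> (\<gamma> |\<^sub>v t \<mapsto> r) $ s) (\<gamma> $ t)
      = - (\<Sum>e\<in>node_pairs n. Z (fst e) (snd e) $ s * (mu_deriv (x0 e) * Z (fst e) (snd e) $ t))"
    by (rule deriv_sum_mu[where c = "y $ s"], subst Q_map_cov[OF st(1)])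
       (use lin_pred_update_cov[OF _ \<gamma> st(2)] pairD in \<open>auto intro!: sum.cong\<close>)
  then show "jacobian (\<lambda>g. Q_map n p Z y \<theta> g) \<gamma> $$ (s, t) = ?M $$ (s, t)"
    using st \<gamma> by (simp add: jacobian_def dim_maps)
qed (use \<gamma> in \<open>simp_all add: jacobian_def dim_maps\<close>)

end

lemma mat_norm_inf_bound:
  assumes A: "A \<in> carrier_mat N N'" and v: "v \<in> carrier_vec N'" and i: "i < N"
    and B: "\<And>j. j < N' \<Longrightarrow> \<bar>v $ j\<bar> \<le> B" and B0: "0 \<le> B"
  shows "\<bar>(A *\<^sub>v v) $ i\<bar> \<le> mat_norm_inf A * B"
proof -
  have "\<bar>(A *\<^sub>v v) $ i\<bar> = \<bar>\<Sum>j<N'. A $$ (i, j) * v $ j\<bar>"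
    using A v i by (auto simp: scalar_prod_def lessThan_atLeast0 intro!: arg_cong[where f = abs] sum.cong)
  also have "\<dots> \<le> (\<Sum>j<N'. \<bar>A $$ (i, j)\<bar> * B)"
    using B by (intro order_trans[OF sum_abs] sum_mono) (auto simp: abs_mult intro!: mult_left_mono)
  also have "\<dots> = (\<Sum>j<dim_col A. \<bar>A $$ (i, j)\<bar>) * B" using A by (simp add: sum_distrib_right)
  also have "\<dots> \<le> mat_norm_inf A * B"
    unfolding mat_norm_inf_def using A i B0 by (intro mult_right_mono Max_ge) auto
  finally show ?thesis .
qed

text \<open>Up to sign, the \<theta>-Jacobian of \<open>F_map\<close> is the Gram matrix of the node
  effects, and its \<gamma>-Jacobian consists of their products with the covariates. The signs
  cancel in \<open>K\<close>, whose columns are therefore the projection coefficients, and the Schur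
  complement H pairs covariates with projection residuals.\<close>

lemma two_way_design_H_mat:
  assumes n: "2 \<le> n" and Z: "\<And>i j. (i, j) \<in> node_pairs n \<Longrightarrow> Z i j \<in> carrier_vec p"
    and \<theta>: "\<theta> \<in> carrier_vec (2 * n - 1)" and \<gamma>: "\<gamma> \<in> carrier_vec p"
    and m: "0 < m" and q: "0 \<le> q" and \<Lambda>: "0 \<le> \<Lambda>"
    and large: "1 \<le> 2 * m\<^sup>2 * real (n - 1)"
    and Z_le: "\<And>i j t. i < n \<Longrightarrow> j < n \<Longrightarrow> i \<noteq> j \<Longrightarrow> t < p \<Longrightarrow> \<bar>Z i j $ t\<bar> \<le> q"
    and w: "\<And>i j. i < n \<Longrightarrow> j < n \<Longrightarrow> i \<noteq> j \<Longrightarrow> m \<le> mu_deriv (lin_pred n Z \<theta> \<gamma> i j)"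
    and H: "positive_definite (H_mat n p Z d b y \<theta> \<gamma>)"
    and H_inv: "mat_norm_inf (inv_mat (H_mat n p Z d b y \<theta> \<gamma>)) \<le> \<Lambda>"
  shows "\<exists>L. two_way_design n p (cov Z) q m \<Lambda> (\<lambda>i j. mu_deriv (lin_pred n Z \<theta> \<gamma> i j)) L"
proof -
  let ?P = "node_pairs n"
  define N where "N = 2 * n - 1"
  define W where "W e = mu_deriv (lin_pred n Z \<theta> \<gamma> (fst e) (snd e))" for e
  define I where "I k e = incidence n (cov Z) k e" for k e
  define z where "z t e = Z (fst e) (snd e) $ t" for t e
  define J where "J = jacobian (\<lambda>x. F_map n Z d b x \<gamma>) \<theta>"
  define K where "K = inv_mat J * jacobian (\<lambda>g. F_map n Z d b \<theta> g) \<gamma>"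
  define L where "L t k = K $$ (k, t)" for t k
  have large8: "1 \<le> 8 * m\<^sup>2 * real (n - 1)"
  proof -
    have "2 * m\<^sup>2 * real (n - 1) \<le> 8 * m\<^sup>2 * real (n - 1)" by (intro mult_right_mono) auto
    then show ?thesis using large by linarith
  qed
  have J: "J = mat N N (\<lambda>(k, l). - (\<Sum>e\<in>?P. I k e * (W e * I l e)))"
    unfolding J_def I_def W_def N_def by (rule jacobian_F_\<theta>) (use n Z \<theta> \<gamma> in auto)
  have JF: "jacobian (\<lambda>g. F_map n Z d b \<theta> g) \<gamma> = mat N p (\<lambda>(k, t). - (\<Sum>e\<in>?P. I k e * (W e * z t e)))"
    unfolding I_def W_def N_def z_def by (rule jacobian_F_\<gamma>) (use n Z \<theta> \<gamma> in auto)
  have JQ\<theta>: "jacobian (\<lambda>x. Q_map n p Z y x \<gamma>) \<theta> = mat p N (\<lambda>(s, l). - (\<Sum>e\<in>?P. z s e * (W e * I l e)))"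
    unfolding I_def W_def N_def z_def by (rule jacobian_Q_\<theta>) (use n Z \<theta> \<gamma> in auto)
  have JQ\<gamma>: "jacobian (\<lambda>g. Q_map n p Z y \<theta> g) \<gamma> = mat p p (\<lambda>(s, t). - (\<Sum>e\<in>?P. z s e * (W e * z t e)))"
    unfolding W_def z_def by (rule jacobian_Q_\<gamma>) (use n Z \<theta> \<gamma> in auto)
  have I_sum: "(\<Sum>l<N. I l e * v l) = effect n v (fst e) (snd e)" if "e \<in> ?P" for e and v :: "nat \<Rightarrow> real"
  proof -
    have split: "(\<Sum>l<N. f l) = (\<Sum>i<n. f i) + (\<Sum>j<n - 1. f (n + j))" for f :: "nat \<Rightarrow> real"
      using sum_params[OF n, where p = 0 and f = f] by (simp add: N_def)
    have ij: "fst e < n" "snd e < n" using that by (auto simp: node_pairs_def)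
    have "(\<Sum>i<n. I i e * v i) = (\<Sum>i<n. if i = fst e then v i else 0)"
      by (rule sum.cong) (auto simp: I_def incidence_def case_prod_beta)
    moreover have "(\<Sum>j<n - 1. I (n + j) e * v (n + j)) = (\<Sum>j<n - 1. if j = snd e then v (n + j) else 0)"
      by (rule sum.cong) (auto simp: I_def incidence_def case_prod_beta)
    ultimately show ?thesis unfolding split effect_def using ij by simp
  qed
  have gram: "(\<Sum>l<N. (\<Sum>e\<in>?P. f e * (W e * I l e)) * v l)
      = (\<Sum>e\<in>?P. f e * (W e * effect n v (fst e) (snd e)))" for f and v :: "nat \<Rightarrow> real"
  proof -
    have "(\<Sum>l<N. (\<Sum>e\<in>?P. f e * (W e * I l e)) * v l) = (\<Sum>e\<in>?P. f e * (W e * (\<Sum>l<N. I l e * v l)))"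
      by (simp add: sum_distrib_left sum_distrib_right ac_simps) (rule sum.swap)
    then show ?thesis using I_sum by simp
  qed
  have J_carrier: "J \<in> carrier_mat N N" by (simp add: J)
  have w4: "m \<le> mu_deriv (lin_pred n Z \<theta> \<gamma> i j) \<and> mu_deriv (lin_pred n Z \<theta> \<gamma> i j) \<le> 1 / 4"
    if "i < n" "j < n" "i \<noteq> j" for i j
    using w[OF that] mu_deriv_le by blast
  \<comment> \<open>Invertibility of \<open>J\<close> is the maximum principle with right-hand side
    0.\<close>
  have J_kernel: "v = 0\<^sub>v N" if v: "v \<in> carrier_vec N" "J *\<^sub>v v = 0\<^sub>v N" for v
  proof -
    have zero: "(\<Sum>e\<in>?P. I k e * (W e * effect n (($) v) (fst e) (snd e))) = 0" if k: "k < N" for k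
    proof -
      have "(J *\<^sub>v v) $ k = (\<Sum>l<N. - (\<Sum>e\<in>?P. I k e * (W e * I l e)) * v $ l)"
        using k v(1) by (auto simp: J scalar_prod_def lessThan_atLeast0 intro!: sum.cong)
      also have "\<dots> = - (\<Sum>e\<in>?P. I k e * (W e * effect n (($) v) (fst e) (snd e)))"
        using gram[of "I k" "($) v"] by (simp add: sum_negf)
      finally show ?thesis using v(2) k by simp
    qed
    have row: "(\<Sum>j\<in>{..<n} - {i}. mu_deriv (lin_pred n Z \<theta> \<gamma> i j) * effect n (($) v) i j) = 0"
      if "i < n" for i
      using zero[of i] that n incidence_row[OF that, of "cov Z" "\<lambda>e. W e * effect n (($) v) (fst e) (snd e)"]
      by (simp add: I_def W_def N_def)
    have col: "(\<Sum>i\<in>{..<n} - {j}. mu_deriv (lin_pred n Z \<theta> \<gamma> i j) * effect n (($) v) i j) = 0"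
      if "j < n - 1" for j
      using zero[of "n + j"] that n incidence_col[OF that, of "cov Z" "\<lambda>e. W e * effect n (($) v) (fst e) (snd e)"]
      by (simp add: I_def W_def N_def)
    have "\<bar>v $ k\<bar> \<le> 0 / (m ^ 3 * real (n - 1))" if "k < N" for k
    proof (rule two_way_bound[OF n m _ large8 w4])
      show "\<bar>\<Sum>i\<in>{..<n} - {n - 1}. mu_deriv (lin_pred n Z \<theta> \<gamma> i (n - 1)) * effect n (($) v) i (n - 1)\<bar> \<le> 0"
        using last_column_sum[of n "\<lambda>i j. mu_deriv (lin_pred n Z \<theta> \<gamma> i j) * effect n (($) v) i j"] n row col
        by simp
    qed (use row col that in \<open>simp_all add: N_def\<close>)
    then show ?thesis using v(1) by (intro eq_vecI) auto
  qed
  note J_inv = inv_mat_trivial_kernel[OF J_carrier J_kernel]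
  have K_carrier: "K \<in> carrier_mat N p" unfolding K_def JF using J_inv(1) by auto
  have "J * K = jacobian (\<lambda>g. F_map n Z d b \<theta> g) \<gamma>"
    unfolding K_def using J_inv J_carrier JF
    by (subst assoc_mult_mat[symmetric, of _ N N _ N _ p]) auto
  then have JK: "(J * K) $$ (k, t) = - (\<Sum>e\<in>?P. I k e * (W e * z t e))" if "k < N" "t < p" for k t
    using that by (simp add: JF)
  have orth: "(\<Sum>e\<in>?P. I k e * (W e * (z t e - effect n (L t) (fst e) (snd e)))) = 0"
    if k: "k < N" and t: "t < p" for k t
  proof -
    have "(J * K) $$ (k, t) = (\<Sum>l<N. - (\<Sum>e\<in>?P. I k e * (W e * I l e)) * L t l)"
      using k t K_carrier by (auto simp: J L_def scalar_prod_def lessThan_atLeast0 intro!: sum.cong)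
    also have "\<dots> = - (\<Sum>e\<in>?P. I k e * (W e * effect n (L t) (fst e) (snd e)))"
      using gram[of "I k" "L t"] by (simp add: sum_negf)
    finally show ?thesis using JK[OF k t] by (simp add: right_diff_distrib sum_subtractf)
  qed
  define HM where "HM = H_mat n p Z d b y \<theta> \<gamma>"
  have HM_eq: "HM = - (mat p p (\<lambda>(s, t). - (\<Sum>e\<in>?P. z s e * (W e * z t e)))
      - mat p N (\<lambda>(s, l). - (\<Sum>e\<in>?P. z s e * (W e * I l e))) * K)"
    unfolding HM_def H_mat_def K_def JQ\<theta> JQ\<gamma> J_def[symmetric] using J_inv(1) JF
    by (subst assoc_mult_mat[of _ p N _ N _ p]) auto
  have HM_carrier: "HM \<in> carrier_mat p p" unfolding HM_eq using K_carrier by auto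
  have HM_entry: "HM $$ (s, t) = (\<Sum>e\<in>?P. W e * (z t e - effect n (L t) (fst e) (snd e)) * z s e)"
    if s: "s < p" and t: "t < p" for s t
  proof -
    have "(mat p N (\<lambda>(s, l). - (\<Sum>e\<in>?P. z s e * (W e * I l e))) * K) $$ (s, t)
        = (\<Sum>l<N. - (\<Sum>e\<in>?P. z s e * (W e * I l e)) * L t l)"
      using s t K_carrier by (auto simp: L_def scalar_prod_def lessThan_atLeast0 intro!: sum.cong)
    also have "\<dots> = - (\<Sum>e\<in>?P. z s e * (W e * effect n (L t) (fst e) (snd e)))"
      using gram[of "z s" "L t"] by (simp add: sum_negf)
    finally show ?thesis
      using s t K_carrier by (simp add: HM_eq algebra_simps sum_subtractf)
  qed
  \<comment> \<open>In \<open>HM_entry\<close> the residual belongs to the column index, in the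
    locale to the row index. The symmetry contained in positive definiteness exchanges them.\<close>
  have HM_sym: "HM $$ (s, t) = HM $$ (t, s)" if "s < p" "t < p" for s t
    using H that HM_carrier unfolding positive_definite_def HM_def[symmetric]
    by (metis carrier_matD index_transpose_mat(1))
  have HM_mult: "(HM *\<^sub>v v) $ s
      = (\<Sum>e\<in>?P. W e * (z s e - effect n (L s) (fst e) (snd e)) * (\<Sum>t<p. z t e * v $ t))"
    if s: "s < p" and v: "v \<in> carrier_vec p" for s v
  proof -
    have "(HM *\<^sub>v v) $ s = (\<Sum>t<p. HM $$ (t, s) * v $ t)"
      using s v HM_carrier HM_sym by (auto simp: scalar_prod_def lessThan_atLeast0 intro!: sum.cong)
    also have "\<dots> = (\<Sum>t<p. (\<Sum>e\<in>?P. W e * (z s e - effect n (L s) (fst e) (snd e)) * z t e) * v $ t)"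
      using s HM_entry by simp
    also have "\<dots> = (\<Sum>e\<in>?P. W e * (z s e - effect n (L s) (fst e) (snd e)) * (\<Sum>t<p. z t e * v $ t))"
      by (simp only: sum_distrib_left sum_distrib_right mult.assoc) (rule sum.swap)
    finally show ?thesis .
  qed
  have HM_kernel: "v = 0\<^sub>v p" if "v \<in> carrier_vec p" "HM *\<^sub>v v = 0\<^sub>v p" for v
    using H that HM_carrier unfolding positive_definite_def HM_def[symmetric] by fastforce
  note HM_inv = inv_mat_trivial_kernel[OF HM_carrier HM_kernel]
  have "two_way_design n p (cov Z) q m \<Lambda> (\<lambda>i j. mu_deriv (lin_pred n Z \<theta> \<gamma> i j)) L"
  proof
    fix t i assume t: "t < p" and i: "i < n"
    show "(\<Sum>j\<in>{..<n} - {i}. mu_deriv (lin_pred n Z \<theta> \<gamma> i j) * (Z i j $ t - effect n (L t) i j)) = 0"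
      using orth[of i t] t i n incidence_row[OF i, of "cov Z" "\<lambda>e. W e * (z t e - effect n (L t) (fst e) (snd e))"]
      by (simp add: I_def W_def z_def N_def)
  next
    fix t j assume t: "t < p" and j: "j < n - 1"
    show "(\<Sum>i\<in>{..<n} - {j}. mu_deriv (lin_pred n Z \<theta> \<gamma> i j) * (Z i j $ t - effect n (L t) i j)) = 0"
      using orth[of "n + j" t] t j n incidence_col[OF j, of "cov Z" "\<lambda>e. W e * (z t e - effect n (L t) (fst e) (snd e))"]
      by (simp add: I_def W_def z_def N_def)
  next
    fix \<delta> :: "nat \<Rightarrow> real" and B :: real and t :: nat
    assume t: "t < p" and B: "\<And>s. s < p \<Longrightarrow> \<bar>\<Sum>(i, j)\<in>?P. mu_deriv (lin_pred n Z \<theta> \<gamma> i j)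
        * (Z i j $ s - effect n (L s) i j) * (\<Sum>t<p. Z i j $ t * \<delta> t)\<bar> \<le> B"
    define v where "v = vec p \<delta>"
    have v: "v \<in> carrier_vec p" by (simp add: v_def)
    have "\<bar>(HM *\<^sub>v v) $ s\<bar> \<le> B" if "s < p" for s
      unfolding HM_mult[OF that v] using B[OF that] by (simp add: W_def z_def v_def case_prod_beta)
    moreover have "0 \<le> B" using B[OF t] by (rule order_trans[rotated]) simp
    \<comment> \<open>\<open>\<delta>\<close> is recovered by applying the inverse of H to the
      product of H and \<open>\<delta>\<close>; the maximal row sum is the operator norm for the sup
      norm.\<close>
    ultimately have "\<bar>(inv_mat HM *\<^sub>v (HM *\<^sub>v v)) $ t\<bar> \<le> mat_norm_inf (inv_mat HM) * B"
      using HM_carrier v t by (intro mat_norm_inf_bound[OF HM_inv(1)]) auto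
    also have "inv_mat HM *\<^sub>v (HM *\<^sub>v v) = v"
      using HM_inv HM_carrier v by (subst assoc_mult_mat_vec[symmetric]) auto
    also have "mat_norm_inf (inv_mat HM) * B \<le> \<Lambda> * B"
      using H_inv \<open>0 \<le> B\<close> unfolding HM_def by (rule mult_right_mono)
    finally show "\<bar>\<delta> t\<bar> \<le> \<Lambda> * B" using t by (simp add: v_def)
  qed (use assms w4 in auto)
  then show ?thesis by blast
qed

section \<open>Noisy networks\<close>

context prob_space
begin

text \<open>Induction on the index set: the new variable is centered and independent of the partial
  sum, so the mixed term has expectation 0.\<close>

lemma expectation_square_indep_sum:
  fixes Y :: "'s \<Rightarrow> 'a \<Rightarrow> real"
  assumes "finite I" "indep_vars (\<lambda>_. borel) Y I"
    and "\<And>s. s \<in> I \<Longrightarrow> integrable M (Y s)" "\<And>s. s \<in> I \<Longrightarrow> integrable M (\<lambda>\<omega>. (Y s \<omega>)\<^sup>2)"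
    and "\<And>s. s \<in> I \<Longrightarrow> expectation (Y s) = 0"
  shows "integrable M (\<lambda>\<omega>. (\<Sum>s\<in>I. Y s \<omega>)\<^sup>2) \<and>
    expectation (\<lambda>\<omega>. (\<Sum>s\<in>I. Y s \<omega>)\<^sup>2) = (\<Sum>s\<in>I. expectation (\<lambda>\<omega>. (Y s \<omega>)\<^sup>2))"
  using assms
proof (induction I rule: finite_induct)
  case (insert i I)
  define S where "S \<omega> = (\<Sum>s\<in>I. Y s \<omega>)" for \<omega>
  have IH: "integrable M (\<lambda>\<omega>. (S \<omega>)\<^sup>2)"
    "expectation (\<lambda>\<omega>. (S \<omega>)\<^sup>2) = (\<Sum>s\<in>I. expectation (\<lambda>\<omega>. (Y s \<omega>)\<^sup>2))"
    using insert.IH insert.prems indep_vars_subset[OF insert.prems(1), of I] by (auto simp: S_def)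
  have indep: "indep_var borel (Y i) borel S"
    unfolding S_def using indep_vars_sum[OF insert.hyps(1,2) insert.prems(1)] .
  have iS: "integrable M S" using insert.prems unfolding S_def by (intro Bochner_Integration.integrable_sum) auto
  have iY: "integrable M (Y i)" "integrable M (\<lambda>\<omega>. (Y i \<omega>)\<^sup>2)" "expectation (Y i) = 0"
    using insert.prems by auto
  have iYS: "integrable M (\<lambda>\<omega>. Y i \<omega> * S \<omega>)" by (rule indep_var_integrable[OF indep iY(1) iS])
  have eYS: "expectation (\<lambda>\<omega>. Y i \<omega> * S \<omega>) = 0"
    by (subst indep_var_lebesgue_integral[OF indep iY(1) iS]) (simp add: iY)
  have eq: "(\<lambda>\<omega>. (\<Sum>s\<in>insert i I. Y s \<omega>)\<^sup>2) = (\<lambda>\<omega>. (Y i \<omega>)\<^sup>2 + 2 * (Y i \<omega> * S \<omega>) + (S \<omega>)\<^sup>2)"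
    using insert.hyps by (auto simp: S_def power2_eq_square algebra_simps)
  have "expectation (\<lambda>\<omega>. (Y i \<omega>)\<^sup>2 + 2 * (Y i \<omega> * S \<omega>) + (S \<omega>)\<^sup>2)
      = expectation (\<lambda>\<omega>. (Y i \<omega>)\<^sup>2) + 2 * expectation (\<lambda>\<omega>. Y i \<omega> * S \<omega>) + expectation (\<lambda>\<omega>. (S \<omega>)\<^sup>2)"
    using iY iYS IH by simp
  then show ?case unfolding eq using iY iYS IH eYS insert.hyps by simp
qed simp

lemma indep_sum_tail:
  fixes U :: "'s \<Rightarrow> 'a \<Rightarrow> real" and c v :: "'s \<Rightarrow> real"
  assumes fin: "finite I" and indep: "indep_vars (\<lambda>_. borel) U I"
    and int: "\<And>s. s \<in> I \<Longrightarrow> integrable M (\<lambda>\<omega>. (U s \<omega>)\<^sup>2)"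
    and mean: "\<And>s. s \<in> I \<Longrightarrow> expectation (U s) = 0"
    and var: "\<And>s. s \<in> I \<Longrightarrow> expectation (\<lambda>\<omega>. (U s \<omega>)\<^sup>2) \<le> v s"
    and K: "0 < K"
  shows "prob {\<omega>\<in>space M. K \<le> \<bar>\<Sum>s\<in>I. c s * U s \<omega>\<bar>} \<le> (\<Sum>s\<in>I. (c s)\<^sup>2 * v s) / K\<^sup>2"
proof -
  have rv: "random_variable borel (U s)" if "s \<in> I" for s
    using indep that by (auto simp: indep_vars_def)
  have iU: "integrable M (U s)" if "s \<in> I" for s
    using rv[OF that] int[OF that] by (rule square_integrable_imp_integrable)
  have "indep_vars (\<lambda>_. borel) (\<lambda>s \<omega>. c s * U s \<omega>) I"
    by (rule indep_vars_compose2[OF indep]) auto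
  then have *: "integrable M (\<lambda>\<omega>. (\<Sum>s\<in>I. c s * U s \<omega>)\<^sup>2)"
    "expectation (\<lambda>\<omega>. (\<Sum>s\<in>I. c s * U s \<omega>)\<^sup>2) = (\<Sum>s\<in>I. expectation (\<lambda>\<omega>. (c s * U s \<omega>)\<^sup>2))"
    using expectation_square_indep_sum[OF fin, of "\<lambda>s \<omega>. c s * U s \<omega>"] iU int mean
    by (auto simp: power_mult_distrib)
  have mean0: "expectation (\<lambda>\<omega>. \<Sum>s\<in>I. c s * U s \<omega>) = 0"
    using iU mean by (subst Bochner_Integration.integral_sum) auto
  have "prob {\<omega>\<in>space M. K \<le> \<bar>(\<Sum>s\<in>I. c s * U s \<omega>) - expectation (\<lambda>\<omega>. \<Sum>s\<in>I. c s * U s \<omega>)\<bar>}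
      \<le> variance (\<lambda>\<omega>. \<Sum>s\<in>I. c s * U s \<omega>) / K\<^sup>2"
    using rv *(1) K by (intro Chebyshev_inequality) auto
  also have "variance (\<lambda>\<omega>. \<Sum>s\<in>I. c s * U s \<omega>) = (\<Sum>s\<in>I. (c s)\<^sup>2 * expectation (\<lambda>\<omega>. (U s \<omega>)\<^sup>2))"
    using *(2) mean0 by (simp add: power_mult_distrib)
  also have "\<dots> / K\<^sup>2 \<le> (\<Sum>s\<in>I. (c s)\<^sup>2 * v s) / K\<^sup>2"
    using var by (intro divide_right_mono sum_mono mult_left_mono) auto
  finally show ?thesis by (simp add: mean0)
qed

text \<open>The sources are given as real variables; since the integers are countable, preimages of
  single points suffice to make the integer variable measurable.\<close>

lemma discrete_laplace_measurable:
  assumes "random_variable borel (\<lambda>\<omega>. real_of_int (X \<omega>))"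
  shows "random_variable (count_space UNIV) X"
proof (rule measurable_count_space_eq2_countable[THEN iffD2])
  show "X \<in> space M \<rightarrow> UNIV \<and> (\<forall>a\<in>UNIV. X -` {a} \<inter> space M \<in> events)"
  proof (intro conjI ballI)
    fix x
    have "(\<lambda>\<omega>. real_of_int (X \<omega>)) -` {real_of_int x} \<inter> space M \<in> events"
      using assms by (rule measurable_sets) simp
    also have "(\<lambda>\<omega>. real_of_int (X \<omega>)) -` {real_of_int x} \<inter> space M = X -` {x} \<inter> space M" by auto
    finally show "X -` {x} \<inter> space M \<in> events" .
  qed simp
qed

text \<open>With \<beta> the square root of the parameter exp(-\<epsilon> / 2), the mass at distance
  k carries \<beta>^k twice. One factor absorbs k^2, their product being at most 32 / \<epsilon>^2,
  and the other is summed as a geometric series. The resulting 128 is twice 8^2, which fits under 2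
  (1 + 8 / \<epsilon>)^2.\<close>

lemma discrete_laplace_second_moment:
  assumes X: "discrete_laplace M (exp (- \<epsilon> / 2)) X" and \<epsilon>: "0 < \<epsilon>"
    and rv: "random_variable borel (\<lambda>\<omega>. real_of_int (X \<omega>))"
  shows "integrable M (\<lambda>\<omega>. (real_of_int (X \<omega>))\<^sup>2)"
    and "expectation (\<lambda>\<omega>. (real_of_int (X \<omega>))\<^sup>2) \<le> 128 / \<epsilon>\<^sup>2"
proof -
  define \<beta> where "\<beta> = exp (- \<epsilon> / 4)"
  have \<beta>: "0 < \<beta>" "\<beta> < 1" "exp (- \<epsilon> / 2) = \<beta>\<^sup>2"
    using \<epsilon> by (auto simp: \<beta>_def power2_eq_square simp flip: exp_add)
  note [measurable] = discrete_laplace_measurable[OF rv]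
  define Y where "Y \<omega> = nat \<bar>X \<omega>\<bar>" for \<omega>
  have Ym [measurable]: "random_variable (count_space UNIV) Y" unfolding Y_def by measurable
  have Y_set [measurable]: "Y -` {k} \<inter> space M \<in> events" for k
    using measurable_sets[OF Ym, of "{k}"] by simp
  \<comment> \<open>The factor 2 stands for the two signs, with the point 0 counted twice; the
    denominator 1 + \<beta>^2 is estimated by 1.\<close>
  have Y_prob: "prob (Y -` {k} \<inter> space M) \<le> 2 * (1 - \<beta>\<^sup>2) * (\<beta> ^ k)\<^sup>2" for k
  proof -
    have eq: "prob {\<omega>\<in>space M. X \<omega> = x} \<le> (1 - \<beta>\<^sup>2) * (\<beta> ^ k)\<^sup>2" if "nat \<bar>x\<bar> = k" for x
    proof -
      have "prob {\<omega>\<in>space M. X \<omega> = x} = (1 - \<beta>\<^sup>2) * (\<beta> ^ k)\<^sup>2 / (1 + \<beta>\<^sup>2)"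
        using X that \<beta>(3) by (simp add: discrete_laplace_def power_mult[symmetric] mult.commute)
      also have "\<dots> \<le> (1 - \<beta>\<^sup>2) * (\<beta> ^ k)\<^sup>2"
      proof -
        have "0 \<le> (1 - \<beta>\<^sup>2) * (\<beta> ^ k)\<^sup>2" using \<beta> by (simp add: power_le_one)
        then have "(1 - \<beta>\<^sup>2) * (\<beta> ^ k)\<^sup>2 / (1 + \<beta>\<^sup>2) \<le> (1 - \<beta>\<^sup>2) * (\<beta> ^ k)\<^sup>2 / 1"
          by (intro divide_left_mono) (auto simp: add_pos_nonneg)
        then show ?thesis by simp
      qed
      finally show ?thesis .
    qed
    have "prob (Y -` {k} \<inter> space M) \<le> prob ({\<omega>\<in>space M. X \<omega> = int k} \<union> {\<omega>\<in>space M. X \<omega> = - int k})"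
      by (intro finite_measure_mono) (auto simp: Y_def)
    also have "\<dots> \<le> prob {\<omega>\<in>space M. X \<omega> = int k} + prob {\<omega>\<in>space M. X \<omega> = - int k}"
      by (intro measure_Un_le) auto
    also have "\<dots> \<le> 2 * (1 - \<beta>\<^sup>2) * (\<beta> ^ k)\<^sup>2" using add_mono[OF eq[of "int k"] eq[of "- int k"]] by (simp add: algebra_simps)
    finally show ?thesis .
  qed
  have k_le: "(real k)\<^sup>2 * \<beta> ^ k \<le> 32 / \<epsilon>\<^sup>2" for k
  proof -
    define t where "t = \<epsilon> / 4 * real k"
    have t: "0 \<le> t" using \<epsilon> by (simp add: t_def)
    have "t\<^sup>2 / 2 \<le> exp t" using exp_lower_Taylor_quadratic[OF t] t by linarith
    then have "t\<^sup>2 / 2 * exp (- t) \<le> exp t * exp (- t)" by (intro mult_right_mono) auto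
    then have "t\<^sup>2 * exp (- t) \<le> 2" by (simp flip: exp_add)
    moreover have "\<beta> ^ k = exp (- t)" by (simp add: \<beta>_def t_def mult.commute flip: exp_of_nat_mult)
    ultimately show ?thesis using \<epsilon> by (simp add: t_def power_mult_distrib field_simps)
  qed
  have sq: "ennreal ((real_of_int (X \<omega>))\<^sup>2)
      = (\<Sum>k. ennreal ((real k)\<^sup>2) * indicator (Y -` {k} \<inter> space M) \<omega>)" if "\<omega> \<in> space M" for \<omega>
  proof -
    have "(\<Sum>k. ennreal ((real k)\<^sup>2) * indicator (Y -` {k} \<inter> space M) \<omega>) = ennreal ((real (Y \<omega>))\<^sup>2)"
      using that by (intro suminf_cmult_indicator) (auto simp: disjoint_family_on_def)
    also have "(real (Y \<omega>))\<^sup>2 = (real_of_int (X \<omega>))\<^sup>2" by (simp add: Y_def)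
    finally show ?thesis by simp
  qed
  have "(\<integral>\<^sup>+ \<omega>. ennreal ((real_of_int (X \<omega>))\<^sup>2) \<partial>M)
      = (\<integral>\<^sup>+ \<omega>. (\<Sum>k. ennreal ((real k)\<^sup>2) * indicator (Y -` {k} \<inter> space M) \<omega>) \<partial>M)"
    using sq by (intro nn_integral_cong) auto
  also have "\<dots> = (\<Sum>k. ennreal ((real k)\<^sup>2) * emeasure M (Y -` {k} \<inter> space M))"
    by (subst nn_integral_suminf) (auto simp: nn_integral_cmult_indicator)
  also have "\<dots> \<le> (\<Sum>k. ennreal (64 / \<epsilon>\<^sup>2 * (1 - \<beta>\<^sup>2) * \<beta> ^ k))"
  proof (intro suminf_le)
    fix k
    have "(real k)\<^sup>2 * prob (Y -` {k} \<inter> space M) \<le> (real k)\<^sup>2 * (2 * (1 - \<beta>\<^sup>2) * (\<beta> ^ k)\<^sup>2)"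
      by (intro mult_left_mono Y_prob) simp
    also have "\<dots> = 2 * (1 - \<beta>\<^sup>2) * \<beta> ^ k * ((real k)\<^sup>2 * \<beta> ^ k)" by (simp add: power2_eq_square)
    also have "\<dots> \<le> 2 * (1 - \<beta>\<^sup>2) * \<beta> ^ k * (32 / \<epsilon>\<^sup>2)"
      using \<beta> k_le by (intro mult_left_mono) (auto simp: abs_square_le_1)
    also have "\<dots> = 64 / \<epsilon>\<^sup>2 * (1 - \<beta>\<^sup>2) * \<beta> ^ k" by simp
    finally show "ennreal ((real k)\<^sup>2) * emeasure M (Y -` {k} \<inter> space M)
        \<le> ennreal (64 / \<epsilon>\<^sup>2 * (1 - \<beta>\<^sup>2) * \<beta> ^ k)"
      by (simp add: emeasure_eq_measure ennreal_leI flip: ennreal_mult)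
  qed auto
  also have "\<dots> = ennreal (64 / \<epsilon>\<^sup>2 * (1 - \<beta>\<^sup>2) * (1 / (1 - \<beta>)))"
  proof -
    have s: "(\<lambda>k. 64 / \<epsilon>\<^sup>2 * (1 - \<beta>\<^sup>2) * \<beta> ^ k) sums (64 / \<epsilon>\<^sup>2 * (1 - \<beta>\<^sup>2) * (1 / (1 - \<beta>)))"
      using \<beta> by (intro sums_mult geometric_sums) auto
    have "0 \<le> 64 / \<epsilon>\<^sup>2 * (1 - \<beta>\<^sup>2) * \<beta> ^ k" for k
      using \<beta> by (intro mult_nonneg_nonneg) (auto simp: abs_square_le_1)
    then show ?thesis using s by (intro suminf_ennreal_eq) auto
  qed
  also have "64 / \<epsilon>\<^sup>2 * (1 - \<beta>\<^sup>2) * (1 / (1 - \<beta>)) = 64 / \<epsilon>\<^sup>2 * (1 + \<beta>)"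
    using \<beta> by (simp add: power2_eq_square divide_simps) (simp add: algebra_simps)
  also have "\<dots> \<le> 128 / \<epsilon>\<^sup>2" using \<beta> \<epsilon> by (simp add: divide_right_mono)
  finally have nn: "(\<integral>\<^sup>+ \<omega>. ennreal ((real_of_int (X \<omega>))\<^sup>2) \<partial>M) \<le> ennreal (128 / \<epsilon>\<^sup>2)"
    by (simp add: ennreal_leI)
  show int: "integrable M (\<lambda>\<omega>. (real_of_int (X \<omega>))\<^sup>2)"
    using rv nn by (intro integrableI_nonneg) (auto simp: le_less_trans)
  show "expectation (\<lambda>\<omega>. (real_of_int (X \<omega>))\<^sup>2) \<le> 128 / \<epsilon>\<^sup>2"
    using nn_integral_eq_integral[OF int] nn \<epsilon> by simp
qed

text \<open>The law is invariant under negation, so the expectation equals its own negative.\<close>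

lemma discrete_laplace_mean:
  assumes X: "discrete_laplace M \<alpha> X" and rv: "random_variable borel (\<lambda>\<omega>. real_of_int (X \<omega>))"
  shows "expectation (\<lambda>\<omega>. real_of_int (X \<omega>)) = 0"
proof -
  note [measurable] = discrete_laplace_measurable[OF rv]
  have "distr M (count_space UNIV) X = distr M (count_space UNIV) (\<lambda>\<omega>. - X \<omega>)"
  proof (rule measure_eqI_countable[where A = UNIV])
    fix x :: int
    have "X -` {x} \<inter> space M = {\<omega>\<in>space M. X \<omega> = x}"
      "(\<lambda>\<omega>. - X \<omega>) -` {x} \<inter> space M = {\<omega>\<in>space M. X \<omega> = - x}" by auto
    then show "emeasure (distr M (count_space UNIV) X) {x} = emeasure (distr M (count_space UNIV) (\<lambda>\<omega>. - X \<omega>)) {x}"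
      using X by (simp add: emeasure_distr emeasure_eq_measure discrete_laplace_def)
  qed auto
  then have "(\<integral>x. real_of_int x \<partial>distr M (count_space UNIV) X)
      = (\<integral>x. real_of_int x \<partial>distr M (count_space UNIV) (\<lambda>\<omega>. - X \<omega>))" by simp
  then have "expectation (\<lambda>\<omega>. real_of_int (X \<omega>)) = expectation (\<lambda>\<omega>. real_of_int (- X \<omega>))"
    by (simp add: integral_distr)
  then show ?thesis by simp
qed

text \<open>The Laplace density is the mean of an exponential density and its reflection; both tails
  together have the mass of one exponential tail.\<close>

lemma laplace_tail:
  assumes D: "distributed M lborel X (\<lambda>x. ennreal (laplace_density \<beta> x))" and \<beta>: "0 < \<beta>" and K: "0 \<le> K"
  shows "prob {\<omega>\<in>space M. K * \<beta> < \<bar>X \<omega>\<bar>} \<le> exp (- K)"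
proof -
  define a where "a = K * \<beta>"
  have a: "0 \<le> a" using \<beta> K by (simp add: a_def)
  define f where "f x = ennreal (exponential_density (1 / \<beta>) x) * indicator {a<..} x" for x
  have fm [measurable]: "f \<in> borel_measurable borel" unfolding f_def by measurable
  have ev: "{\<omega>\<in>space M. K * \<beta> < \<bar>X \<omega>\<bar>} = X -` {x. a < \<bar>x\<bar>} \<inter> space M" by (auto simp: a_def)
  have "emeasure M (X -` {x. a < \<bar>x\<bar>} \<inter> space M)
      = (\<integral>\<^sup>+ x. ennreal (laplace_density \<beta> x) * indicator {x. a < \<bar>x\<bar>} x \<partial>lborel)"
    by (rule distributed_emeasure[OF D]) measurable
  also have "\<dots> = (\<integral>\<^sup>+ x. ennreal (1 / 2) * f x + ennreal (1 / 2) * f (- x) \<partial>lborel)"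
  proof (rule nn_integral_cong)
    fix x :: real
    show "ennreal (laplace_density \<beta> x) * indicator {x. a < \<bar>x\<bar>} x = ennreal (1 / 2) * f x + ennreal (1 / 2) * f (- x)"
    proof (cases "a < \<bar>x\<bar>")
      case True
      have half: "ennreal (1 / 2) * ennreal (exp u / \<beta>) = ennreal (1 / (2 * \<beta>) * exp u)" for u
        using \<beta> by (subst ennreal_mult[symmetric]) auto
      from True a consider "x < 0" "a < - x" | "0 < x" "a < x" by linarith
      then show ?thesis
      proof cases
        case 1
        then have "f x = 0" "f (- x) = ennreal (exp (x / \<beta>) / \<beta>)"
          using a by (auto simp: f_def exponential_density_def)
        then show ?thesis using 1 True half[of "x / \<beta>"] by (simp only:) (simp add: laplace_density_def)
      next
        case 2
        then have "f (- x) = 0" "f x = ennreal (exp (- x / \<beta>) / \<beta>)"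
          using a by (auto simp: f_def exponential_density_def)
        then show ?thesis using 2 True half[of "- x / \<beta>"] by (simp only:) (simp add: laplace_density_def)
      qed
    next
      case False
      then show ?thesis by (auto simp: f_def indicator_def)
    qed
  qed
  also have "\<dots> = ennreal (1 / 2) * (\<integral>\<^sup>+ x. f x \<partial>lborel) + ennreal (1 / 2) * (\<integral>\<^sup>+ x. f (- x) \<partial>lborel)"
    by (subst nn_integral_add) (auto simp: nn_integral_cmult)
  also have "(\<integral>\<^sup>+ x. f (- x) \<partial>lborel) = (\<integral>\<^sup>+ x. f x \<partial>lborel)"
  proof -
    have "(\<integral>\<^sup>+ x. f x \<partial>lborel) = (\<integral>\<^sup>+ x. f x \<partial>distr lborel borel uminus)" by (simp add: lborel_distr_uminus)
    also have "\<dots> = (\<integral>\<^sup>+ x. f (- x) \<partial>lborel)" by (subst nn_integral_distr) auto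
    finally show ?thesis by simp
  qed
  also have "ennreal (1 / 2) * (\<integral>\<^sup>+ x. f x \<partial>lborel) + ennreal (1 / 2) * (\<integral>\<^sup>+ x. f x \<partial>lborel) = (\<integral>\<^sup>+ x. f x \<partial>lborel)"
  proof -
    have "ennreal (1 / 2) + ennreal (1 / 2) = ennreal (1 / 2 + 1 / 2)" by (rule ennreal_plus[symmetric]) auto
    then have "ennreal (1 / 2) + ennreal (1 / 2) = 1" by (simp only: field_sum_of_halves ennreal_1)
    then show ?thesis by (simp only: distrib_right[symmetric] mult_1_left)
  qed
  also have "(\<integral>\<^sup>+ x. f x \<partial>lborel) = emeasure (density lborel (exponential_density (1 / \<beta>))) {a<..}"
    unfolding f_def by (subst emeasure_density) auto
  also have "\<dots> = ennreal (exp (- a * (1 / \<beta>)))"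
  proof -
    interpret E: prob_space "density lborel (exponential_density (1 / \<beta>))"
      using \<beta> by (intro prob_space_exponential_density) simp
    have "distributed (density lborel (exponential_density (1 / \<beta>))) lborel (\<lambda>x. x) (exponential_density (1 / \<beta>))"
      unfolding distributed_def by (auto simp: distr_id2 cong: distr_cong)
    from E.exponential_distributedD_gt[OF this a] show ?thesis
      using \<beta> by (simp add: E.emeasure_eq_measure greaterThan_def)
  qed
  finally have "emeasure M (X -` {x. a < \<bar>x\<bar>} \<inter> space M) = ennreal (exp (- K))" using \<beta> by (simp add: a_def)
  then show ?thesis unfolding ev by (simp add: emeasure_eq_measure)
qed

end

section \<open>Concentration in one noisy network of fixed size\<close>

locale noisy_network = prob_space M for M :: "'w measure" +
  fixes n p :: nat and \<pi> :: "nat \<Rightarrow> nat \<Rightarrow> real"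
    and a :: "nat \<Rightarrow> nat \<Rightarrow> 'w \<Rightarrow> real" and ep em :: "nat \<Rightarrow> 'w \<Rightarrow> int" and eta :: "nat \<Rightarrow> 'w \<Rightarrow> real"
    and \<epsilon> \<beta> :: real
  assumes n: "2 \<le> n" and \<epsilon>: "0 < \<epsilon>" and \<beta>: "0 < \<beta>"
    and indep: "indep_vars (\<lambda>_. borel) (source_var a ep em eta) (sources n p)"
    and edge_range: "\<And>i j \<omega>. (i, j) \<in> node_pairs n \<Longrightarrow> \<omega> \<in> space M \<Longrightarrow> a i j \<omega> \<in> {0, 1}"
    and edge_prob: "\<And>i j. (i, j) \<in> node_pairs n \<Longrightarrow> prob {\<omega>\<in>space M. a i j \<omega> = 1} = \<pi> i j"
    and ep_dist: "\<And>i. i < n \<Longrightarrow> discrete_laplace M (exp (- \<epsilon> / 2)) (ep i)"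
    and em_dist: "\<And>j. j < n \<Longrightarrow> discrete_laplace M (exp (- \<epsilon> / 2)) (em j)"
    and eta_dist: "\<And>t. t < p \<Longrightarrow> distributed M lborel (eta t) (\<lambda>x. ennreal (laplace_density \<beta> x))"
begin

definition \<epsilon>t :: real where "\<epsilon>t = 1 + 8 / \<epsilon>"

lemma \<epsilon>t: "1 \<le> \<epsilon>t" "128 / \<epsilon>\<^sup>2 \<le> 2 * \<epsilon>t\<^sup>2"
proof -
  show "1 \<le> \<epsilon>t" using \<epsilon> by (simp add: \<epsilon>t_def)
  have "(8 / \<epsilon>)\<^sup>2 \<le> \<epsilon>t\<^sup>2" using \<epsilon> by (intro power_mono) (auto simp: \<epsilon>t_def)
  then show "128 / \<epsilon>\<^sup>2 \<le> 2 * \<epsilon>t\<^sup>2" by (simp add: power_divide)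
qed

lemma rv:
  "(i, j) \<in> node_pairs n \<Longrightarrow> random_variable borel (a i j)"
  "i < n \<Longrightarrow> random_variable borel (\<lambda>\<omega>. real_of_int (ep i \<omega>))"
  "j < n \<Longrightarrow> random_variable borel (\<lambda>\<omega>. real_of_int (em j \<omega>))"
  "t < p \<Longrightarrow> random_variable borel (eta t)"
proof -
  have *: "random_variable borel (source_var a ep em eta s)" if "s \<in> sources n p" for s
    using indep that by (auto simp: indep_vars_def)
  show "(i, j) \<in> node_pairs n \<Longrightarrow> random_variable borel (a i j)"
    using *[of "Edge i j"] by (auto simp: sources_def source_var_def[abs_def])
  show "i < n \<Longrightarrow> random_variable borel (\<lambda>\<omega>. real_of_int (ep i \<omega>))"
    using *[of "Out_noise i"] by (auto simp: sources_def source_var_def[abs_def])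
  show "j < n \<Longrightarrow> random_variable borel (\<lambda>\<omega>. real_of_int (em j \<omega>))"
    using *[of "In_noise j"] by (auto simp: sources_def source_var_def[abs_def])
  show "t < p \<Longrightarrow> random_variable borel (eta t)"
    using *[of "Cov_noise t"] by (auto simp: sources_def source_var_def[abs_def])
qed

lemma edge_mean:
  assumes ij: "(i, j) \<in> node_pairs n"
  shows "expectation (a i j) = \<pi> i j"
    and "integrable M (a i j)"
    and "integrable M (\<lambda>\<omega>. (a i j \<omega> - \<pi> i j)\<^sup>2)"
    and "expectation (\<lambda>\<omega>. (a i j \<omega> - \<pi> i j)\<^sup>2) = \<pi> i j * (1 - \<pi> i j)"
proof -
  note [measurable] = rv(1)[OF ij]
  have r: "a i j \<omega> = 0 \<or> a i j \<omega> = 1" if "\<omega> \<in> space M" for \<omega>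
    using edge_range[OF ij that] by simp
  show int: "integrable M (a i j)"
    by (rule integrable_const_bound[of _ 1]) (use r in \<open>fastforce intro!: AE_I2\<close>, simp add: rv(1)[OF ij])
  have "expectation (a i j) = expectation (indicator {\<omega>\<in>space M. a i j \<omega> = 1})"
    using r by (intro Bochner_Integration.integral_cong) (auto simp: indicator_def)
  also have "\<dots> = prob {\<omega>\<in>space M. a i j \<omega> = 1}" by simp
  finally show mean: "expectation (a i j) = \<pi> i j" using edge_prob[OF ij] by simp
  have sq: "(a i j \<omega> - \<pi> i j)\<^sup>2 = (1 - 2 * \<pi> i j) * a i j \<omega> + (\<pi> i j)\<^sup>2" if "\<omega> \<in> space M" for \<omega>
    using r[OF that] by (auto simp: power2_eq_square algebra_simps)
  have "integrable M (\<lambda>\<omega>. (1 - 2 * \<pi> i j) * a i j \<omega> + (\<pi> i j)\<^sup>2)" using int by simp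
  then show "integrable M (\<lambda>\<omega>. (a i j \<omega> - \<pi> i j)\<^sup>2)"
    by (rule Bochner_Integration.integrable_cong[THEN iffD1, rotated -1]) (use sq in auto)
  have "expectation (\<lambda>\<omega>. (a i j \<omega> - \<pi> i j)\<^sup>2) = expectation (\<lambda>\<omega>. (1 - 2 * \<pi> i j) * a i j \<omega> + (\<pi> i j)\<^sup>2)"
    using sq by (intro Bochner_Integration.integral_cong) auto
  also have "\<dots> = (1 - 2 * \<pi> i j) * \<pi> i j + (\<pi> i j)\<^sup>2" using int mean by (simp add: prob_space)
  finally show "expectation (\<lambda>\<omega>. (a i j \<omega> - \<pi> i j)\<^sup>2) = \<pi> i j * (1 - \<pi> i j)"
    by (simp add: power2_eq_square algebra_simps)
qed

definition dev :: "'w \<Rightarrow> nat \<Rightarrow> nat \<Rightarrow> real" where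
  "dev \<omega> i j = a i j \<omega> - \<pi> i j"

text \<open>One shape for everything that is treated by second moments: single node noises, their
  signed total and the projected scores. The coefficients \<open>l\<close> are indexed like
  \<theta>, so the in-noise of the last node does not occur.\<close>

definition linear_form :: "(nat \<Rightarrow> nat \<Rightarrow> real) \<Rightarrow> (nat \<Rightarrow> real) \<Rightarrow> 'w \<Rightarrow> real" where
  "linear_form c l \<omega> = (\<Sum>(i, j)\<in>node_pairs n. c i j * dev \<omega> i j)
     + (\<Sum>i<n. l i * real_of_int (ep i \<omega>)) + (\<Sum>j<n - 1. l (n + j) * real_of_int (em j \<omega>))"

text \<open>An upper bound for the variance of \<open>linear_form\<close>: the second moment of each
  discrete noise is replaced by \<open>2 * \<epsilon>t\<^sup>2\<close>.\<close>

definition form_var :: "(nat \<Rightarrow> nat \<Rightarrow> real) \<Rightarrow> (nat \<Rightarrow> real) \<Rightarrow> real" where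
  "form_var c l = (\<Sum>(i, j)\<in>node_pairs n. (c i j)\<^sup>2 * (\<pi> i j * (1 - \<pi> i j)))
     + 2 * \<epsilon>t\<^sup>2 * ((\<Sum>i<n. (l i)\<^sup>2) + (\<Sum>j<n - 1. (l (n + j))\<^sup>2))"

lemma linear_form_measurable: "random_variable borel (linear_form c l)"
proof -
  have "(\<lambda>\<omega>. \<Sum>(i, j)\<in>node_pairs n. c i j * dev \<omega> i j) \<in> borel_measurable M"
    unfolding dev_def case_prod_beta using rv(1)
    by (intro borel_measurable_sum borel_measurable_times borel_measurable_diff) auto
  moreover have "(\<lambda>\<omega>. \<Sum>i<n. l i * real_of_int (ep i \<omega>)) \<in> borel_measurable M"
    using rv(2) by (intro borel_measurable_sum borel_measurable_times) auto
  moreover have "(\<lambda>\<omega>. \<Sum>j<n - 1. l (n + j) * real_of_int (em j \<omega>)) \<in> borel_measurable M"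
    using rv(3) by (intro borel_measurable_sum borel_measurable_times) auto
  ultimately show ?thesis
    unfolding linear_form_def[abs_def] by (intro borel_measurable_add)
qed

lemma linear_form_event: "{\<omega>\<in>space M. K \<le> \<bar>linear_form c l \<omega>\<bar>} \<in> events"
  using linear_form_measurable[of c l] by measurable

lemma linear_form_tail:
  assumes K: "0 < K"
  shows "prob {\<omega>\<in>space M. K \<le> \<bar>linear_form c l \<omega>\<bar>} \<le> form_var c l / K\<^sup>2"
proof -
  define I where "I = (\<lambda>(i, j). Edge i j) ` node_pairs n \<union> (Out_noise ` {..<n} \<union> In_noise ` {..<n - 1})"
  define cf where "cf s = (case s of Edge i j \<Rightarrow> c i j | Out_noise i \<Rightarrow> l i | In_noise j \<Rightarrow> l (n + j) | _ \<Rightarrow> 0)" for s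
  \<comment> \<open>Only the edges are shifted; the noises are centered already.\<close>
  define ct where "ct s = (case s of Edge i j \<Rightarrow> \<pi> i j | _ \<Rightarrow> 0)" for s
  define v where "v s = (case s of Edge i j \<Rightarrow> \<pi> i j * (1 - \<pi> i j) | _ \<Rightarrow> 2 * \<epsilon>t\<^sup>2)" for s
  define U where "U s \<omega> = source_var a ep em eta s \<omega> - ct s" for s \<omega>
  have fin: "finite I" by (simp add: I_def)
  have sub: "I \<subseteq> sources n p" by (auto simp: I_def sources_def)
  have sum_I: "(\<Sum>s\<in>I. f s) = (\<Sum>(i, j)\<in>node_pairs n. f (Edge i j)) + (\<Sum>i<n. f (Out_noise i))
      + (\<Sum>j<n - 1. f (In_noise j))" for f :: "source \<Rightarrow> real"
  proof -
    have "(\<Sum>s\<in>I. f s) = (\<Sum>s\<in>(\<lambda>(i, j). Edge i j) ` node_pairs n. f s)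
        + ((\<Sum>s\<in>Out_noise ` {..<n}. f s) + (\<Sum>s\<in>In_noise ` {..<n - 1}. f s))"
      unfolding I_def by (subst sum.union_disjoint, simp, simp, force, subst sum.union_disjoint) auto
    moreover have "(\<Sum>s\<in>(\<lambda>(i, j). Edge i j) ` node_pairs n. f s) = (\<Sum>(i, j)\<in>node_pairs n. f (Edge i j))"
      by (subst sum.reindex) (auto simp: inj_on_def case_prod_beta)
    moreover have "(\<Sum>s\<in>Out_noise ` {..<n}. f s) = (\<Sum>i<n. f (Out_noise i))"
      by (subst sum.reindex) (auto simp: inj_on_def)
    moreover have "(\<Sum>s\<in>In_noise ` {..<n - 1}. f s) = (\<Sum>j<n - 1. f (In_noise j))"
      by (subst sum.reindex) (auto simp: inj_on_def)
    ultimately show ?thesis by simp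
  qed
  have "indep_vars (\<lambda>_. borel) (source_var a ep em eta) I" by (rule indep_vars_subset[OF indep sub])
  then have indU: "indep_vars (\<lambda>_. borel) U I"
    unfolding U_def[abs_def] by (rule indep_vars_compose2) auto
  have U: "integrable M (\<lambda>\<omega>. (U s \<omega>)\<^sup>2) \<and> expectation (U s) = 0 \<and> expectation (\<lambda>\<omega>. (U s \<omega>)\<^sup>2) \<le> v s"
    if s: "s \<in> I" for s
  proof -
    consider i j where "s = Edge i j" "(i, j) \<in> node_pairs n" | i where "s = Out_noise i" "i < n"
      | j where "s = In_noise j" "j < n - 1" using s by (auto simp: I_def)
    then show ?thesis
    proof cases
      case 1
      then show ?thesis using edge_mean[OF 1(2)]
        by (simp add: U_def[abs_def] source_var_def ct_def v_def prob_space)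
    next
      case 2
      show ?thesis using discrete_laplace_second_moment[OF ep_dist \<epsilon> rv(2)] discrete_laplace_mean[OF ep_dist rv(2)] 2 \<epsilon>t(2)
        by (fastforce simp add: U_def[abs_def] source_var_def ct_def v_def)
    next
      case 3
      then have "j < n" by simp
      with 3 show ?thesis using discrete_laplace_second_moment[OF em_dist \<epsilon> rv(3)] discrete_laplace_mean[OF em_dist rv(3)] \<epsilon>t(2)
        by (fastforce simp add: U_def[abs_def] source_var_def ct_def v_def)
    qed
  qed
  have "prob {\<omega>\<in>space M. K \<le> \<bar>\<Sum>s\<in>I. cf s * U s \<omega>\<bar>} \<le> (\<Sum>s\<in>I. (cf s)\<^sup>2 * v s) / K\<^sup>2"
    using U by (intro indep_sum_tail[OF fin indU _ _ _ K]) auto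
  moreover have "(\<Sum>s\<in>I. cf s * U s \<omega>) = linear_form c l \<omega>" for \<omega>
    by (simp add: sum_I linear_form_def dev_def U_def source_var_def cf_def ct_def)
  moreover have "(\<Sum>s\<in>I. (cf s)\<^sup>2 * v s) = form_var c l"
    by (simp add: sum_I form_var_def cf_def v_def sum_distrib_left sum_distrib_right distrib_left mult.commute)
  ultimately show ?thesis by simp
qed

text \<open>The row and column sums of the edges can have variance of order n, so at level sqrt(n ln
  n) Chebyshev's inequality gives only order 1 / ln n for each of the 2 n sums. Hoeffding's
  inequality gives 2 / n^2, which survives the union.\<close>

lemma edge_sum_tail:
  assumes J: "J \<subseteq> node_pairs n" "real (card J) \<le> real n" "0 < card J"
  shows "prob {\<omega>\<in>space M. sqrt (real n * ln (real n)) \<le> \<bar>\<Sum>(i, j)\<in>J. dev \<omega> i j\<bar>} \<le> 2 / (real n)\<^sup>2"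
    and "{\<omega>\<in>space M. K \<le> \<bar>\<Sum>(i, j)\<in>J. dev \<omega> i j\<bar>} \<in> events"
proof -
  have fin: "finite J" using J(1) by (rule finite_subset) simp
  have "(\<lambda>\<omega>. \<Sum>(i, j)\<in>J. dev \<omega> i j) \<in> borel_measurable M"
    unfolding dev_def case_prod_beta using rv(1) J(1)
    by (intro borel_measurable_sum borel_measurable_diff) auto
  then show "{\<omega>\<in>space M. K \<le> \<bar>\<Sum>(i, j)\<in>J. dev \<omega> i j\<bar>} \<in> events" by measurable
  have "indep_vars (\<lambda>_. borel) (source_var a ep em eta) ((\<lambda>(i, j). Edge i j) ` J)"
    using J(1) by (intro indep_vars_subset[OF indep]) (auto simp: sources_def)
  then interpret H: Hoeffding_ineq M "(\<lambda>(i, j). Edge i j) ` J" "source_var a ep em eta" "\<lambda>_. 0" "\<lambda>_. 1"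
      "\<Sum>s\<in>(\<lambda>(i, j). Edge i j) ` J. expectation (source_var a ep em eta s)"
    using J(1) fin edge_range
    by unfold_locales (fastforce intro!: AE_I2 simp: source_var_def)+
  have inj: "inj_on (\<lambda>(i, j). Edge i j) J" by (auto simp: inj_on_def)
  have mean: "(\<Sum>s\<in>(\<lambda>(i, j). Edge i j) ` J. expectation (source_var a ep em eta s)) = (\<Sum>(i, j)\<in>J. \<pi> i j)"
    using edge_mean(1) J(1) by (subst sum.reindex[OF inj]) (auto simp: source_var_def[abs_def] intro!: sum.cong)
  have val: "(\<Sum>s\<in>(\<lambda>(i, j). Edge i j) ` J. source_var a ep em eta s \<omega>) = (\<Sum>(i, j)\<in>J. a i j \<omega>)" for \<omega>
    by (subst sum.reindex[OF inj]) (auto simp: source_var_def intro!: sum.cong)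
  have card: "(\<Sum>s\<in>(\<lambda>(i, j). Edge i j) ` J. (1 - 0 :: real)\<^sup>2) = real (card J)"
    by (simp add: card_image[OF inj])
  have ln: "0 \<le> ln (real n)" using n by simp
  have "prob {\<omega>\<in>space M. sqrt (real n * ln (real n)) \<le> \<bar>\<Sum>(i, j)\<in>J. dev \<omega> i j\<bar>}
      \<le> 2 * exp (- 2 * (sqrt (real n * ln (real n)))\<^sup>2 / real (card J))"
    using H.Hoeffding_ineq_abs_ge[of "sqrt (real n * ln (real n))"] J(3) n ln
    unfolding mean val card by (simp add: dev_def case_prod_beta sum_subtractf)
  also have "\<dots> \<le> 2 * exp (- 2 * ln (real n))"
  proof -
    have "2 * ln (real n) \<le> 2 * (real n * ln (real n)) / real (card J)"
      using J ln mult_right_mono[OF J(2) ln] by (simp add: field_simps)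
    then show ?thesis using ln n by simp
  qed
  also have "exp (- 2 * ln (real n)) = 1 / (real n)\<^sup>2"
    using n by (simp add: exp_minus exp_double field_simps)
  finally show "prob {\<omega>\<in>space M. sqrt (real n * ln (real n)) \<le> \<bar>\<Sum>(i, j)\<in>J. dev \<omega> i j\<bar>} \<le> 2 / (real n)\<^sup>2"
    by simp
qed

end

lemma ln_ge_1: "3 \<le> n \<Longrightarrow> 1 \<le> ln (real n)"
  using exp_le by (subst ln_ge_iff) auto

context noisy_network
begin

text \<open>Each union bound over the nodes tends to 0: 2 n edge sums at 2 / n^2, fewer than 2 n
  node noises at 2 / (n ln n), and one signed total at 4 / ln n. The scores and continuous noises
  fail with a probability controlled by \<open>K\<close> and p, uniformly in n. The 2 in
  \<open>X\<close> adds the edge part to the noise part.\<close>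

lemma good_event:
  fixes c :: "nat \<Rightarrow> nat \<Rightarrow> nat \<Rightarrow> real" and l :: "nat \<Rightarrow> nat \<Rightarrow> real" and K V :: real
  defines "X \<equiv> 2 * \<epsilon>t * sqrt (real n * ln (real n))"
  assumes n3: "3 \<le> n" and K: "0 < K" and V0: "0 < V"
    and V: "\<And>s. s < p \<Longrightarrow> form_var (c s) (l s) \<le> V\<^sup>2"
  obtains E where "E \<in> events"
    and "1 - (4 / real n + 8 / ln (real n) + real p * (1 / K\<^sup>2 + exp (- K))) \<le> prob E"
    and "\<And>\<omega> i. \<omega> \<in> E \<Longrightarrow> i < n \<Longrightarrow> \<bar>(\<Sum>j\<in>{..<n} - {i}. dev \<omega> i j) + real_of_int (ep i \<omega>)\<bar> \<le> X"
    and "\<And>\<omega> j. \<omega> \<in> E \<Longrightarrow> j < n - 1 \<Longrightarrow> \<bar>(\<Sum>i\<in>{..<n} - {j}. dev \<omega> i j) + real_of_int (em j \<omega>)\<bar> \<le> X"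
    and "\<And>\<omega>. \<omega> \<in> E \<Longrightarrow> \<bar>(\<Sum>i\<in>{..<n} - {n - 1}. dev \<omega> i (n - 1)) + (\<Sum>i<n. real_of_int (ep i \<omega>))
           - (\<Sum>j<n - 1. real_of_int (em j \<omega>))\<bar> \<le> X"
    and "\<And>\<omega> s. \<omega> \<in> E \<Longrightarrow> s < p \<Longrightarrow> \<bar>linear_form (c s) (l s) \<omega> + eta s \<omega>\<bar> \<le> K * V + K * \<beta>"
proof -
  define S where "S = sqrt (real n * ln (real n))"
  have ln: "1 \<le> ln (real n)" by (rule ln_ge_1[OF n3])
  have n0: "0 < real n" using n by simp
  have "0 < real n * ln (real n)" using n0 ln by (intro mult_pos_pos) linarith+
  then have S: "0 < S" "S\<^sup>2 = real n * ln (real n)" by (auto simp: S_def)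
  have tS: "0 < \<epsilon>t * S" "S \<le> \<epsilon>t * S" using S \<epsilon>t(1) by auto
  define rowJ where "rowJ i = {i} \<times> ({..<n} - {i})" for i
  define colJ where "colJ j = ({..<n} - {j}) \<times> {j}" for j
  have J: "rowJ i \<subseteq> node_pairs n" "colJ i \<subseteq> node_pairs n" if "i < n" for i
    using that by (auto simp: rowJ_def colJ_def node_pairs_def)
  have cardJ: "card (rowJ i) = n - 1" "card (colJ i) = n - 1" if "i < n" for i
    using that by (simp_all add: rowJ_def colJ_def card_cartesian_product)
  have sumJ: "(\<Sum>(i', j)\<in>rowJ i. f i' j) = (\<Sum>j\<in>{..<n} - {i}. f i j)"
    "(\<Sum>(i', j)\<in>colJ i. f i' j) = (\<Sum>j\<in>{..<n} - {i}. f j i)" for f :: "nat \<Rightarrow> nat \<Rightarrow> real" and i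
    by (simp_all add: rowJ_def colJ_def flip: sum.cartesian_product)
  define R where "R i = {\<omega>\<in>space M. S \<le> \<bar>\<Sum>(i', j)\<in>rowJ i. dev \<omega> i' j\<bar>}" for i
  define C where "C j = {\<omega>\<in>space M. S \<le> \<bar>\<Sum>(i, j')\<in>colJ j. dev \<omega> i j'\<bar>}" for j
  \<comment> \<open>Coordinate vectors, which present a single node noise as a
    \<open>linear_form\<close>.\<close>
  define \<delta> where "\<delta> k k' = (if k' = k then 1 else 0 :: real)" for k k' :: nat
  have \<delta>_sq: "(\<delta> k k')\<^sup>2 = \<delta> k k' * 1" for k k' by (simp add: \<delta>_def)
  have \<delta>_out: "(\<Sum>i<n. \<delta> k i * f i) = (if k < n then f k else 0)" for k and f :: "nat \<Rightarrow> real"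
  proof -
    have "(\<Sum>i<n. \<delta> k i * f i) = (\<Sum>i<n. if i = k then f i else 0)" by (rule sum.cong) (auto simp: \<delta>_def)
    then show ?thesis by simp
  qed
  have \<delta>_in: "(\<Sum>j<n - 1. \<delta> k (n + j) * f j) = (if n \<le> k \<and> k < 2 * n - 1 then f (k - n) else 0)"
    for k and f :: "nat \<Rightarrow> real"
  proof (cases "n \<le> k")
    case True
    have "(\<Sum>j<n - 1. \<delta> k (n + j) * f j) = (\<Sum>j<n - 1. if j = k - n then f j else 0)"
      using True by (intro sum.cong) (auto simp: \<delta>_def)
    also have "\<dots> = (if k - n < n - 1 then f (k - n) else 0)" by simp
    finally show ?thesis using True by auto
  qed (auto simp: \<delta>_def intro!: sum.neutral)
  define N where "N k = {\<omega>\<in>space M. \<epsilon>t * S \<le> \<bar>linear_form (\<lambda>_ _. 0) (\<delta> k) \<omega>\<bar>}" for k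
  \<comment> \<open>Coefficients 1 and -1 give the noise in the last column sum, recovered as all
    rows minus the free columns.\<close>
  define T where "T = {\<omega>\<in>space M. \<epsilon>t * S \<le> \<bar>linear_form (\<lambda>_ _. 0) (\<lambda>k. if k < n then 1 else - 1) \<omega>\<bar>}"
  define Q where "Q s = {\<omega>\<in>space M. K * V \<le> \<bar>linear_form (c s) (l s) \<omega>\<bar>}" for s
  define H where "H s = {\<omega>\<in>space M. K * \<beta> < \<bar>eta s \<omega>\<bar>}" for s
  have R: "R i \<in> events" "prob (R i) \<le> 2 / (real n)\<^sup>2" if "i < n" for i
    unfolding R_def S_def using that n J cardJ by (intro edge_sum_tail; simp)+
  have C: "C i \<in> events" "prob (C i) \<le> 2 / (real n)\<^sup>2" if "i < n" for i
    unfolding C_def S_def using that n J cardJ by (intro edge_sum_tail; simp)+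
  have var_N: "form_var (\<lambda>_ _. 0) (\<delta> k) = 2 * \<epsilon>t\<^sup>2" if "k < 2 * n - 1" for k
    unfolding form_var_def \<delta>_sq \<delta>_out \<delta>_in using that by auto
  have N: "N k \<in> events" "prob (N k) \<le> 2 / (real n * ln (real n))" if "k < 2 * n - 1" for k
  proof -
    show "N k \<in> events" unfolding N_def by (rule linear_form_event)
    have "prob (N k) \<le> 2 * \<epsilon>t\<^sup>2 / (\<epsilon>t * S)\<^sup>2"
      unfolding N_def var_N[OF that, symmetric] by (rule linear_form_tail[OF tS(1)])
    then show "prob (N k) \<le> 2 / (real n * ln (real n))" using \<epsilon>t(1) S by (simp add: power_mult_distrib)
  qed
  have T: "T \<in> events" "prob T \<le> 4 / ln (real n)"
  proof -
    show "T \<in> events" unfolding T_def by (rule linear_form_event)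
    have var: "form_var (\<lambda>_ _. 0) (\<lambda>k. if k < n then 1 else - 1) = 2 * \<epsilon>t\<^sup>2 * (real n + real (n - 1))"
      by (simp add: form_var_def)
    have "prob T \<le> 2 * \<epsilon>t\<^sup>2 * (real n + real (n - 1)) / (\<epsilon>t * S)\<^sup>2"
      unfolding T_def var[symmetric] by (rule linear_form_tail[OF tS(1)])
    also have "\<dots> \<le> 2 * \<epsilon>t\<^sup>2 * (2 * real n) / (\<epsilon>t * S)\<^sup>2" using n by (intro divide_right_mono mult_left_mono) auto
    also have "\<dots> = 4 / ln (real n)" using \<epsilon>t(1) S n0 by (simp add: power_mult_distrib)
    finally show "prob T \<le> 4 / ln (real n)" .
  qed
  have Q: "Q s \<in> events" "prob (Q s) \<le> 1 / K\<^sup>2" if "s < p" for s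
  proof -
    show "Q s \<in> events" unfolding Q_def by (rule linear_form_event)
    have "prob (Q s) \<le> form_var (c s) (l s) / (K * V)\<^sup>2"
      unfolding Q_def using K V0 by (intro linear_form_tail) auto
    also have "\<dots> \<le> V\<^sup>2 / (K * V)\<^sup>2" by (intro divide_right_mono V[OF that]) simp
    finally show "prob (Q s) \<le> 1 / K\<^sup>2" using V0 by (simp add: power_mult_distrib)
  qed
  have H: "H s \<in> events" "prob (H s) \<le> exp (- K)" if "s < p" for s
  proof -
    note [measurable] = rv(4)[OF that]
    show "H s \<in> events" unfolding H_def by measurable
    show "prob (H s) \<le> exp (- K)" unfolding H_def using K by (intro laplace_tail[OF eta_dist[OF that] \<beta>]) simp
  qed
  define U1 where "U1 = (\<Union>i\<in>{..<n}. R i) \<union> (\<Union>i\<in>{..<n}. C i)"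
  define U2 where "U2 = (\<Union>k\<in>{..<2 * n - 1}. N k) \<union> T"
  define U3 where "U3 = (\<Union>s\<in>{..<p}. Q s) \<union> (\<Union>s\<in>{..<p}. H s)"
  have U_events: "U1 \<in> events" "U2 \<in> events" "U3 \<in> events"
    unfolding U1_def U2_def U3_def using R C N T Q H by (auto intro!: sets.Un sets.finite_UN)
  have UN_le: "prob (\<Union>i\<in>{..<k}. G i) \<le> real k * x"
    if "\<And>i. i < k \<Longrightarrow> G i \<in> events" "\<And>i. i < k \<Longrightarrow> prob (G i) \<le> x" for G k x
  proof -
    have "prob (\<Union>i\<in>{..<k}. G i) \<le> (\<Sum>i<k. prob (G i))" using that by (intro measure_UNION_le) auto
    also have "\<dots> \<le> (\<Sum>i<k. x)" using that by (intro sum_mono) auto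
    finally show ?thesis by simp
  qed
  have "prob U1 \<le> real n * (2 / (real n)\<^sup>2) + real n * (2 / (real n)\<^sup>2)"
    unfolding U1_def using R C
    by (intro order_trans[OF measure_Un_le] add_mono UN_le sets.finite_UN) auto
  also have "\<dots> = 4 / real n" using n0 by (simp add: power2_eq_square field_simps)
  finally have U1: "prob U1 \<le> 4 / real n" .
  have "prob U2 \<le> real (2 * n - 1) * (2 / (real n * ln (real n))) + 4 / ln (real n)"
    unfolding U2_def using N T
    by (intro order_trans[OF measure_Un_le] add_mono UN_le sets.finite_UN) auto
  also have "\<dots> \<le> (2 * real n) * (2 / (real n * ln (real n))) + 4 / ln (real n)"
    using n n0 ln by (intro add_mono mult_right_mono) auto
  also have "\<dots> = 8 / ln (real n)" using n0 ln by (simp add: field_simps)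
  finally have U2: "prob U2 \<le> 8 / ln (real n)" .
  have "prob U3 \<le> real p * (1 / K\<^sup>2) + real p * exp (- K)"
    unfolding U3_def using Q H
    by (intro order_trans[OF measure_Un_le] add_mono UN_le sets.finite_UN) auto
  then have U3: "prob U3 \<le> real p * (1 / K\<^sup>2 + exp (- K))" by (simp add: algebra_simps)
  define E where "E = space M - (U1 \<union> U2 \<union> U3)"
  have E: "E \<in> events" unfolding E_def using U_events by auto
  have "prob (U1 \<union> U2 \<union> U3) \<le> prob U1 + prob U2 + prob U3"
    using U_events by (intro order_trans[OF measure_Un_le] add_mono order_refl measure_Un_le) auto
  then have "1 - (4 / real n + 8 / ln (real n) + real p * (1 / K\<^sup>2 + exp (- K))) \<le> prob E"
    unfolding E_def using U_events U1 U2 U3 by (subst prob_compl) auto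
  moreover have "(\<forall>i<n. \<bar>(\<Sum>j\<in>{..<n} - {i}. dev \<omega> i j) + real_of_int (ep i \<omega>)\<bar> \<le> X)
      \<and> (\<forall>j<n - 1. \<bar>(\<Sum>i\<in>{..<n} - {j}. dev \<omega> i j) + real_of_int (em j \<omega>)\<bar> \<le> X)
      \<and> \<bar>(\<Sum>i\<in>{..<n} - {n - 1}. dev \<omega> i (n - 1)) + (\<Sum>i<n. real_of_int (ep i \<omega>))
           - (\<Sum>j<n - 1. real_of_int (em j \<omega>))\<bar> \<le> X
      \<and> (\<forall>s<p. \<bar>linear_form (c s) (l s) \<omega> + eta s \<omega>\<bar> \<le> K * V + K * \<beta>)" if \<omega>: "\<omega> \<in> E" for \<omega>
  proof -
    have sp: "\<omega> \<in> space M" using \<omega> by (simp add: E_def)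
    have not: "\<omega> \<notin> R i" "\<omega> \<notin> C i" if "i < n" for i using \<omega> that by (auto simp: E_def U1_def)
    have row: "\<bar>\<Sum>j\<in>{..<n} - {i}. dev \<omega> i j\<bar> \<le> S" if "i < n" for i
      using not(1)[OF that] sp by (simp add: R_def sumJ)
    have col: "\<bar>\<Sum>j\<in>{..<n} - {i}. dev \<omega> j i\<bar> \<le> S" if "i < n" for i
      using not(2)[OF that] sp by (simp add: C_def sumJ)
    have noise: "\<bar>linear_form (\<lambda>_ _. 0) (\<delta> k) \<omega>\<bar> \<le> \<epsilon>t * S" if "k < 2 * n - 1" for k
    proof -
      have "\<omega> \<notin> N k" using \<omega> that by (auto simp: E_def U2_def)
      then show ?thesis using sp by (simp add: N_def)
    qed
    have ep: "\<bar>real_of_int (ep i \<omega>)\<bar> \<le> \<epsilon>t * S" if "i < n" for i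
      using noise[of i] that n unfolding linear_form_def \<delta>_out \<delta>_in by simp
    have em: "\<bar>real_of_int (em j \<omega>)\<bar> \<le> \<epsilon>t * S" if "j < n - 1" for j
      using noise[of "n + j"] that n unfolding linear_form_def \<delta>_out \<delta>_in by simp
    have "\<omega> \<notin> T" using \<omega> by (auto simp: E_def U2_def)
    then have tot: "\<bar>(\<Sum>i<n. real_of_int (ep i \<omega>)) - (\<Sum>j<n - 1. real_of_int (em j \<omega>))\<bar> \<le> \<epsilon>t * S"
      using sp by (simp add: T_def linear_form_def sum_negf)
    have "\<bar>linear_form (c s) (l s) \<omega> + eta s \<omega>\<bar> \<le> K * V + K * \<beta>" if "s < p" for s
    proof -
      have "\<omega> \<notin> Q s" "\<omega> \<notin> H s" using \<omega> that by (auto simp: E_def U3_def)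
      then show ?thesis using sp by (auto simp: Q_def H_def)
    qed
    moreover have XS: "S + \<epsilon>t * S \<le> X" using tS(2) by (simp add: X_def S_def)
    have sumX: "\<bar>x + y\<bar> \<le> X" if "\<bar>x\<bar> \<le> S" "\<bar>y\<bar> \<le> \<epsilon>t * S" for x y :: real
      using that XS by linarith
    have "\<bar>(\<Sum>i\<in>{..<n} - {n - 1}. dev \<omega> i (n - 1)) + (\<Sum>i<n. real_of_int (ep i \<omega>))
           - (\<Sum>j<n - 1. real_of_int (em j \<omega>))\<bar> \<le> X"
      using sumX[OF col tot, of "n - 1"] n by (simp add: add_diff_eq)
    ultimately show ?thesis using row col ep em n by (auto intro!: sumX)
  qed
  ultimately show ?thesis by (intro that[OF E]) blast+
qed

end

section \<open>Moment solutions\<close>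

lemma vec_norm_inf_le:
  assumes "0 < dim_vec x" "\<And>i. i < dim_vec x \<Longrightarrow> \<bar>x $ i\<bar> \<le> r"
  shows "vec_norm_inf x \<le> r"
  unfolding vec_norm_inf_def using assms by (intro Max.boundedI) (auto simp: lessThan_empty_iff)

lemma vec_norm_inf_ge: "i < dim_vec x \<Longrightarrow> \<bar>x $ i\<bar> \<le> vec_norm_inf x"
  unfolding vec_norm_inf_def by (rule Max_ge) auto

definition observed :: "nat \<Rightarrow> (nat \<Rightarrow> real) \<Rightarrow> (nat \<Rightarrow> real) \<Rightarrow> real vec \<Rightarrow> nat \<Rightarrow> real" where
  "observed n d b y k = (if k < n then d k else if k < 2 * n - 1 then b (k - n) else y $ (k - (2 * n - 1)))"

text \<open>Puts the three kinds of moment equations into one family, indexed by the coordinates of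
  the joint parameter and with \<open>incidence\<close> as gradient; existence and uniqueness are
  both proved in this form.\<close>

lemma moment_solution_incidence:
  assumes n: "2 \<le> n" and y: "y \<in> carrier_vec p"
  shows "moment_solution n p Z d b y \<theta> \<gamma> \<longleftrightarrow> \<theta> \<in> carrier_vec (2 * n - 1) \<and> \<gamma> \<in> carrier_vec p \<and>
    (\<forall>k<2 * n - 1 + p. observed n d b y k
      = (\<Sum>e\<in>node_pairs n. incidence n (cov Z) k e * mu (lin_pred n Z \<theta> \<gamma> (fst e) (snd e))))"
proof -
  let ?f = "\<lambda>e. mu (lin_pred n Z \<theta> \<gamma> (fst e) (snd e))"
  let ?eq = "\<lambda>k. observed n d b y k = (\<Sum>e\<in>node_pairs n. incidence n (cov Z) k e * ?f e)"
  have out: "?eq i \<longleftrightarrow> d i = out_sum n (mean_edge n Z \<theta> \<gamma>) i" if "i < n" for i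
    using that by (simp add: observed_def incidence_row out_sum_def mean_edge_def)
  have inn: "?eq (n + j) \<longleftrightarrow> b j = in_sum n (mean_edge n Z \<theta> \<gamma>) j" if "j < n - 1" for j
    unfolding incidence_col[OF that] using that by (simp add: observed_def in_sum_def mean_edge_def)
  have obs_cov: "observed n d b y (2 * n - 1 + t) = y $ t" for t
  proof -
    have "\<not> 2 * n - 1 + t < 2 * n - 1" "\<not> 2 * n - 1 + t < n" using n by linarith+
    then show ?thesis by (simp only: observed_def) simp
  qed
  have inc_cov: "(\<Sum>e\<in>node_pairs n. incidence n (cov Z) (2 * n - 1 + t) e * ?f e)
      = cov_sum n p Z (mean_edge n Z \<theta> \<gamma>) $ t" if "t < p" for t
    using that incidence_cov[OF n, of "cov Z" t]
    by (auto simp: cov_sum_def mean_edge_def case_prod_beta intro!: sum.cong)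
  have cov: "(\<forall>t<p. ?eq (2 * n - 1 + t)) \<longleftrightarrow> y = cov_sum n p Z (mean_edge n Z \<theta> \<gamma>)"
  proof
    assume *: "\<forall>t<p. ?eq (2 * n - 1 + t)"
    show "y = cov_sum n p Z (mean_edge n Z \<theta> \<gamma>)"
    proof (rule eq_vecI)
      show dim: "dim_vec y = dim_vec (cov_sum n p Z (mean_edge n Z \<theta> \<gamma>))" using y by (simp add: cov_sum_def)
      fix t assume "t < dim_vec (cov_sum n p Z (mean_edge n Z \<theta> \<gamma>))"
      then have "t < p" by (simp add: cov_sum_def)
      then show "y $ t = cov_sum n p Z (mean_edge n Z \<theta> \<gamma>) $ t"
        using *[rule_format, of t] obs_cov[of t] inc_cov[of t] by simp
    qed
  next
    assume "y = cov_sum n p Z (mean_edge n Z \<theta> \<gamma>)"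
    then show "\<forall>t<p. ?eq (2 * n - 1 + t)" unfolding obs_cov using inc_cov by simp
  qed
  have all: "(\<forall>k<2 * n - 1 + p. G k) \<longleftrightarrow> (\<forall>i<n. G i) \<and> (\<forall>j<n - 1. G (n + j)) \<and> (\<forall>t<p. G (2 * n - 1 + t))" for G
  proof (intro iffI conjI allI impI)
    fix k assume *: "(\<forall>i<n. G i) \<and> (\<forall>j<n - 1. G (n + j)) \<and> (\<forall>t<p. G (2 * n - 1 + t))" and k: "k < 2 * n - 1 + p"
    consider "k < n" | "k - n < n - 1" "n + (k - n) = k" | "k - (2 * n - 1) < p" "2 * n - 1 + (k - (2 * n - 1)) = k"
      using k n by linarith
    then show "G k" using * by cases metis+
  qed (use n in auto)
  show ?thesis unfolding moment_solution_def all using out inn cov by auto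
qed

definition param_diff :: "nat \<Rightarrow> real vec \<Rightarrow> real vec \<Rightarrow> real vec \<Rightarrow> real vec \<Rightarrow> nat \<Rightarrow> real" where
  "param_diff n \<theta> \<gamma> \<theta>' \<gamma>' k = (if k < 2 * n - 1 then \<theta> $ k - \<theta>' $ k
     else \<gamma> $ (k - (2 * n - 1)) - \<gamma>' $ (k - (2 * n - 1)))"

lemma param_diff_cov: "2 \<le> n \<Longrightarrow> param_diff n \<theta> \<gamma> \<theta>' \<gamma>' (2 * n - 1 + t) = \<gamma> $ t - \<gamma>' $ t"
proof -
  have "\<not> 2 * n - 1 + t < 2 * n - 1" by linarith
  then show ?thesis by (simp only: param_diff_def) simp
qed

lemma lin_pred_diff:
  assumes D: "two_way_design n p (cov Z) q m \<Lambda> w L"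
    and "Z i j \<in> carrier_vec p" "\<gamma> \<in> carrier_vec p" "\<gamma>' \<in> carrier_vec p" "i < n"
  shows "lin_pred n Z \<theta> \<gamma> i j = lin_pred n Z \<theta>' \<gamma>' i j
    + two_way_design.pred n p (cov Z) (param_diff n \<theta> \<gamma> \<theta>' \<gamma>') i j"
proof -
  interpret D: two_way_design n p "cov Z" q m \<Lambda> w L by (rule D)
  have "(\<Sum>t<p. Z i j $ t * param_diff n \<theta> \<gamma> \<theta>' \<gamma>' (2 * n - 1 + t)) = Z i j \<bullet> \<gamma> - Z i j \<bullet> \<gamma>'"
    unfolding param_diff_cov[OF D.n]
    using assms by (simp add: scalar_prod_def lessThan_atLeast0 right_diff_distrib sum_subtractf)
  then show ?thesis
    using assms D.n unfolding D.pred_def by (auto simp: lin_pred_effect effect_def param_diff_def)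
qed

text \<open>Pair the difference of the two systems with the difference of the two solutions. Every
  summand is a product of an increment of the predictor and the increment of \<open>mu\<close>,
  hence nonnegative and zero only for equal predictors; \<open>pred_kernel\<close> passes from
  predictors to parameters. No closeness to the truth enters, so uniqueness is global.\<close>

lemma moment_solution_unique:
  assumes D: "two_way_design n p (cov Z) q m \<Lambda> w L"
    and Z: "\<And>i j. (i, j) \<in> node_pairs n \<Longrightarrow> Z i j \<in> carrier_vec p" and y: "y \<in> carrier_vec p"
    and S: "moment_solution n p Z d b y \<theta> \<gamma>" and S': "moment_solution n p Z d b y \<theta>' \<gamma>'"
  shows "\<theta> = \<theta>' \<and> \<gamma> = \<gamma>'"
proof -
  interpret D: two_way_design n p "cov Z" q m \<Lambda> w L by (rule D)
  note eqs = S[unfolded moment_solution_incidence[OF D.n y]] S'[unfolded moment_solution_incidence[OF D.n y]]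
  define u where "u = param_diff n \<theta> \<gamma> \<theta>' \<gamma>'"
  define x where "x e = lin_pred n Z \<theta> \<gamma> (fst e) (snd e)" for e
  define x' where "x' e = lin_pred n Z \<theta>' \<gamma>' (fst e) (snd e)" for e
  let ?P = "node_pairs n"
  have diff: "x e - x' e = (\<Sum>k<2 * n - 1 + p. incidence n (cov Z) k e * u k)" if "e \<in> ?P" for e
    using that lin_pred_diff[OF D, of "fst e" "snd e" \<gamma> \<gamma>' \<theta> \<theta>'] Z[of "fst e" "snd e"] eqs
      D.incidence_pred[of "fst e" "snd e" u]
    by (auto simp: x_def x'_def u_def node_pairs_def)
  have zero: "(\<Sum>e\<in>?P. incidence n (cov Z) k e * (mu (x e) - mu (x' e))) = 0" if "k < 2 * n - 1 + p" for k
    using eqs that by (auto simp: x_def x'_def right_diff_distrib sum_subtractf)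
  have "(\<Sum>e\<in>?P. (x e - x' e) * (mu (x e) - mu (x' e)))
      = (\<Sum>e\<in>?P. \<Sum>k<2 * n - 1 + p. u k * (incidence n (cov Z) k e * (mu (x e) - mu (x' e))))"
    by (intro sum.cong refl) (simp add: diff sum_distrib_left sum_distrib_right ac_simps)
  also have "\<dots> = (\<Sum>k<2 * n - 1 + p. u k * (\<Sum>e\<in>?P. incidence n (cov Z) k e * (mu (x e) - mu (x' e))))"
    by (subst sum.swap) (simp add: sum_distrib_left)
  also have "\<dots> = 0" using zero by simp
  finally have sum0: "(\<Sum>e\<in>?P. (x e - x' e) * (mu (x e) - mu (x' e))) = 0" .
  have pos: "0 < (s - t) * (mu s - mu t)" if "s \<noteq> t" for s t
    using that mu_strict_mono[of s t] mu_strict_mono[of t s]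
    by (cases "s < t") (auto intro: mult_pos_pos mult_neg_neg)
  then have nonneg: "0 \<le> (s - t) * (mu s - mu t)" for s t by (cases "s = t") (auto simp: less_imp_le)
  have "\<forall>e\<in>?P. (x e - x' e) * (mu (x e) - mu (x' e)) = 0"
    using sum0 nonneg by (subst (asm) sum_nonneg_eq_0_iff) auto
  then have eq: "x e = x' e" if "e \<in> ?P" for e using pos[of "x e" "x' e"] that by force
  have "D.pred u i j = 0" if "(i, j) \<in> ?P" for i j
    using diff[OF that] eq[OF that] that D.incidence_pred[of i j u] by (auto simp: node_pairs_def)
  then have u0: "u k = 0" if "k < 2 * n - 1 + p" for k using D.pred_kernel that by blast
  have "\<theta> $ k = \<theta>' $ k" if "k < 2 * n - 1" for k using u0[of k] that by (simp add: u_def param_diff_def)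
  moreover have "\<gamma> $ t = \<gamma>' $ t" if "t < p" for t
    using u0[of "2 * n - 1 + t"] that by (simp add: u_def param_diff_def)
  ultimately show ?thesis using eqs by (auto intro!: eq_vecI)
qed

text \<open>The deterministic half of existence. Here \<open>g\<close> is the observed statistic
  minus the fitted value at the truth, and all randomness is confined to the four bounds
  \<open>row\<close>, \<open>col\<close>, \<open>last\<close> and \<open>score\<close>.\<close>

lemma moment_solution_near_truth:
  fixes Z :: "nat \<Rightarrow> nat \<Rightarrow> real vec" and a :: "nat \<Rightarrow> nat \<Rightarrow> real" and ep em eta :: "nat \<Rightarrow> real"
    and \<Lambda> q m X B :: real and n p :: nat
  defines "A \<equiv> 1 / m ^ 3" and "P \<equiv> 1 + real p * q"
  defines "r \<equiv> 64 * A * P * (X / real n)"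
  assumes D: "two_way_design n p (cov Z) q m \<Lambda> (\<lambda>i j. mu_deriv (lin_pred n Z \<theta>s \<gamma>s i j)) L"
    and Z: "\<And>i j. (i, j) \<in> node_pairs n \<Longrightarrow> Z i j \<in> carrier_vec p"
    and \<theta>s: "\<theta>s \<in> carrier_vec (2 * n - 1)" and \<gamma>s: "\<gamma>s \<in> carrier_vec p" and p: "1 \<le> p"
    and X0: "0 \<le> X" and B0: "0 \<le> B" and r: "r \<le> 1 / 4"
    and \<eta>: "16 * (\<Lambda> * (real n)\<^sup>2) * r * q * A * P \<le> 1 / 4" and \<Lambda>B: "4 * (\<Lambda> * B) \<le> X / real n"
    and dev: "\<And>i j. dev i j = a i j - mu (lin_pred n Z \<theta>s \<gamma>s i j)"
    and row: "\<And>i. i < n \<Longrightarrow> \<bar>(\<Sum>j\<in>{..<n} - {i}. dev i j) + ep i\<bar> \<le> X"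
    and col: "\<And>j. j < n - 1 \<Longrightarrow> \<bar>(\<Sum>i\<in>{..<n} - {j}. dev i j) + em j\<bar> \<le> X"
    and last: "\<bar>(\<Sum>i\<in>{..<n} - {n - 1}. dev i (n - 1)) + (\<Sum>i<n. ep i) - (\<Sum>j<n - 1. em j)\<bar> \<le> X"
    and score: "\<And>s. s < p \<Longrightarrow>
      \<bar>(\<Sum>(i, j)\<in>node_pairs n. (Z i j $ s - effect n (L s) i j) * dev i j) + eta s
        - (\<Sum>i<n. L s i * ep i) - (\<Sum>j<n - 1. L s (n + j) * em j)\<bar> \<le> B"
  shows "\<exists>\<theta> \<gamma>. moment_solution n p Z (\<lambda>i. out_sum n a i + ep i) (\<lambda>j. in_sum n a j + em j)
        (cov_sum n p Z a + vec p eta) \<theta> \<gamma>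
      \<and> vec_norm_inf (\<theta> - \<theta>s) \<le> r
      \<and> vec_norm_inf (\<gamma> - \<gamma>s) \<le> 2 * (\<Lambda> * B) + 2 * (16 * (\<Lambda> * (real n)\<^sup>2) * r * q * A * P) * (X / real n)"
proof -
  interpret D: two_way_design n p "cov Z" q m \<Lambda> "\<lambda>i j. mu_deriv (lin_pred n Z \<theta>s \<gamma>s i j)" L by (rule D)
  note n = D.n
  define x0 where "x0 = lin_pred n Z \<theta>s \<gamma>s"
  have a_eq: "a i j = dev i j + mu (x0 i j)" for i j by (simp add: dev x0_def)
  define d where "d i = out_sum n a i + ep i" for i
  define b where "b j = in_sum n a j + em j" for j
  define y where "y = cov_sum n p Z a + vec p eta"
  have y: "y \<in> carrier_vec p" by (rule carrier_vecI) (simp add: y_def cov_sum_def)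
  define g where "g k = observed n d b y k - (\<Sum>e\<in>node_pairs n. incidence n (cov Z) k e * mu (x0 (fst e) (snd e)))" for k
  have g_out: "g i = (\<Sum>j\<in>{..<n} - {i}. dev i j) + ep i" if "i < n" for i
    unfolding g_def incidence_row[OF that] using that
    by (simp add: observed_def d_def out_sum_def a_eq sum.distrib)
  have g_in: "g (n + j) = (\<Sum>i\<in>{..<n} - {j}. dev i j) + em j" if "j < n - 1" for j
  proof -
    have "n + j < 2 * n - 1" using that by linarith
    then show ?thesis unfolding g_def incidence_col[OF that]
      by (simp add: observed_def b_def in_sum_def a_eq sum.distrib)
  qed
  have g_cov: "g (2 * n - 1 + s) = (\<Sum>(i, j)\<in>node_pairs n. Z i j $ s * dev i j) + eta s" if s: "s < p" for s
  proof -
    have "\<not> 2 * n - 1 + s < 2 * n - 1" "\<not> 2 * n - 1 + s < n" using n by linarith+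
    then have "observed n d b y (2 * n - 1 + s) = y $ s" by (simp only: observed_def) simp
    also have "y $ s = (\<Sum>(i, j)\<in>node_pairs n. Z i j $ s * a i j) + eta s"
      using s by (simp add: y_def cov_sum_def)
    finally have obs: "observed n d b y (2 * n - 1 + s) = (\<Sum>(i, j)\<in>node_pairs n. Z i j $ s * a i j) + eta s" .
    have "(\<Sum>e\<in>node_pairs n. incidence n (cov Z) (2 * n - 1 + s) e * mu (x0 (fst e) (snd e)))
        = (\<Sum>(i, j)\<in>node_pairs n. Z i j $ s * mu (x0 i j))"
    proof (rule sum.cong[OF refl])
      fix e show "incidence n (cov Z) (2 * n - 1 + s) e * mu (x0 (fst e) (snd e)) = (case e of (i, j) \<Rightarrow> Z i j $ s * mu (x0 i j))"
        using incidence_cov[OF n, of "cov Z" s "fst e" "snd e"] by (simp add: case_prod_beta)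
    qed
    then show ?thesis unfolding g_def obs
      by (simp add: a_eq case_prod_beta distrib_left sum.distrib)
  qed
  have g_le: "\<bar>g k\<bar> \<le> X" if "k < 2 * n - 1" for k
  proof (cases "k < n")
    case True
    then show ?thesis using row[OF True] by (simp add: g_out)
  next
    case False
    then have "k - n < n - 1" "n + (k - n) = k" using that by auto
    then show ?thesis using col[of "k - n"] g_in[of "k - n"] by simp
  qed
  have g_last: "\<bar>(\<Sum>i<n. g i) - (\<Sum>j<n - 1. g (n + j))\<bar> \<le> X"
  proof -
    have "(\<Sum>i<n. g i) - (\<Sum>j<n - 1. g (n + j))
        = ((\<Sum>i<n. \<Sum>j\<in>{..<n} - {i}. dev i j) - (\<Sum>j<n - 1. \<Sum>i\<in>{..<n} - {j}. dev i j))
          + (\<Sum>i<n. ep i) - (\<Sum>j<n - 1. em j)"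
      using g_out g_in by (simp add: sum.distrib)
    then show ?thesis using last last_column_sum[of n dev] n by simp
  qed
  have g_score: "\<bar>g (2 * n - 1 + s) - (\<Sum>i<n. L s i * g i) - (\<Sum>j<n - 1. L s (n + j) * g (n + j))\<bar> \<le> B"
    if s: "s < p" for s
  proof -
    have "(\<Sum>(i, j)\<in>node_pairs n. dev i j * effect n (L s) i j)
        = (\<Sum>i<n. L s i * (\<Sum>j\<in>{..<n} - {i}. dev i j))
          + (\<Sum>j<n - 1. L s (n + j) * (\<Sum>i\<in>{..<n} - {j}. dev i j))"
      by (rule D.sum_mult_effect)
    moreover have "(\<Sum>(i, j)\<in>node_pairs n. (Z i j $ s - effect n (L s) i j) * dev i j)
        = (\<Sum>(i, j)\<in>node_pairs n. Z i j $ s * dev i j)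
          - (\<Sum>(i, j)\<in>node_pairs n. dev i j * effect n (L s) i j)"
      by (simp add: case_prod_beta left_diff_distrib sum_subtractf mult.commute[of "dev _ _"])
    moreover have "(\<Sum>i<n. L s i * g i) = (\<Sum>i<n. L s i * (\<Sum>j\<in>{..<n} - {i}. dev i j)) + (\<Sum>i<n. L s i * ep i)"
      using g_out by (simp add: distrib_left sum.distrib)
    moreover have "(\<Sum>j<n - 1. L s (n + j) * g (n + j))
        = (\<Sum>j<n - 1. L s (n + j) * (\<Sum>i\<in>{..<n} - {j}. dev i j)) + (\<Sum>j<n - 1. L s (n + j) * em j)"
      using g_in by (simp add: distrib_left sum.distrib)
    ultimately show ?thesis using score[OF s] g_cov[OF s] by linarith
  qed
  have w_x0: "mu_deriv (lin_pred n Z \<theta>s \<gamma>s i j) = mu_deriv (x0 i j)" for i j by (simp add: x0_def)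
  obtain u where u: "\<forall>k<2 * n - 1 + p. (\<Sum>(i, j)\<in>node_pairs n.
          incidence n (cov Z) k (i, j) * (mu (x0 i j + D.pred u i j) - mu (x0 i j))) = g k"
    "\<forall>k<2 * n - 1. \<bar>u k\<bar> \<le> r"
    "\<forall>t<p. \<bar>u (2 * n - 1 + t)\<bar> \<le> 2 * (\<Lambda> * B) + 2 * (16 * (\<Lambda> * (real n)\<^sup>2) * r * q * A * P) * (X / real n)"
    using D.estimating_equations_solvable[of x0 X, folded A_def P_def, folded r_def,
        OF w_x0 X0 B0 r \<eta> \<Lambda>B g_le g_last g_score] by blast
  define \<theta> where "\<theta> = vec (2 * n - 1) (\<lambda>k. \<theta>s $ k + u k)"
  define \<gamma> where "\<gamma> = vec p (\<lambda>t. \<gamma>s $ t + u (2 * n - 1 + t))"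
  have carr: "\<theta> \<in> carrier_vec (2 * n - 1)" "\<gamma> \<in> carrier_vec p" by (auto simp: \<theta>_def \<gamma>_def)
  have pred: "lin_pred n Z \<theta> \<gamma> i j = x0 i j + D.pred u i j" if ij: "(i, j) \<in> node_pairs n" for i j
  proof -
    have ij': "i < n" "j < n" using ij by (auto simp: node_pairs_def)
    have "(\<Sum>t<p. Z i j $ t * param_diff n \<theta> \<gamma> \<theta>s \<gamma>s (2 * n - 1 + t)) = (\<Sum>t<p. Z i j $ t * u (2 * n - 1 + t))"
      unfolding param_diff_cov[OF n] by (simp add: \<gamma>_def)
    moreover have "effect n (param_diff n \<theta> \<gamma> \<theta>s \<gamma>s) i j = effect n u i j"
      using ij' by (auto simp: effect_def param_diff_def \<theta>_def)
    ultimately have "D.pred (param_diff n \<theta> \<gamma> \<theta>s \<gamma>s) i j = D.pred u i j" by (simp only: D.pred_def)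
    then show ?thesis
      using lin_pred_diff[OF D Z[OF ij] carr(2) \<gamma>s ij'(1), of \<theta> \<theta>s] by (simp only: x0_def)
  qed
  have "observed n d b y k = (\<Sum>e\<in>node_pairs n. incidence n (cov Z) k e * mu (lin_pred n Z \<theta> \<gamma> (fst e) (snd e)))"
    if k: "k < 2 * n - 1 + p" for k
  proof -
    have "(\<Sum>(i, j)\<in>node_pairs n. incidence n (cov Z) k (i, j) * (mu (x0 i j + D.pred u i j) - mu (x0 i j)))
        = (\<Sum>e\<in>node_pairs n. incidence n (cov Z) k e * mu (lin_pred n Z \<theta> \<gamma> (fst e) (snd e)))
          - (\<Sum>e\<in>node_pairs n. incidence n (cov Z) k e * mu (x0 (fst e) (snd e)))"
      unfolding sum_subtractf[symmetric] by (rule sum.cong) (auto simp: pred right_diff_distrib)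
    then show ?thesis using u(1) k by (simp add: g_def)
  qed
  then have "moment_solution n p Z d b y \<theta> \<gamma>"
    using carr by (simp add: moment_solution_incidence[OF n y])
  moreover have "vec_norm_inf (\<theta> - \<theta>s) \<le> r"
    using \<theta>s n u(2) by (intro vec_norm_inf_le) (auto simp: \<theta>_def)
  moreover have "vec_norm_inf (\<gamma> - \<gamma>s) \<le> 2 * (\<Lambda> * B) + 2 * (16 * (\<Lambda> * (real n)\<^sup>2) * r * q * A * P) * (X / real n)"
    using \<gamma>s p u(3) by (intro vec_norm_inf_le) (auto simp: \<gamma>_def)
  ultimately show ?thesis unfolding d_def[abs_def] b_def[abs_def] y_def by blast
qed

text \<open>Joins the deterministic statement to the good event: in the projected score the edges
  have the residuals as coefficients, the node noises \<open>- L s\<close>. \<open>x\<close> is the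
  degree error divided by n and \<open>B\<close> the level of the score.\<close>

lemma network_solution:
  fixes M :: "'w measure" and Z :: "nat \<Rightarrow> nat \<Rightarrow> real vec" and K \<Lambda> q m \<epsilon> :: real and n p :: nat
  defines "A \<equiv> 1 / m ^ 3" and "P \<equiv> 1 + real p * q"
    and "x \<equiv> 2 * (1 + 8 / \<epsilon>) * sqrt (real n * ln (real n)) / real n"
  defines "r \<equiv> 64 * A * P * x" and "B \<equiv> K * (2 + real p) * q * real n * A * (1 + 8 / \<epsilon>)"
  assumes N: "noisy_network M n p (\<lambda>i j. mu (lin_pred n Z \<theta>s \<gamma>s i j)) a ep em eta \<epsilon> (real p * q / \<epsilon>)"
    and D: "two_way_design n p (cov Z) q m \<Lambda> (\<lambda>i j. mu_deriv (lin_pred n Z \<theta>s \<gamma>s i j)) L"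
    and Z: "\<And>i j. (i, j) \<in> node_pairs n \<Longrightarrow> Z i j \<in> carrier_vec p"
    and \<theta>s: "\<theta>s \<in> carrier_vec (2 * n - 1)" and \<gamma>s: "\<gamma>s \<in> carrier_vec p"
    and n3: "3 \<le> n" and p: "1 \<le> p" and q: "0 < q" and K: "0 < K" and r: "r \<le> 1 / 4"
    and \<eta>: "16 * (\<Lambda> * (real n)\<^sup>2) * r * q * A * P \<le> 1 / 4" and \<Lambda>B: "4 * (\<Lambda> * B) \<le> x"
  shows "\<exists>E\<in>sets M. 1 - (4 / real n + 8 / ln (real n) + real p * (1 / K\<^sup>2 + exp (- K))) \<le> measure M E \<and>
    (\<forall>\<omega>\<in>E. \<exists>\<theta> \<gamma>. moment_solution n p Z
        (\<lambda>i. out_sum n (\<lambda>i j. a i j \<omega>) i + real_of_int (ep i \<omega>))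
        (\<lambda>j. in_sum n (\<lambda>i j. a i j \<omega>) j + real_of_int (em j \<omega>))
        (cov_sum n p Z (\<lambda>i j. a i j \<omega>) + vec p (\<lambda>t. eta t \<omega>)) \<theta> \<gamma>
      \<and> vec_norm_inf (\<theta> - \<theta>s) \<le> r
      \<and> vec_norm_inf (\<gamma> - \<gamma>s) \<le> 2 * (\<Lambda> * B) + 2 * (16 * (\<Lambda> * (real n)\<^sup>2) * r * q * A * P) * x)"
proof -
  interpret N: noisy_network M n p "\<lambda>i j. mu (lin_pred n Z \<theta>s \<gamma>s i j)" a ep em eta \<epsilon> "real p * q / \<epsilon>" by (rule N)
  interpret D: two_way_design n p "cov Z" q m \<Lambda> "\<lambda>i j. mu_deriv (lin_pred n Z \<theta>s \<gamma>s i j)" L by (rule D)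
  note n = D.n
  have et: "1 + 8 / \<epsilon> = N.\<epsilon>t" by (simp add: N.\<epsilon>t_def)
  have n1: "1 \<le> real n" using n by simp
  have A: "1 \<le> A"
  proof -
    have "m \<le> 1 / 4" using D.w[of 0 1] n by simp
    then have "m ^ 3 \<le> 1" using D.m by (intro power_le_one) auto
    then show ?thesis using D.m by (simp add: A_def)
  qed
  \<comment> \<open>The edge part of the variance is at most (q n)^2 / 4 by
    \<open>D.\<zeta>_norm\<close>, as the weights are the edge variances; the noise part has fewer
    than 2 n coefficients of size at most q A / 2. Both lie below the square of half of
    \<open>V\<close>.\<close>
  define V where "V = 2 * q * real n * A * N.\<epsilon>t"
  have V0: "0 < V" using q n1 A N.\<epsilon>t(1) by (simp add: V_def)
  have V: "N.form_var (D.\<zeta> s) (\<lambda>k. - L s k) \<le> V\<^sup>2" if s: "s < p" for s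
  proof -
    have Lsq: "(L s k)\<^sup>2 \<le> (q * A / 2)\<^sup>2" if "k < 2 * n - 1" for k
      using power_mono[OF D.L_bound[OF s that], of 2] by (simp add: A_def mult.commute)
    have "(\<Sum>(i, j)\<in>node_pairs n. (D.\<zeta> s i j)\<^sup>2 * (mu (lin_pred n Z \<theta>s \<gamma>s i j) * (1 - mu (lin_pred n Z \<theta>s \<gamma>s i j))))
        \<le> q\<^sup>2 * (real n)\<^sup>2 / 4"
      using D.\<zeta>_norm[OF s] by (simp add: mu_deriv_def mult.commute)
    also have "\<dots> \<le> (q * real n * A * N.\<epsilon>t)\<^sup>2"
    proof -
      have "1 * 1 \<le> A * N.\<epsilon>t" using A N.\<epsilon>t(1) by (intro mult_mono) auto
      then have "q * real n * 1 \<le> q * real n * (A * N.\<epsilon>t)" using q by (intro mult_left_mono) auto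
      then have "(q * real n)\<^sup>2 \<le> (q * real n * (A * N.\<epsilon>t))\<^sup>2" using q by (intro power_mono) auto
      moreover have "q\<^sup>2 * (real n)\<^sup>2 / 4 \<le> (q * real n)\<^sup>2" by (simp add: power_mult_distrib)
      ultimately show ?thesis by (simp add: mult.assoc)
    qed
    finally have 1: "(\<Sum>(i, j)\<in>node_pairs n. (D.\<zeta> s i j)\<^sup>2 * (mu (lin_pred n Z \<theta>s \<gamma>s i j) * (1 - mu (lin_pred n Z \<theta>s \<gamma>s i j))))
        \<le> (q * real n * A * N.\<epsilon>t)\<^sup>2" .
    have "(\<Sum>i<n. (- L s i)\<^sup>2) + (\<Sum>j<n - 1. (- L s (n + j))\<^sup>2)
        \<le> (\<Sum>i<n. (q * A / 2)\<^sup>2) + (\<Sum>j<n - 1. (q * A / 2)\<^sup>2)"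
      using Lsq by (intro add_mono sum_mono) auto
    also have "\<dots> = (real n + real (n - 1)) * (q * A / 2)\<^sup>2" by (simp add: algebra_simps)
    also have "\<dots> \<le> (2 * (real n)\<^sup>2) * (q * A / 2)\<^sup>2"
    proof (rule mult_right_mono)
      have "real n * 1 \<le> real n * real n" using n1 by (intro mult_left_mono) auto
      moreover have "real (n - 1) \<le> real n" by simp
      ultimately show "real n + real (n - 1) \<le> 2 * (real n)\<^sup>2" unfolding power2_eq_square by linarith
    qed simp
    finally have "2 * N.\<epsilon>t\<^sup>2 * ((\<Sum>i<n. (- L s i)\<^sup>2) + (\<Sum>j<n - 1. (- L s (n + j))\<^sup>2))
        \<le> 2 * N.\<epsilon>t\<^sup>2 * ((2 * (real n)\<^sup>2) * (q * A / 2)\<^sup>2)" by (rule mult_left_mono) simp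
    also have "\<dots> = (q * real n * A * N.\<epsilon>t)\<^sup>2" by (simp add: power_mult_distrib power_divide)
    finally have 2: "2 * N.\<epsilon>t\<^sup>2 * ((\<Sum>i<n. (- L s i)\<^sup>2) + (\<Sum>j<n - 1. (- L s (n + j))\<^sup>2))
        \<le> (q * real n * A * N.\<epsilon>t)\<^sup>2" .
    have "N.form_var (D.\<zeta> s) (\<lambda>k. - L s k) \<le> 2 * (q * real n * A * N.\<epsilon>t)\<^sup>2"
      unfolding N.form_var_def using 1 2 by linarith
    also have "\<dots> \<le> V\<^sup>2" by (simp add: V_def power_mult_distrib)
    finally show ?thesis .
  qed
  \<comment> \<open>The continuous noise has scale p q / \<epsilon>, at most p q times
    \<open>N.\<epsilon>t\<close>; it accounts for the summand p in the factor 2 + p of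
    \<open>B\<close>.\<close>
  have B_ge: "K * V + K * (real p * q / \<epsilon>) \<le> B"
  proof -
    have "1 / \<epsilon> \<le> N.\<epsilon>t" using N.\<epsilon> by (simp add: N.\<epsilon>t_def field_simps)
    then have "real p * q * (1 / \<epsilon>) \<le> real p * q * N.\<epsilon>t" using q by (intro mult_left_mono) auto
    also have "\<dots> \<le> real p * q * N.\<epsilon>t * (real n * A)"
    proof -
      have "1 * 1 \<le> real n * A" using n1 A by (intro mult_mono) auto
      then have "real p * q * N.\<epsilon>t * 1 \<le> real p * q * N.\<epsilon>t * (real n * A)"
        using q N.\<epsilon>t(1) by (intro mult_left_mono) auto
      then show ?thesis by simp
    qed
    finally have "V + real p * q / \<epsilon> \<le> (2 + real p) * q * real n * A * N.\<epsilon>t"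
      by (simp add: V_def algebra_simps)
    then have "K * (V + real p * q / \<epsilon>) \<le> K * ((2 + real p) * q * real n * A * N.\<epsilon>t)"
      using K by (intro mult_left_mono) auto
    then show ?thesis by (simp add: B_def et algebra_simps)
  qed
  define X where "X = 2 * N.\<epsilon>t * sqrt (real n * ln (real n))"
  have x: "x = X / real n" by (simp add: x_def X_def et)
  have ln: "1 \<le> ln (real n)" by (rule ln_ge_1[OF n3])
  have X0: "0 \<le> X" using ln n1 N.\<epsilon>t(1) by (simp add: X_def)
  have B0: "0 \<le> B" unfolding B_def et using K q A N.\<epsilon>t(1) by (intro mult_nonneg_nonneg) auto
  show ?thesis
  proof (rule N.good_event[where c = D.\<zeta> and l = "\<lambda>s k. - L s k", OF n3 K V0, folded X_def])
    show "N.form_var (D.\<zeta> s) (\<lambda>k. - L s k) \<le> V\<^sup>2" if "s < p" for s by (rule V[OF that])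
  next
    fix E assume E: "E \<in> sets M"
      "1 - (4 / real n + 8 / ln (real n) + real p * (1 / K\<^sup>2 + exp (- K))) \<le> measure M E"
      "\<And>\<omega> i. \<omega> \<in> E \<Longrightarrow> i < n \<Longrightarrow> \<bar>(\<Sum>j\<in>{..<n} - {i}. N.dev \<omega> i j) + real_of_int (ep i \<omega>)\<bar> \<le> X"
      "\<And>\<omega> j. \<omega> \<in> E \<Longrightarrow> j < n - 1 \<Longrightarrow> \<bar>(\<Sum>i\<in>{..<n} - {j}. N.dev \<omega> i j) + real_of_int (em j \<omega>)\<bar> \<le> X"
      "\<And>\<omega>. \<omega> \<in> E \<Longrightarrow> \<bar>(\<Sum>i\<in>{..<n} - {n - 1}. N.dev \<omega> i (n - 1)) + (\<Sum>i<n. real_of_int (ep i \<omega>))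
           - (\<Sum>j<n - 1. real_of_int (em j \<omega>))\<bar> \<le> X"
      "\<And>\<omega> s. \<omega> \<in> E \<Longrightarrow> s < p \<Longrightarrow>
      \<bar>N.linear_form (D.\<zeta> s) (\<lambda>k. - L s k) \<omega> + eta s \<omega>\<bar> \<le> K * V + K * (real p * q / \<epsilon>)"
    have "\<exists>\<theta> \<gamma>. moment_solution n p Z
        (\<lambda>i. out_sum n (\<lambda>i j. a i j \<omega>) i + real_of_int (ep i \<omega>))
        (\<lambda>j. in_sum n (\<lambda>i j. a i j \<omega>) j + real_of_int (em j \<omega>))
        (cov_sum n p Z (\<lambda>i j. a i j \<omega>) + vec p (\<lambda>t. eta t \<omega>)) \<theta> \<gamma>
      \<and> vec_norm_inf (\<theta> - \<theta>s) \<le> r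
      \<and> vec_norm_inf (\<gamma> - \<gamma>s) \<le> 2 * (\<Lambda> * B) + 2 * (16 * (\<Lambda> * (real n)\<^sup>2) * r * q * A * P) * x"
      if \<omega>: "\<omega> \<in> E" for \<omega>
      unfolding r_def x A_def P_def
    proof (rule moment_solution_near_truth[where dev = "N.dev \<omega>", OF D Z \<theta>s \<gamma>s p X0 B0])
      fix s assume s: "s < p"
      have "N.linear_form (D.\<zeta> s) (\<lambda>k. - L s k) \<omega> + eta s \<omega>
          = (\<Sum>(i, j)\<in>node_pairs n. (Z i j $ s - effect n (L s) i j) * N.dev \<omega> i j) + eta s \<omega>
            - (\<Sum>i<n. L s i * real_of_int (ep i \<omega>)) - (\<Sum>j<n - 1. L s (n + j) * real_of_int (em j \<omega>))"
        by (simp add: N.linear_form_def D.\<zeta>_def sum_negf)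
      then show "\<bar>(\<Sum>(i, j)\<in>node_pairs n. (Z i j $ s - effect n (L s) i j) * N.dev \<omega> i j) + eta s \<omega>
            - (\<Sum>i<n. L s i * real_of_int (ep i \<omega>)) - (\<Sum>j<n - 1. L s (n + j) * real_of_int (em j \<omega>))\<bar> \<le> B"
        using E(6)[OF \<omega> s] B_ge by linarith
    qed (use E(3,4,5)[OF \<omega>] r \<eta> \<Lambda>B in \<open>simp_all add: N.dev_def r_def x A_def P_def\<close>)
    then show ?thesis using E(1,2) by blast
  qed
qed

section \<open>Rates\<close>

text \<open>The numbers follow from \<open>m\<close>: it gives A = 64 exp(3 \<rho>), and with x = 2
  s the radius is r = 64 * 64 * 2 P exp(3 \<rho>) s, hence 8192, and 32768 = 4 * 8192 for r <= 1 /
  4. The feedback factor has 16 * 8192 * 64 = 8388608, and doubling it and multiplying by x gives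
  four times as much. In \<open>B\<close> the 64 of A becomes 128 by the doubling of the score
  term.\<close>

lemma rate_inequalities:
  fixes \<rho> e lam N l P q K c s :: real
  defines "m \<equiv> exp (- \<rho>) / 4"
  defines "A \<equiv> 1 / m ^ 3" and "x \<equiv> 2 * e * sqrt (N * l) / N"
  defines "r \<equiv> 64 * A * P * x" and "B \<equiv> K * c * q * N * A * e" and "\<Lambda> \<equiv> lam / N\<^sup>2"
    and "s \<equiv> e * sqrt (l / N)"
  assumes \<rho>: "0 \<le> \<rho>" and e: "1 \<le> e" and lam: "0 \<le> lam" and N: "3 \<le> N" and l: "1 \<le> l"
    and P: "1 \<le> P" and q: "0 \<le> q" and K: "0 \<le> K" and c: "0 \<le> c"
    and t1: "exp (6 * \<rho>) * s \<le> 1 / (32768 * P)"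
    and t2: "8388608 * q * P\<^sup>2 * (lam * exp (9 * \<rho>) * s) \<le> 1 / 4" "128 * K * c * q * (lam * exp (9 * \<rho>) * s) \<le> 1"
    and varpi: "exp (9 * \<rho>) * e\<^sup>2 \<le> varpi"
  shows "1 \<le> 2 * m\<^sup>2 * (N - 1)" "r \<le> 1 / 4" "16 * (\<Lambda> * N\<^sup>2) * r * q * A * P \<le> 1 / 4" "4 * (\<Lambda> * B) \<le> x"
    and "r = 8192 * P * (exp (3 * \<rho>) * e * sqrt (l / N))"
    and "2 * (\<Lambda> * B) + 2 * (16 * (\<Lambda> * N\<^sup>2) * r * q * A * P) * x
      \<le> (128 * K * c * q + 33554432 * q * P\<^sup>2) * (varpi * lam * l / N)"
proof -
  have N0: "0 < N" using N by simp
  have A: "A = 64 * exp (3 * \<rho>)"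
    by (simp add: A_def m_def power_divide field_simps flip: exp_of_nat_mult exp_add)
  have sq: "sqrt (N * l) / N = sqrt (l / N)"
    using N0 by (simp add: real_sqrt_mult real_sqrt_divide field_simps)
  have x: "x = 2 * s" unfolding x_def s_def using sq by (metis mult.assoc times_divide_eq_right)
  have s0: "0 < s" using e l N0 by (simp add: s_def)
  have s2: "s\<^sup>2 = e\<^sup>2 * l / N" using l N0 by (simp add: s_def power_mult_distrib)
  have ex: "exp (j * \<rho>) \<le> exp (k * \<rho>)" if "j \<le> k" for j k using that \<rho> by (simp add: mult_right_mono)
  show r_eq: "r = 8192 * P * (exp (3 * \<rho>) * e * sqrt (l / N))"
    by (simp add: r_def A x s_def)
  have r_s: "r = 8192 * P * (exp (3 * \<rho>) * s)" by (simp add: r_def A x)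
  show "r \<le> 1 / 4"
  proof -
    have "exp (3 * \<rho>) * s \<le> exp (6 * \<rho>) * s" using ex[of 3 6] s0 by (intro mult_right_mono) auto
    then have "exp (3 * \<rho>) * s \<le> 1 / (32768 * P)" using t1 by linarith
    then have "8192 * P * (exp (3 * \<rho>) * s) \<le> 8192 * P * (1 / (32768 * P))" using P by (intro mult_left_mono) auto
    also have "\<dots> = 1 / 4" using P by simp
    finally show ?thesis by (simp add: r_s)
  qed
  show "1 \<le> 2 * m\<^sup>2 * (N - 1)"
  proof -
    \<comment> \<open>Squared, this bounds exp(12 \<rho>) by N / 16, hence also exp(2 \<rho>), which
      is 1 / \<open>m\<close>^2 up to the factor 16.\<close>
    have "exp (6 * \<rho>) * s \<le> 1 / 4"
    proof -
      have "1 / (32768 * P) \<le> 1 / 4" using P by (simp add: field_simps)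
      then show ?thesis using t1 by linarith
    qed
    then have "(exp (6 * \<rho>) * s)\<^sup>2 \<le> (1 / 4)\<^sup>2" using s0 by (intro power_mono) auto
    then have "(exp (6 * \<rho>))\<^sup>2 * (e\<^sup>2 * l / N) \<le> (1 / 4)\<^sup>2" by (simp only: power_mult_distrib s2)
    then have "(exp (6 * \<rho>))\<^sup>2 * (e\<^sup>2 * l / N) * N \<le> (1 / 4)\<^sup>2 * N" using N0 by (intro mult_right_mono) auto
    moreover have "(exp (6 * \<rho>))\<^sup>2 * (e\<^sup>2 * l / N) * N = (exp (6 * \<rho>))\<^sup>2 * (e\<^sup>2 * l)" using N0 by simp
    moreover have "(1 / 4)\<^sup>2 * N = N / 16" by (simp add: power2_eq_square)
    ultimately have a: "(exp (6 * \<rho>))\<^sup>2 * (e\<^sup>2 * l) \<le> N / 16" by linarith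
    have "1 * 1 \<le> e\<^sup>2 * l" using e l by (intro mult_mono) auto
    then have "(exp (6 * \<rho>))\<^sup>2 * 1 \<le> (exp (6 * \<rho>))\<^sup>2 * (e\<^sup>2 * l)" by (intro mult_left_mono) auto
    moreover have "(exp (6 * \<rho>))\<^sup>2 = exp (12 * \<rho>)" by (simp add: power2_eq_square flip: exp_add)
    ultimately have "exp (2 * \<rho>) \<le> N / 16" using a ex[of 2 12] by linarith
    then have "8 * exp (2 * \<rho>) \<le> N - 1" using N by linarith
    then have "8 * exp (2 * \<rho>) * exp (- 2 * \<rho>) \<le> (N - 1) * exp (- 2 * \<rho>)" by (rule mult_right_mono) simp
    then have "8 \<le> (N - 1) * exp (- 2 * \<rho>)" by (simp flip: exp_add add: mult.assoc)
    moreover have "m\<^sup>2 = exp (- 2 * \<rho>) / 16" by (simp add: m_def power_divide power2_eq_square flip: exp_add)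
    then have "2 * m\<^sup>2 * (N - 1) = (N - 1) * exp (- 2 * \<rho>) / 8" by simp
    ultimately show ?thesis by linarith
  qed
  have \<Lambda>N: "\<Lambda> * N\<^sup>2 = lam" using N0 by (simp add: \<Lambda>_def)
  have e36: "exp (3 * \<rho>) * exp (3 * \<rho>) = exp (6 * \<rho>)" by (simp flip: exp_add)
  have \<eta>: "16 * (\<Lambda> * N\<^sup>2) * r * q * A * P = 8388608 * q * P\<^sup>2 * (lam * exp (6 * \<rho>) * s)"
    unfolding \<Lambda>N r_s A e36[symmetric] by (simp add: power2_eq_square)
  have \<eta>_nonneg: "0 \<le> 8388608 * q * P\<^sup>2" using q by simp
  show "16 * (\<Lambda> * N\<^sup>2) * r * q * A * P \<le> 1 / 4"
  proof -
    have "lam * exp (6 * \<rho>) * s \<le> lam * exp (9 * \<rho>) * s"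
      using ex[of 6 9] lam s0 by (intro mult_right_mono mult_left_mono) auto
    then show ?thesis unfolding \<eta> using t2(1) \<eta>_nonneg mult_left_mono order_trans by blast
  qed
  have \<Lambda>B: "\<Lambda> * B = 64 * K * c * q * (lam * exp (3 * \<rho>) * (e / N))"
    using N0 by (simp add: \<Lambda>_def B_def A power2_eq_square field_simps)
  have Kcq: "0 \<le> K * c * q" using K c q by simp
  \<comment> \<open>The score term is of order e / N and so of second order in s, because
    \<open>e\<close> and \<open>l\<close> are at least 1; one factor s goes into \<open>t2\<close>,
    the other is compared with \<open>x\<close>.\<close>
  have eN: "e / N \<le> s\<^sup>2"
  proof -
    have "e * 1 \<le> e * (e * l)" using e l mult_mono[of 1 e 1 l] by (intro mult_left_mono) auto
    then show ?thesis unfolding s2 using N0 by (simp add: divide_right_mono power2_eq_square mult.assoc)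
  qed
  show "4 * (\<Lambda> * B) \<le> x"
  proof -
    have "lam * exp (3 * \<rho>) * (e / N) \<le> lam * exp (9 * \<rho>) * s\<^sup>2"
      using eN ex[of 3 9] lam e N0 by (intro mult_mono) auto
    then have "K * c * q * (lam * exp (3 * \<rho>) * (e / N)) \<le> K * c * q * (lam * exp (9 * \<rho>) * s\<^sup>2)"
      using Kcq by (rule mult_left_mono)
    moreover have "4 * (\<Lambda> * B) = 256 * (K * c * q * (lam * exp (3 * \<rho>) * (e / N)))" by (simp add: \<Lambda>B)
    moreover have "2 * (128 * K * c * q * (lam * exp (9 * \<rho>) * s)) * s
        = 256 * (K * c * q * (lam * exp (9 * \<rho>) * s\<^sup>2))" by (simp add: power2_eq_square)
    ultimately have "4 * (\<Lambda> * B) \<le> 2 * (128 * K * c * q * (lam * exp (9 * \<rho>) * s)) * s" by linarith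
    also have "\<dots> \<le> 2 * 1 * s" by (intro mult_right_mono mult_left_mono t2(2)) (use s0 in auto)
    finally show ?thesis by (simp add: x)
  qed
  have R_nonneg: "0 \<le> lam * l / N" using lam l N0 by simp
  have "\<Lambda> * B * 2 \<le> 128 * K * c * q * (varpi * (lam * l / N))"
  proof -
    have "exp (3 * \<rho>) * e \<le> exp (9 * \<rho>) * e\<^sup>2"
      using ex[of 3 9] e mult_left_mono[of 1 e e] by (intro mult_mono) (auto simp: power2_eq_square)
    then have v: "exp (3 * \<rho>) * e \<le> varpi" using varpi by simp
    have "lam / N \<le> lam * l / N" using lam l N0 by (simp add: divide_right_mono mult_le_cancel_left1)
    then have "(exp (3 * \<rho>) * e) * (lam / N) \<le> varpi * (lam * l / N)"
      using v lam N0 e order_trans[OF _ v, of 0] by (intro mult_mono) auto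
    then have "128 * (K * c * q) * ((exp (3 * \<rho>) * e) * (lam / N)) \<le> 128 * (K * c * q) * (varpi * (lam * l / N))"
      using Kcq by (intro mult_left_mono) auto
    then show ?thesis unfolding \<Lambda>B by (simp add: ac_simps)
  qed
  moreover have "2 * (16 * (\<Lambda> * N\<^sup>2) * r * q * A * P) * x \<le> 33554432 * q * P\<^sup>2 * (varpi * (lam * l / N))"
  proof -
    have "exp (6 * \<rho>) * e\<^sup>2 \<le> varpi"
      using order_trans[OF mult_right_mono[OF ex[of 6 9], of "e\<^sup>2"] varpi] by simp
    then have "(exp (6 * \<rho>) * e\<^sup>2) * (lam * l / N) \<le> varpi * (lam * l / N)" using R_nonneg by (rule mult_right_mono)
    moreover have "lam * exp (6 * \<rho>) * s\<^sup>2 = (exp (6 * \<rho>) * e\<^sup>2) * (lam * l / N)" unfolding s2 by simp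
    ultimately have le: "lam * exp (6 * \<rho>) * s\<^sup>2 \<le> varpi * (lam * l / N)" by simp
    have "2 * (16 * (\<Lambda> * N\<^sup>2) * r * q * A * P) * x = 33554432 * q * P\<^sup>2 * (lam * exp (6 * \<rho>) * s\<^sup>2)"
      unfolding \<eta> x by (simp add: power2_eq_square)
    also have "\<dots> \<le> 33554432 * q * P\<^sup>2 * (varpi * (lam * l / N))" using le q by (intro mult_left_mono) auto
    finally show ?thesis .
  qed
  ultimately have "2 * (\<Lambda> * B) + 2 * (16 * (\<Lambda> * N\<^sup>2) * r * q * A * P) * x
      \<le> 128 * K * c * q * (varpi * (lam * l / N)) + 33554432 * q * P\<^sup>2 * (varpi * (lam * l / N))"
    by linarith
  also have "\<dots> = (128 * K * c * q + 33554432 * q * P\<^sup>2) * (varpi * lam * l / N)"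
    by (simp add: algebra_simps)
  finally show "2 * (\<Lambda> * B) + 2 * (16 * (\<Lambda> * N\<^sup>2) * r * q * A * P) * x
      \<le> (128 * K * c * q + 33554432 * q * P\<^sup>2) * (varpi * lam * l / N)" .
qed

text \<open>The hypothesis supplies a different event for each \<delta>, the conclusion asks for one
  sequence. For every n an event is taken whose measure is within 1 / (n + 1) of the supremum over
  all admissible events; it does nearly as well as the event for any \<delta>.\<close>

lemma with_prob_tending_to_oneI:
  assumes prob: "\<And>n. k \<le> n \<Longrightarrow> prob_space (M n)"
    and ev: "\<And>\<delta>. 0 < \<delta> \<Longrightarrow> \<forall>\<^sub>F n in sequentially. \<exists>E\<in>sets (M n). 1 - \<delta> \<le> measure (M n) E \<and> (\<forall>\<omega>\<in>E. P n \<omega>)"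
  shows "with_prob_tending_to_one M P"
proof -
  define good where "good n E \<longleftrightarrow> E \<in> sets (M n) \<and> (\<forall>\<omega>\<in>E. P n \<omega>)" for n E
  define top where "top n = Sup (measure (M n) ` Collect (good n))" for n
  have "\<exists>E. good n E \<and> (k \<le> n \<longrightarrow> (\<forall>E'. good n E' \<longrightarrow> measure (M n) E' \<le> measure (M n) E + 1 / real (Suc n)))" for n
  proof (cases "k \<le> n")
    case True
    interpret prob_space "M n" by (rule prob[OF True])
    have ne: "measure (M n) ` Collect (good n) \<noteq> {}" by (auto simp: good_def)
    have bdd: "bdd_above (measure (M n) ` Collect (good n))" by (rule bdd_aboveI[of _ 1]) auto
    obtain E where E: "good n E" "top n - 1 / real (Suc n) < measure (M n) E"
      using less_cSup_iff[OF ne bdd, of "top n - 1 / real (Suc n)"] by (auto simp: top_def)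
    have "measure (M n) E' \<le> top n" if "good n E'" for E'
      unfolding top_def using that by (intro cSup_upper bdd) auto
    then show ?thesis using E by (intro exI[of _ E]) (auto intro: order_trans[of _ "top n"])
  next
    case False
    \<comment> \<open>Below \<open>k\<close> nothing is known about \<open>M n\<close>; the empty
      event is admissible in any measure space.\<close>
    then show ?thesis by (intro exI[of _ "{}"]) (auto simp: good_def)
  qed
  then obtain E where E: "\<And>n. good n (E n)"
    "\<And>n E'. k \<le> n \<Longrightarrow> good n E' \<Longrightarrow> measure (M n) E' \<le> measure (M n) (E n) + 1 / real (Suc n)"
    by metis
  have "(\<lambda>n. measure (M n) (E n)) \<longlonglongrightarrow> 1"
  proof (rule LIMSEQ_I)
    fix r :: real assume r: "0 < r"
    have "\<forall>\<^sub>F n in sequentially. 1 / real (Suc n) < r / 2"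
      using order_tendstoD(2)[OF LIMSEQ_inverse_real_of_nat, of "r / 2"] r by (simp add: inverse_eq_divide)
    moreover have "\<forall>\<^sub>F n in sequentially. \<exists>E\<in>sets (M n). 1 - r / 4 \<le> measure (M n) E \<and> (\<forall>\<omega>\<in>E. P n \<omega>)"
      using r by (intro ev) simp
    ultimately have "\<forall>\<^sub>F n in sequentially. norm (measure (M n) (E n) - 1) < r"
      using eventually_ge_at_top[of k]
    proof eventually_elim
      case (elim n)
      interpret prob_space "M n" by (rule prob) (use elim in simp)
      obtain E' where "good n E'" "1 - r / 4 \<le> measure (M n) E'" using elim by (auto simp: good_def)
      then have "1 - r / 4 \<le> measure (M n) (E n) + 1 / real (Suc n)" using E(2) elim by (meson order_trans)
      then have "\<bar>measure (M n) (E n) - 1\<bar> < r" using elim r prob_le_1[of "E n"] by linarith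
      then show ?case by simp
    qed
    then show "\<exists>no. \<forall>n\<ge>no. norm (measure (M n) (E n) - 1) < r" by (simp add: eventually_sequentially)
  qed
  then show ?thesis unfolding with_prob_tending_to_one_def using E(1) by (auto simp: good_def)
qed

lemma big_O_pI:
  assumes prob: "\<And>n. k \<le> n \<Longrightarrow> prob_space (M n)"
    and ev: "\<And>\<delta>. 0 < \<delta> \<Longrightarrow> \<exists>C>0. \<forall>\<^sub>F n in sequentially.
      \<exists>E\<in>sets (M n). 1 - \<delta> \<le> measure (M n) E \<and> (\<forall>\<omega>\<in>E. \<bar>X n \<omega>\<bar> \<le> C * \<bar>r n\<bar>)"
  shows "big_O_p M X r"
  unfolding big_O_p_def
proof (intro allI impI)
  fix \<delta> :: real assume "0 < \<delta>"
  then obtain C where C: "0 < C" "\<forall>\<^sub>F n in sequentially.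
      \<exists>E\<in>sets (M n). 1 - \<delta> \<le> measure (M n) E \<and> (\<forall>\<omega>\<in>E. \<bar>X n \<omega>\<bar> \<le> C * \<bar>r n\<bar>)" using ev by blast
  have "\<forall>\<^sub>F n in sequentially.
      \<exists>E\<in>sets (M n). {\<omega> \<in> space (M n). \<bar>X n \<omega>\<bar> > C * \<bar>r n\<bar>} \<subseteq> E \<and> measure (M n) E \<le> \<delta>"
    using C(2) eventually_ge_at_top[of k]
  proof eventually_elim
    case (elim n)
    interpret prob_space "M n" by (rule prob) (use elim in simp)
    obtain E where E: "E \<in> sets (M n)" "1 - \<delta> \<le> measure (M n) E" "\<forall>\<omega>\<in>E. \<bar>X n \<omega>\<bar> \<le> C * \<bar>r n\<bar>"
      using elim by blast
    have "measure (M n) (space (M n) - E) \<le> \<delta>" using prob_compl[OF E(1)] E(2) by simp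
    moreover have "{\<omega> \<in> space (M n). \<bar>X n \<omega>\<bar> > C * \<bar>r n\<bar>} \<subseteq> space (M n) - E" using E(3) by force
    ultimately show ?case using E(1) by blast
  qed
  then show "\<exists>C>0. \<forall>\<^sub>F n in sequentially.
      \<exists>E\<in>sets (M n). {\<omega> \<in> space (M n). \<bar>X n \<omega>\<bar> > C * \<bar>r n\<bar>} \<subseteq> E \<and> measure (M n) E \<le> \<delta>"
    using C(1) by blast
qed

section \<open>Assembly of the estimates for one network and for the sequence\<close>

lemma lin_pred_le_rho:
  assumes n: "2 \<le> n" and Z: "\<And>i j. (i, j) \<in> node_pairs n \<Longrightarrow> Z i j \<in> carrier_vec p"
    and Z_le: "\<And>i j t. (i, j) \<in> node_pairs n \<Longrightarrow> t < p \<Longrightarrow> \<bar>Z i j $ t\<bar> \<le> q"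
    and \<theta>s: "\<theta>s \<in> carrier_vec (2 * n - 1)" and \<gamma>s: "\<gamma>s \<in> carrier_vec p"
    and \<theta>: "\<theta> \<in> ball_inf \<theta>s \<epsilon>1" and \<gamma>: "\<gamma> \<in> ball_inf \<gamma>s \<epsilon>2" and \<epsilon>1: "0 \<le> \<epsilon>1"
    and p: "1 \<le> p" and q: "0 \<le> q" and ij: "(i, j) \<in> node_pairs n"
  shows "\<bar>lin_pred n Z \<theta> \<gamma> i j\<bar> \<le> rho n p q \<theta>s \<gamma>s \<epsilon>1 \<epsilon>2"
proof -
  have \<theta>c: "\<theta> \<in> carrier_vec (2 * n - 1)" "vec_norm_inf (\<theta>s - \<theta>) \<le> \<epsilon>1" using \<theta> \<theta>s by (auto simp: ball_inf_def)
  have \<gamma>c: "\<gamma> \<in> carrier_vec p" "vec_norm_inf (\<gamma>s - \<gamma>) \<le> \<epsilon>2" using \<gamma> \<gamma>s by (auto simp: ball_inf_def)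
  have ij': "i < n" "j < n" using ij by (auto simp: node_pairs_def)
  have d\<theta>: "\<bar>\<theta>s $ k - \<theta> $ k\<bar> \<le> \<epsilon>1" if "k < 2 * n - 1" for k
    using vec_norm_inf_ge[of k "\<theta>s - \<theta>"] that \<theta>c \<theta>s by auto
  have d\<gamma>: "\<bar>\<gamma>s $ t - \<gamma> $ t\<bar> \<le> \<epsilon>2" if "t < p" for t
    using vec_norm_inf_ge[of t "\<gamma>s - \<gamma>"] that \<gamma>c \<gamma>s by auto
  have \<gamma>_le: "\<bar>\<gamma> $ t\<bar> \<le> vec_norm_inf \<gamma>s + \<epsilon>2" if "t < p" for t
    using vec_norm_inf_ge[of t \<gamma>s] d\<gamma>[OF that] that \<gamma>s by auto
  have "\<bar>out_par \<theta> i - out_par \<theta>s i\<bar> \<le> \<epsilon>1" using d\<theta>[of i] ij' n by (simp add: out_par_def abs_minus_commute)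
  moreover have "\<bar>in_par n \<theta> j - in_par n \<theta>s j\<bar> \<le> \<epsilon>1"
    using d\<theta>[of "n + j"] \<epsilon>1 by (simp add: in_par_def abs_minus_commute)
  moreover have "\<bar>out_par \<theta>s i + in_par n \<theta>s j\<bar> \<le> Max ((\<lambda>(i, j). \<bar>out_par \<theta>s i + in_par n \<theta>s j\<bar>) ` node_pairs n)"
    using ij by (intro Max_ge) auto
  moreover have "\<bar>Z i j \<bullet> \<gamma>\<bar> \<le> real p * q * (vec_norm_inf \<gamma>s + \<epsilon>2)"
  proof -
    have "\<bar>Z i j \<bullet> \<gamma>\<bar> = \<bar>\<Sum>t<p. Z i j $ t * \<gamma> $ t\<bar>" using \<gamma>c by (simp add: scalar_prod_def lessThan_atLeast0)
    also have "\<dots> \<le> (\<Sum>t<p. \<bar>Z i j $ t\<bar> * \<bar>\<gamma> $ t\<bar>)" unfolding abs_mult[symmetric] by (rule sum_abs)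
    also have "\<dots> \<le> (\<Sum>t<p. q * (vec_norm_inf \<gamma>s + \<epsilon>2))"
      using Z_le[OF ij] \<gamma>_le q by (intro sum_mono mult_mono) auto
    finally show ?thesis by simp
  qed
  ultimately show ?thesis unfolding lin_pred_def rho_def by (simp add: algebra_simps)
qed

lemma rho_nonneg:
  assumes "2 \<le> n" "\<gamma> \<in> carrier_vec p" "1 \<le> p" "0 \<le> q" "0 \<le> \<epsilon>1" "0 \<le> \<epsilon>2"
  shows "0 \<le> rho n p q \<theta> \<gamma> \<epsilon>1 \<epsilon>2"
proof -
  have "(0, 1) \<in> node_pairs n" using assms(1) by (auto simp: node_pairs_def)
  then have "\<bar>out_par \<theta> 0 + in_par n \<theta> 1\<bar> \<le> Max ((\<lambda>(i, j). \<bar>out_par \<theta> i + in_par n \<theta> j\<bar>) ` node_pairs n)"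
    by (intro Max_ge) auto
  moreover have "0 \<le> vec_norm_inf \<gamma>" using vec_norm_inf_ge[of 0 \<gamma>] assms by auto
  ultimately show ?thesis unfolding rho_def using assms by (smt (verit) mult_nonneg_nonneg of_nat_0_le_iff)
qed

lemma H_mat_carrier:
  assumes "positive_definite (H_mat n p Z d b y \<theta> \<gamma>)"
  shows "H_mat n p Z d b y \<theta> \<gamma> \<in> carrier_mat p p"
proof -
  have "dim_row (H_mat n p Z d b y \<theta> \<gamma>) = p" by (simp add: H_mat_def jacobian_def Q_map_def cov_sum_def)
  then show ?thesis using assms by (simp add: positive_definite_def)
qed

text \<open>Yields the nonnegativity of \<open>lam\<close>, which bounds such a norm after division
  by n^2.\<close>

lemma mat_norm_inf_inv_nonneg:
  assumes pd: "positive_definite A" and A: "A \<in> carrier_mat p p" and p: "1 \<le> p"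
  shows "0 \<le> mat_norm_inf (inv_mat A)"
proof -
  have "v = 0\<^sub>v p" if "v \<in> carrier_vec p" "A *\<^sub>v v = 0\<^sub>v p" for v
    using pd that A unfolding positive_definite_def by fastforce
  then have "inv_mat A \<in> carrier_mat p p" by (rule inv_mat_trivial_kernel(1)[OF A])
  then have "0 \<in> {..<dim_row (inv_mat A)}" using p by auto
  then have "(\<Sum>j<dim_col (inv_mat A). \<bar>inv_mat A $$ (0, j)\<bar>) \<le> mat_norm_inf (inv_mat A)"
    unfolding mat_norm_inf_def by (intro Max_ge) auto
  then show ?thesis by (rule order_trans[rotated]) (simp add: sum_nonneg)
qed

text \<open>The true parameter lies in its own balls, so \<rho> bounds the true predictors and
  exp(-\<rho>) / 4 bounds the weights from below; this fixes \<open>m\<close>. Uniqueness is part of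
  the conclusion because an estimator is known only as some solution of the equations.\<close>

lemma network_rates:
  fixes M :: "'w measure" and Z :: "nat \<Rightarrow> nat \<Rightarrow> real vec" and K q \<epsilon> \<epsilon>1 \<epsilon>2 lam varpi :: real and n p :: nat
    and \<theta>s \<gamma>s :: "real vec" and a :: "nat \<Rightarrow> nat \<Rightarrow> 'w \<Rightarrow> real" and ep em :: "nat \<Rightarrow> 'w \<Rightarrow> int"
    and eta :: "nat \<Rightarrow> 'w \<Rightarrow> real"
  defines "\<rho> \<equiv> rho n p q \<theta>s \<gamma>s \<epsilon>1 \<epsilon>2" and "P \<equiv> 1 + real p * q" and "e \<equiv> 1 + 8 / \<epsilon>"
    and "l \<equiv> ln (real n)"
  assumes N: "noisy_network M n p (\<lambda>i j. mu (lin_pred n Z \<theta>s \<gamma>s i j)) a ep em eta \<epsilon> (real p * q / \<epsilon>)"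
    and Z: "\<And>i j. (i, j) \<in> node_pairs n \<Longrightarrow> Z i j \<in> carrier_vec p"
    and Z_le: "\<And>i j t. (i, j) \<in> node_pairs n \<Longrightarrow> t < p \<Longrightarrow> \<bar>Z i j $ t\<bar> \<le> q"
    and \<theta>s: "\<theta>s \<in> carrier_vec (2 * n - 1)" and \<gamma>s: "\<gamma>s \<in> carrier_vec p"
    and n3: "3 \<le> n" and p: "1 \<le> p" and q: "0 < q" and K: "0 < K" and \<epsilon>: "0 < \<epsilon>" "0 < \<epsilon>1" "0 < \<epsilon>2"
    and H: "positive_definite (H_mat n p Z d b y \<theta>s \<gamma>s)"
    and H_inv: "mat_norm_inf (inv_mat (H_mat n p Z d b y \<theta>s \<gamma>s)) \<le> lam / (real n)\<^sup>2"
    and t1: "exp (6 * \<rho>) * (e * sqrt (l / real n)) \<le> 1 / (32768 * P)"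
    and t2: "8388608 * q * P\<^sup>2 * (lam * exp (9 * \<rho>) * (e * sqrt (l / real n))) \<le> 1 / 4"
      "128 * K * (2 + real p) * q * (lam * exp (9 * \<rho>) * (e * sqrt (l / real n))) \<le> 1"
    and varpi: "exp (9 * \<rho>) * e\<^sup>2 \<le> varpi"
  defines "solves \<equiv> \<lambda>\<omega>. moment_solution n p Z
        (\<lambda>i. out_sum n (\<lambda>i j. a i j \<omega>) i + real_of_int (ep i \<omega>))
        (\<lambda>j. in_sum n (\<lambda>i j. a i j \<omega>) j + real_of_int (em j \<omega>))
        (cov_sum n p Z (\<lambda>i j. a i j \<omega>) + vec p (\<lambda>t. eta t \<omega>))"
  shows "\<exists>E\<in>sets M. 1 - (4 / real n + 8 / l + real p * (1 / K\<^sup>2 + exp (- K))) \<le> measure M E \<and>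
    (\<forall>\<omega>\<in>E. \<exists>\<theta> \<gamma>. solves \<omega> \<theta> \<gamma> \<and> (\<forall>\<theta>' \<gamma>'. solves \<omega> \<theta>' \<gamma>' \<longrightarrow> \<theta>' = \<theta> \<and> \<gamma>' = \<gamma>)
      \<and> vec_norm_inf (\<theta> - \<theta>s) \<le> 8192 * P * (exp (3 * \<rho>) * e * sqrt (l / real n))
      \<and> vec_norm_inf (\<gamma> - \<gamma>s)
          \<le> (128 * K * (2 + real p) * q + 33554432 * q * P\<^sup>2) * (varpi * lam * l / real n))"
proof -
  have n: "2 \<le> n" using n3 by simp
  define m where "m = exp (- \<rho>) / 4"
  define \<Lambda> where "\<Lambda> = lam / (real n)\<^sup>2"
  have lam: "0 \<le> lam"
  proof -
    have "0 \<le> lam / (real n)\<^sup>2"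
      using order_trans[OF mat_norm_inf_inv_nonneg[OF H H_mat_carrier[OF H] p] H_inv] .
    then show ?thesis using n by (simp add: zero_le_divide_iff)
  qed
  have \<rho>: "0 \<le> \<rho>" unfolding \<rho>_def using n \<gamma>s p q \<epsilon> by (intro rho_nonneg) auto
  have e: "1 \<le> e" using \<epsilon> by (simp add: e_def)
  have l: "1 \<le> l" unfolding l_def by (rule ln_ge_1[OF n3])
  have P: "1 \<le> P" using q by (simp add: P_def)
  note rates = rate_inequalities[where \<rho> = \<rho> and e = e and lam = lam and N = "real n" and l = l and P = P
      and q = q and K = K and c = "2 + real p" and varpi = varpi, OF \<rho> e lam _ l P _ _ _ t1 t2 varpi,
      folded m_def \<Lambda>_def]
  have w: "m \<le> mu_deriv (lin_pred n Z \<theta>s \<gamma>s i j)" if "i < n" "j < n" "i \<noteq> j" for i j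
  proof -
    have refl: "x \<in> ball_inf x \<delta>" if "0 < dim_vec x" "0 < \<delta>" for x \<delta>
      using that by (auto simp: ball_inf_def intro!: vec_norm_inf_le)
    have "\<bar>lin_pred n Z \<theta>s \<gamma>s i j\<bar> \<le> \<rho>"
      unfolding \<rho>_def using n Z Z_le \<theta>s \<gamma>s refl \<epsilon> p q that
      by (intro lin_pred_le_rho[where p = p]) (auto simp: node_pairs_def)
    then have "m \<le> exp (- \<bar>lin_pred n Z \<theta>s \<gamma>s i j\<bar>) / 4" by (simp add: m_def)
    then show ?thesis using mu_deriv_ge_exp order_trans by blast
  qed
  have large: "1 \<le> 2 * m\<^sup>2 * real (n - 1)" using rates(1) n3 q K by (simp add: of_nat_diff)
  have "\<exists>L. two_way_design n p (cov Z) q m \<Lambda> (\<lambda>i j. mu_deriv (lin_pred n Z \<theta>s \<gamma>s i j)) L"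
    using Z_le q lam H_inv
    by (intro two_way_design_H_mat[OF n Z \<theta>s \<gamma>s _ _ _ large _ w H]) (auto simp: m_def \<Lambda>_def node_pairs_def)
  then obtain L where D: "two_way_design n p (cov Z) q m \<Lambda> (\<lambda>i j. mu_deriv (lin_pred n Z \<theta>s \<gamma>s i j)) L" ..
  have side: "3 \<le> real n" "0 \<le> q" "0 \<le> K" "0 \<le> 2 + real p" using n3 q K by auto
  have unique: "\<theta>' = \<theta> \<and> \<gamma>' = \<gamma>" if "solves \<omega> \<theta> \<gamma>" "solves \<omega> \<theta>' \<gamma>'" for \<omega> \<theta> \<gamma> \<theta>' \<gamma>'
    using that unfolding solves_def
    by (intro moment_solution_unique[OF D Z]) (auto intro!: carrier_vecI simp: cov_sum_def)
  define r where "r = 64 * (1 / m ^ 3) * P * (2 * e * sqrt (real n * l) / real n)"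
  define R where "R = 2 * (\<Lambda> * (K * (2 + real p) * q * real n * (1 / m ^ 3) * e))
        + 2 * (16 * (\<Lambda> * (real n)\<^sup>2) * r * q * (1 / m ^ 3) * P) * (2 * e * sqrt (real n * l) / real n)"
  have "\<exists>E\<in>sets M. 1 - (4 / real n + 8 / l + real p * (1 / K\<^sup>2 + exp (- K))) \<le> measure M E \<and>
    (\<forall>\<omega>\<in>E. \<exists>\<theta> \<gamma>. solves \<omega> \<theta> \<gamma> \<and> vec_norm_inf (\<theta> - \<theta>s) \<le> r \<and> vec_norm_inf (\<gamma> - \<gamma>s) \<le> R)"
    unfolding solves_def R_def r_def P_def e_def l_def
    by (rule network_solution[where K = K, OF N D Z \<theta>s \<gamma>s n3 p q K])
      (assumption | rule rates(2-4)[OF side, unfolded P_def e_def l_def])+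
  then obtain E where E: "E \<in> sets M" "1 - (4 / real n + 8 / l + real p * (1 / K\<^sup>2 + exp (- K))) \<le> measure M E"
    "\<And>\<omega>. \<omega> \<in> E \<Longrightarrow> \<exists>\<theta> \<gamma>. solves \<omega> \<theta> \<gamma> \<and> vec_norm_inf (\<theta> - \<theta>s) \<le> r \<and> vec_norm_inf (\<gamma> - \<gamma>s) \<le> R"
    by auto
  have r: "r = 8192 * P * (exp (3 * \<rho>) * e * sqrt (l / real n))" unfolding r_def by (rule rates(5)[OF side])
  have R: "R \<le> (128 * K * (2 + real p) * q + 33554432 * q * P\<^sup>2) * (varpi * lam * l / real n)"
    unfolding R_def r_def by (rule rates(6)[OF side])
  show ?thesis
  proof (intro bexI[OF _ E(1)] conjI E(2) ballI)
    fix \<omega> assume "\<omega> \<in> E"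
    then obtain \<theta> \<gamma> where S: "solves \<omega> \<theta> \<gamma>" "vec_norm_inf (\<theta> - \<theta>s) \<le> r" "vec_norm_inf (\<gamma> - \<gamma>s) \<le> R"
      using E(3) by blast
    show "\<exists>\<theta> \<gamma>. solves \<omega> \<theta> \<gamma> \<and> (\<forall>\<theta>' \<gamma>'. solves \<omega> \<theta>' \<gamma>' \<longrightarrow> \<theta>' = \<theta> \<and> \<gamma>' = \<gamma>)
      \<and> vec_norm_inf (\<theta> - \<theta>s) \<le> 8192 * P * (exp (3 * \<rho>) * e * sqrt (l / real n))
      \<and> vec_norm_inf (\<gamma> - \<gamma>s)
          \<le> (128 * K * (2 + real p) * q + 33554432 * q * P\<^sup>2) * (varpi * lam * l / real n)"
      using S(1) S(2)[unfolded r] order_trans[OF S(3) R] unique[OF S(1)] by blast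
  qed
qed

text \<open>The estimator is any pair of functions that solve the moment equations whenever a
  solution exists; its values elsewhere are arbitrary, and on the good events uniqueness determines
  it.\<close>

theorem theorem1:
  fixes p :: nat and q :: real
    and M :: "nat \<Rightarrow> 'w measure"
    and Z :: "nat \<Rightarrow> nat \<Rightarrow> nat \<Rightarrow> real vec"
    and \<theta>s \<gamma>s :: "nat \<Rightarrow> real vec"
    and a :: "nat \<Rightarrow> nat \<Rightarrow> nat \<Rightarrow> 'w \<Rightarrow> real"
    and ep em :: "nat \<Rightarrow> nat \<Rightarrow> 'w \<Rightarrow> int"
    and eta :: "nat \<Rightarrow> nat \<Rightarrow> 'w \<Rightarrow> real"
    and \<epsilon> \<epsilon>1 \<epsilon>2 lam :: "nat \<Rightarrow> real"
    and \<theta>hat \<gamma>hat :: "nat \<Rightarrow> 'w \<Rightarrow> real vec"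
    and d b :: "nat \<Rightarrow> 'w \<Rightarrow> nat \<Rightarrow> real" and y :: "nat \<Rightarrow> 'w \<Rightarrow> real vec"
    and \<rho> \<epsilon>t varpi :: "nat \<Rightarrow> real"
  defines "d \<equiv> \<lambda>n \<omega> i. out_sum n (\<lambda>i j. a n i j \<omega>) i + real_of_int (ep n i \<omega>)"
    and "b \<equiv> \<lambda>n \<omega> j. in_sum n (\<lambda>i j. a n i j \<omega>) j + real_of_int (em n j \<omega>)"
    and "y \<equiv> \<lambda>n \<omega>. cov_sum n p (Z n) (\<lambda>i j. a n i j \<omega>) + vec p (\<lambda>t. eta n t \<omega>)"
    and "\<rho> \<equiv> \<lambda>n. rho n p q (\<theta>s n) (\<gamma>s n) (\<epsilon>1 n) (\<epsilon>2 n)"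
    and "\<epsilon>t \<equiv> \<lambda>n. 1 + 8 / \<epsilon> n"
    and "varpi \<equiv> \<lambda>n. q / sqrt (ln n) + p * q / (n * \<epsilon> n) + exp (9 * \<rho> n) * (1 + 8 / \<epsilon> n)\<^sup>2"
  assumes p: "p \<ge> 1"
    and Z_carrier: "\<And>n i j. n \<ge> 2 \<Longrightarrow> (i, j) \<in> node_pairs n \<Longrightarrow> Z n i j \<in> carrier_vec p"
    and q: "\<And>n. n \<ge> 2 \<Longrightarrow> q = Max ((\<lambda>(i, j). vec_norm_inf (Z n i j)) ` node_pairs n)"
    and \<theta>s_carrier: "\<And>n. n \<ge> 2 \<Longrightarrow> \<theta>s n \<in> carrier_vec (2 * n - 1)"
    and \<gamma>s_carrier: "\<And>n. n \<ge> 2 \<Longrightarrow> \<gamma>s n \<in> carrier_vec p"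
    and \<epsilon>_pos: "\<And>n. n \<ge> 2 \<Longrightarrow> \<epsilon> n > 0"
    and \<epsilon>1_pos: "\<And>n. n \<ge> 2 \<Longrightarrow> \<epsilon>1 n > 0"
    and \<epsilon>2_pos: "\<And>n. n \<ge> 2 \<Longrightarrow> \<epsilon>2 n > 0"
    and prob_space: "\<And>n. n \<ge> 2 \<Longrightarrow> prob_space (M n)"
    and independent: "\<And>n. n \<ge> 2 \<Longrightarrow>
          prob_space.indep_vars (M n) (\<lambda>_. borel) (source_var (a n) (ep n) (em n) (eta n)) (sources n p)"
    and edge_range: "\<And>n i j \<omega>. n \<ge> 2 \<Longrightarrow> (i, j) \<in> node_pairs n \<Longrightarrow> \<omega> \<in> space (M n) \<Longrightarrow>
          a n i j \<omega> \<in> {0, 1}"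
    and no_loops: "\<And>n i \<omega>. n \<ge> 2 \<Longrightarrow> i < n \<Longrightarrow> \<omega> \<in> space (M n) \<Longrightarrow> a n i i \<omega> = 0"
    and edge_prob: "\<And>n i j. n \<ge> 2 \<Longrightarrow> (i, j) \<in> node_pairs n \<Longrightarrow>
          measure (M n) {\<omega> \<in> space (M n). a n i j \<omega> = 1} = mu (lin_pred n (Z n) (\<theta>s n) (\<gamma>s n) i j)"
    and ep_dist: "\<And>n i. n \<ge> 2 \<Longrightarrow> i < n \<Longrightarrow> discrete_laplace (M n) (exp (- \<epsilon> n / 2)) (ep n i)"
    and em_dist: "\<And>n j. n \<ge> 2 \<Longrightarrow> j < n \<Longrightarrow> discrete_laplace (M n) (exp (- \<epsilon> n / 2)) (em n j)"
    and eta_dist: "\<And>n t. n \<ge> 2 \<Longrightarrow> t < p \<Longrightarrow>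
          distributed (M n) lborel (eta n t) (\<lambda>x. ennreal (laplace_density (p * q / \<epsilon> n) x))"
    and H_pos_def: "\<forall>\<^sub>F n in sequentially. \<forall>\<omega>\<in>space (M n).
          \<forall>\<theta>\<in>carrier_vec (2 * n - 1). \<forall>\<gamma>\<in>carrier_vec p.
            positive_definite (H_mat n p (Z n) (d n \<omega>) (b n \<omega>) (y n \<omega>) \<theta> \<gamma>)"
    and lam_bound: "\<forall>\<^sub>F n in sequentially. \<forall>\<omega>\<in>space (M n). \<forall>\<theta>\<in>ball_inf (\<theta>s n) (\<epsilon>1 n).
          mat_norm_inf (inv_mat (H_mat n p (Z n) (d n \<omega>) (b n \<omega>) (y n \<omega>) \<theta> (\<gamma>s n)))
            \<le> lam n / (real n)\<^sup>2"
    and rate1: "(\<lambda>n. \<epsilon>t n * exp (6 * \<rho> n)) \<in> o(\<lambda>n. sqrt (real n / ln n))"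
    and rate2: "(\<lambda>n. varpi n * (lam n)\<^sup>2 * exp (9 * \<rho> n)) \<in> o(\<lambda>n. real n / ln n)"
    and estimator: "\<And>n \<omega>. n \<ge> 2 \<Longrightarrow> \<omega> \<in> space (M n) \<Longrightarrow>
          (\<exists>\<theta> \<gamma>. moment_solution n p (Z n) (d n \<omega>) (b n \<omega>) (y n \<omega>) \<theta> \<gamma>) \<Longrightarrow>
          moment_solution n p (Z n) (d n \<omega>) (b n \<omega>) (y n \<omega>) (\<theta>hat n \<omega>) (\<gamma>hat n \<omega>)"
  shows "(\<forall>n\<ge>2. \<forall>\<theta>\<in>ball_inf (\<theta>s n) (\<epsilon>1 n). \<forall>\<gamma>\<in>ball_inf (\<gamma>s n) (\<epsilon>2 n). \<forall>(i, j)\<in>node_pairs n.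
            \<bar>lin_pred n (Z n) \<theta> \<gamma> i j\<bar> \<le> \<rho> n)
    \<and> with_prob_tending_to_one M
          (\<lambda>n \<omega>. \<exists>\<theta> \<gamma>. moment_solution n p (Z n) (d n \<omega>) (b n \<omega>) (y n \<omega>) \<theta> \<gamma>)
    \<and> big_O_p M (\<lambda>n \<omega>. vec_norm_inf (\<theta>hat n \<omega> - \<theta>s n))
          (\<lambda>n. exp (3 * \<rho> n) * \<epsilon>t n * sqrt (ln n / n))
    \<and> big_O_p M (\<lambda>n \<omega>. vec_norm_inf (\<gamma>hat n \<omega> - \<gamma>s n))
          (\<lambda>n. varpi n * lam n * ln n / n)"
proof -
  have q_norm: "vec_norm_inf (Z n i j) \<le> q" if "2 \<le> n" "(i, j) \<in> node_pairs n" for n i j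
    unfolding q[OF that(1)] using that(2) by (intro Max_ge) auto
  have Z_le: "\<bar>Z n i j $ t\<bar> \<le> q" if "2 \<le> n" "(i, j) \<in> node_pairs n" "t < p" for n i j t
    using vec_norm_inf_ge[of t "Z n i j"] Z_carrier[OF that(1,2)] q_norm[OF that(1,2)] that(3) by auto
  \<comment> \<open>For q = 0 the Laplace scale would be 0 and, division by 0 being 0, the assumed
    density would vanish identically, contradicting total mass 1.\<close>
  have q_pos: "0 < q"
  proof (rule ccontr)
    assume "\<not> 0 < q"
    moreover have "0 \<le> q" using Z_le[of 2 0 1 0] p by (fastforce simp: node_pairs_def)
    ultimately have "q = 0" by simp
    interpret prob_space "M 2" by (rule prob_space) simp
    have "emeasure (M 2) (eta 2 0 -` UNIV \<inter> space (M 2))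
        = (\<integral>\<^sup>+ x. ennreal (laplace_density (p * q / \<epsilon> 2) x) * indicator UNIV x \<partial>lborel)"
      using p by (intro distributed_emeasure eta_dist) auto
    also have "\<dots> = 0" using \<open>q = 0\<close> by (simp add: laplace_density_def)
    finally show False using emeasure_space_1 by simp
  qed
  have bound: "\<bar>lin_pred n (Z n) \<theta> \<gamma> i j\<bar> \<le> \<rho> n"
    if "2 \<le> n" "\<theta> \<in> ball_inf (\<theta>s n) (\<epsilon>1 n)" "\<gamma> \<in> ball_inf (\<gamma>s n) (\<epsilon>2 n)" "(i, j) \<in> node_pairs n" for n \<theta> \<gamma> i j
    unfolding \<rho>_def using that q_pos p \<epsilon>1_pos Z_carrier Z_le \<theta>s_carrier \<gamma>s_carrier
    by (intro lin_pred_le_rho[where p = p]) (auto simp: less_imp_le)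
  define P where "P = 1 + real p * q"
  have P: "1 \<le> P" using q_pos by (simp add: P_def)
  define s where "s n = \<epsilon>t n * sqrt (ln (real n) / real n)" for n
  have \<epsilon>t: "1 \<le> \<epsilon>t n" if "2 \<le> n" for n using \<epsilon>_pos[OF that] by (simp add: \<epsilon>t_def)
  have varpi: "exp (9 * \<rho> n) * (\<epsilon>t n)\<^sup>2 \<le> varpi n" if "2 \<le> n" for n
    using that q_pos \<epsilon>_pos[OF that] by (simp add: varpi_def \<epsilon>t_def)
  have t1: "\<forall>\<^sub>F n in sequentially. exp (6 * \<rho> n) * s n \<le> c" if "0 < c" for c
  proof -
    have "(\<lambda>n. \<epsilon>t n * exp (6 * \<rho> n) / sqrt (real n / ln (real n))) \<longlonglongrightarrow> 0"
      by (rule smalloD_tendsto[OF rate1])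
    then have "\<forall>\<^sub>F n in sequentially. \<epsilon>t n * exp (6 * \<rho> n) / sqrt (real n / ln (real n)) < c"
      using that by (rule order_tendstoD(2))
    then show ?thesis
      by eventually_elim (simp add: s_def real_sqrt_divide ac_simps)
  qed
  have t2: "\<forall>\<^sub>F n in sequentially. lam n * exp (9 * \<rho> n) * s n \<le> c" if c: "0 < c" for c
  proof -
    have "(\<lambda>n. varpi n * (lam n)\<^sup>2 * exp (9 * \<rho> n) / (real n / ln (real n))) \<longlonglongrightarrow> 0"
      by (rule smalloD_tendsto[OF rate2])
    then have "\<forall>\<^sub>F n in sequentially. varpi n * (lam n)\<^sup>2 * exp (9 * \<rho> n) / (real n / ln (real n)) < c\<^sup>2"
      using c by (intro order_tendstoD(2)) auto
    then show ?thesis using eventually_ge_at_top[of 2]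
    proof eventually_elim
      case (elim n)
      \<comment> \<open>The second rate condition is quadratic in \<open>lam\<close>. As
        \<open>varpi\<close> dominates exp(9 \<rho>) times the squared noise factor, the condition
        controls the square of the quantity in question.\<close>
      have "(lam n * exp (9 * \<rho> n) * s n)\<^sup>2
          = exp (9 * \<rho> n) * (\<epsilon>t n)\<^sup>2 * ((lam n)\<^sup>2 * exp (9 * \<rho> n) * (ln (real n) / real n))"
      proof -
        have sq: "(sqrt (ln (real n) / real n))\<^sup>2 = ln (real n) / real n" using elim by simp
        show ?thesis unfolding s_def power_mult_distrib sq by (simp add: power2_eq_square)
      qed
      also have "\<dots> \<le> varpi n * ((lam n)\<^sup>2 * exp (9 * \<rho> n) * (ln (real n) / real n))"
        using elim by (intro mult_right_mono varpi) auto
      also have "\<dots> = varpi n * (lam n)\<^sup>2 * exp (9 * \<rho> n) / (real n / ln (real n))" by simp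
      also have "\<dots> \<le> c\<^sup>2" using elim by simp
      finally show ?case by (rule power2_le_imp_le) (use c in simp)
    qed
  qed
  define good where "good C n \<omega> \<longleftrightarrow>
      (\<exists>\<theta> \<gamma>. moment_solution n p (Z n) (d n \<omega>) (b n \<omega>) (y n \<omega>) \<theta> \<gamma>)
      \<and> \<bar>vec_norm_inf (\<theta>hat n \<omega> - \<theta>s n)\<bar> \<le> C * \<bar>exp (3 * \<rho> n) * \<epsilon>t n * sqrt (ln (real n) / real n)\<bar>
      \<and> \<bar>vec_norm_inf (\<gamma>hat n \<omega> - \<gamma>s n)\<bar> \<le> C * \<bar>varpi n * lam n * ln (real n) / real n\<bar>" for C n \<omega>
  \<comment> \<open>One event and one constant serve all three asymptotic claims; \<open>C\<close>
    depends on \<delta> through \<open>K\<close>.\<close>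
  have core: "\<exists>C>0. \<forall>\<^sub>F n in sequentially. \<exists>E\<in>sets (M n). 1 - \<delta> \<le> measure (M n) E \<and>
      (\<forall>\<omega>\<in>E. good C n \<omega>)" if \<delta>: "0 < \<delta>" for \<delta>
  proof -
    \<comment> \<open>For K >= 1 both 1 / K^2 and exp(-K) are at most 1 / K, so K >= 4 p / \<delta>
      leaves at most \<delta> / 2 for the scores and continuous noises.\<close>
    define K where "K = max 1 (4 * real p / \<delta>)"
    have K: "1 \<le> K" "4 * real p / \<delta> \<le> K" by (auto simp: K_def)
    have K_tail: "real p * (1 / K\<^sup>2 + exp (- K)) \<le> \<delta> / 2"
    proof -
      have "1 / K\<^sup>2 \<le> 1 / K" using K(1) by (intro divide_left_mono) (auto simp: power2_eq_square)
      moreover have "K \<le> exp K" using exp_ge_add_one_self[of K] by linarith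
      then have "exp (- K) \<le> 1 / K" using K(1) by (simp add: exp_minus field_simps)
      ultimately have "real p * (1 / K\<^sup>2 + exp (- K)) \<le> real p * (2 / K)" by (intro mult_left_mono) auto
      also have "\<dots> \<le> \<delta> / 2" using K \<delta> by (simp add: field_simps)
      finally show ?thesis .
    qed
    define C where "C = 8192 * P + (128 * K * (2 + real p) * q + 33554432 * q * P\<^sup>2)"
    have C0: "0 \<le> 128 * K * (2 + real p) * q + 33554432 * q * P\<^sup>2" using K q_pos by simp
    have C: "0 < C" "8192 * P \<le> C" "128 * K * (2 + real p) * q + 33554432 * q * P\<^sup>2 \<le> C"
      using C0 P by (auto simp: C_def)
    have "\<forall>\<^sub>F n in sequentially. 4 / real n + 8 / ln (real n) < \<delta> / 2"
    proof (rule order_tendstoD(2))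
      show "(\<lambda>n. 4 / real n + 8 / ln (real n)) \<longlonglongrightarrow> 0" by real_asymp
    qed (use \<delta> in simp)
    moreover have "\<forall>\<^sub>F n in sequentially. exp (6 * \<rho> n) * s n \<le> 1 / (32768 * P)" using P by (intro t1) simp
    moreover have "\<forall>\<^sub>F n in sequentially. lam n * exp (9 * \<rho> n) * s n \<le> 1 / (4 * 8388608 * q * P\<^sup>2)"
      using P q_pos by (intro t2) simp
    moreover have "\<forall>\<^sub>F n in sequentially. lam n * exp (9 * \<rho> n) * s n \<le> 1 / (128 * K * (2 + real p) * q)"
      using K q_pos by (intro t2) simp
    ultimately have "\<forall>\<^sub>F n in sequentially. \<exists>E\<in>sets (M n). 1 - \<delta> \<le> measure (M n) E \<and>
      (\<forall>\<omega>\<in>E. good C n \<omega>)"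
      using H_pos_def lam_bound eventually_ge_at_top[of 3]
    proof eventually_elim
      case (elim n)
      then have n: "2 \<le> n" by simp
      interpret prob_space "M n" by (rule prob_space[OF n])
      \<comment> \<open>\<open>network_rates\<close> takes the conditions on \<open>H_mat\<close>
        for a single choice of data, so any one outcome provides them.\<close>
      obtain \<omega>0 where \<omega>0: "\<omega>0 \<in> space (M n)" using not_empty by blast
      have H: "positive_definite (H_mat n p (Z n) (d n \<omega>0) (b n \<omega>0) (y n \<omega>0) (\<theta>s n) (\<gamma>s n))"
        using elim(5) \<omega>0 \<theta>s_carrier[OF n] \<gamma>s_carrier[OF n] by blast
      have "\<theta>s n \<in> ball_inf (\<theta>s n) (\<epsilon>1 n)"
        using \<theta>s_carrier[OF n] \<epsilon>1_pos[OF n] n by (auto simp: ball_inf_def intro!: vec_norm_inf_le)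
      then have H_inv: "mat_norm_inf (inv_mat (H_mat n p (Z n) (d n \<omega>0) (b n \<omega>0) (y n \<omega>0) (\<theta>s n) (\<gamma>s n)))
          \<le> lam n / (real n)\<^sup>2"
        using elim(6) \<omega>0 by blast
      have N: "noisy_network (M n) n p (\<lambda>i j. mu (lin_pred n (Z n) (\<theta>s n) (\<gamma>s n) i j))
          (a n) (ep n) (em n) (eta n) (\<epsilon> n) (real p * q / \<epsilon> n)"
        using n \<epsilon>_pos[OF n] q_pos p independent[OF n] edge_range[OF n] edge_prob[OF n] ep_dist[OF n]
          em_dist[OF n] eta_dist[OF n]
        by unfold_locales auto
      have t2': "8388608 * q * P\<^sup>2 * (lam n * exp (9 * \<rho> n) * s n) \<le> 1 / 4"
        "128 * K * (2 + real p) * q * (lam n * exp (9 * \<rho> n) * s n) \<le> 1"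
      proof -
        have "8388608 * q * P\<^sup>2 * (lam n * exp (9 * \<rho> n) * s n) \<le> 8388608 * q * P\<^sup>2 * (1 / (4 * 8388608 * q * P\<^sup>2))"
          using elim(3) q_pos by (intro mult_left_mono) auto
        also have "\<dots> = 1 / 4" using q_pos P by simp
        finally show "8388608 * q * P\<^sup>2 * (lam n * exp (9 * \<rho> n) * s n) \<le> 1 / 4" .
        have "128 * K * (2 + real p) * q * (lam n * exp (9 * \<rho> n) * s n)
            \<le> 128 * K * (2 + real p) * q * (1 / (128 * K * (2 + real p) * q))"
          using elim(4) q_pos K by (intro mult_left_mono) auto
        also have "\<dots> = 1" using q_pos K p by simp
        finally show "128 * K * (2 + real p) * q * (lam n * exp (9 * \<rho> n) * s n) \<le> 1" .
      qed
      have "0 < K" using K by simp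
      obtain E where E: "E \<in> sets (M n)"
          "1 - (4 / real n + 8 / ln (real n) + real p * (1 / K\<^sup>2 + exp (- K))) \<le> measure (M n) E"
        and sol: "\<And>\<omega>. \<omega> \<in> E \<Longrightarrow> \<exists>\<theta> \<gamma>. moment_solution n p (Z n) (d n \<omega>) (b n \<omega>) (y n \<omega>) \<theta> \<gamma>
          \<and> (\<forall>\<theta>' \<gamma>'. moment_solution n p (Z n) (d n \<omega>) (b n \<omega>) (y n \<omega>) \<theta>' \<gamma>' \<longrightarrow> \<theta>' = \<theta> \<and> \<gamma>' = \<gamma>)
          \<and> vec_norm_inf (\<theta> - \<theta>s n) \<le> 8192 * P * (exp (3 * \<rho> n) * \<epsilon>t n * sqrt (ln (real n) / real n))
          \<and> vec_norm_inf (\<gamma> - \<gamma>s n)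
              \<le> (128 * K * (2 + real p) * q + 33554432 * q * P\<^sup>2) * (varpi n * lam n * ln (real n) / real n)"
        using network_rates[OF N Z_carrier[OF n] Z_le[OF n] \<theta>s_carrier[OF n] \<gamma>s_carrier[OF n] elim(7) p q_pos
            \<open>0 < K\<close> \<epsilon>_pos[OF n] \<epsilon>1_pos[OF n] \<epsilon>2_pos[OF n] H H_inv elim(2)[unfolded P_def s_def \<rho>_def \<epsilon>t_def]
            t2'[unfolded P_def s_def \<rho>_def \<epsilon>t_def] varpi[OF n, unfolded \<rho>_def \<epsilon>t_def]]
        unfolding d_def b_def y_def P_def \<rho>_def \<epsilon>t_def by auto
      show ?case unfolding good_def
      proof (intro bexI[OF _ E(1)] conjI ballI)
        show "1 - \<delta> \<le> measure (M n) E" using E(2) elim(1) K_tail by linarith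
      next
        fix \<omega> assume \<omega>: "\<omega> \<in> E"
        then have sp: "\<omega> \<in> space (M n)" using E(1) sets.sets_into_space by blast
        obtain \<theta> \<gamma> where S: "moment_solution n p (Z n) (d n \<omega>) (b n \<omega>) (y n \<omega>) \<theta> \<gamma>"
          "\<And>\<theta>' \<gamma>'. moment_solution n p (Z n) (d n \<omega>) (b n \<omega>) (y n \<omega>) \<theta>' \<gamma>' \<Longrightarrow> \<theta>' = \<theta> \<and> \<gamma>' = \<gamma>"
          "vec_norm_inf (\<theta> - \<theta>s n) \<le> 8192 * P * (exp (3 * \<rho> n) * \<epsilon>t n * sqrt (ln (real n) / real n))"
          "vec_norm_inf (\<gamma> - \<gamma>s n)
              \<le> (128 * K * (2 + real p) * q + 33554432 * q * P\<^sup>2) * (varpi n * lam n * ln (real n) / real n)"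
          using sol[OF \<omega>] by blast
        show ex: "\<exists>\<theta> \<gamma>. moment_solution n p (Z n) (d n \<omega>) (b n \<omega>) (y n \<omega>) \<theta> \<gamma>" using S(1) by blast
        have hat: "\<theta>hat n \<omega> = \<theta>" "\<gamma>hat n \<omega> = \<gamma>" using S(2)[OF estimator[OF n sp ex]] by auto
        have norm_nonneg: "0 \<le> vec_norm_inf (\<theta> - \<theta>s n)" "0 \<le> vec_norm_inf (\<gamma> - \<gamma>s n)"
          using vec_norm_inf_ge[of 0 "\<theta> - \<theta>s n"] vec_norm_inf_ge[of 0 "\<gamma> - \<gamma>s n"] n p
            \<theta>s_carrier[OF n] \<gamma>s_carrier[OF n] by auto
        \<comment> \<open>\<open>big_O_p\<close> compares with the modulus of the rate; this passes
          from the signed bound with its own constant to the modulus with the common constant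
          \<open>C\<close>.\<close>
        have le_abs: "x * r \<le> C * \<bar>r\<bar>" if "0 \<le> x" "x \<le> C" for x r :: real
          using that mult_mono[of x C r "\<bar>r\<bar>"] mult_left_mono[of r "\<bar>r\<bar>" x] mult_right_mono[of x C "\<bar>r\<bar>"] by linarith
        show "\<bar>vec_norm_inf (\<theta>hat n \<omega> - \<theta>s n)\<bar> \<le> C * \<bar>exp (3 * \<rho> n) * \<epsilon>t n * sqrt (ln (real n) / real n)\<bar>"
          unfolding hat using S(3) norm_nonneg(1) le_abs[OF _ C(2)] P by (smt (verit))
        show "\<bar>vec_norm_inf (\<gamma>hat n \<omega> - \<gamma>s n)\<bar> \<le> C * \<bar>varpi n * lam n * ln (real n) / real n\<bar>"
          unfolding hat using S(4) norm_nonneg(2) le_abs[OF C0 C(3)] by (smt (verit))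
      qed
    qed
    then show ?thesis using C(1) by blast
  qed
  have "with_prob_tending_to_one M
      (\<lambda>n \<omega>. \<exists>\<theta> \<gamma>. moment_solution n p (Z n) (d n \<omega>) (b n \<omega>) (y n \<omega>) \<theta> \<gamma>)"
  proof (rule with_prob_tending_to_oneI[where k = 2, OF prob_space])
    fix \<delta> :: real assume "0 < \<delta>"
    from core[OF this] obtain C where "\<forall>\<^sub>F n in sequentially. \<exists>E\<in>sets (M n). 1 - \<delta> \<le> measure (M n) E \<and>
      (\<forall>\<omega>\<in>E. good C n \<omega>)" by blast
    then show "\<forall>\<^sub>F n in sequentially. \<exists>E\<in>sets (M n). 1 - \<delta> \<le> measure (M n) E \<and>
        (\<forall>\<omega>\<in>E. \<exists>\<theta> \<gamma>. moment_solution n p (Z n) (d n \<omega>) (b n \<omega>) (y n \<omega>) \<theta> \<gamma>)"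
      unfolding good_def by eventually_elim blast
  qed
  moreover have "big_O_p M (\<lambda>n \<omega>. vec_norm_inf (\<theta>hat n \<omega> - \<theta>s n))
      (\<lambda>n. exp (3 * \<rho> n) * \<epsilon>t n * sqrt (ln n / n))"
  proof (rule big_O_pI[where k = 2, OF prob_space])
    fix \<delta> :: real assume "0 < \<delta>"
    from core[OF this] show "\<exists>C>0. \<forall>\<^sub>F n in sequentially. \<exists>E\<in>sets (M n). 1 - \<delta> \<le> measure (M n) E \<and>
        (\<forall>\<omega>\<in>E. \<bar>vec_norm_inf (\<theta>hat n \<omega> - \<theta>s n)\<bar> \<le> C * \<bar>exp (3 * \<rho> n) * \<epsilon>t n * sqrt (ln (real n) / real n)\<bar>)"
      unfolding good_def by (rule ex_forward) (erule conj_forward, assumption, erule eventually_mono, blast)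
  qed
  moreover have "big_O_p M (\<lambda>n \<omega>. vec_norm_inf (\<gamma>hat n \<omega> - \<gamma>s n)) (\<lambda>n. varpi n * lam n * ln n / n)"
  proof (rule big_O_pI[where k = 2, OF prob_space])
    fix \<delta> :: real assume "0 < \<delta>"
    from core[OF this] show "\<exists>C>0. \<forall>\<^sub>F n in sequentially. \<exists>E\<in>sets (M n). 1 - \<delta> \<le> measure (M n) E \<and>
        (\<forall>\<omega>\<in>E. \<bar>vec_norm_inf (\<gamma>hat n \<omega> - \<gamma>s n)\<bar> \<le> C * \<bar>varpi n * lam n * ln (real n) / real n\<bar>)"
      unfolding good_def by (rule ex_forward) (erule conj_forward, assumption, erule eventually_mono, blast)
  qed
  ultimately show ?thesis using bound by blast
qed

end
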